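(* (Regev's Formula.) Let $n\ge 2$ and let $\mu=(\mu_1,\ldots,\mu_r,1^s)$ be a partition of $n$ with $\mu_r>1$ (where $r,s\ge 0$). Then $$\chi_n(\mu)=\frac14\cdot s\cdot\prod_{j=1}^{r+s}\bigl(1+(-1)^{\mu_j-1}\bigr).$$
   Context: Let $V$ be the $(n-2)$-dimensional standard representation of the symmetric group $\mathcal{S}_{n-1}$ over $\mathbb{C}$, i.e. the permutation representation $\mathbb{C}^{n-1}$ modulo its invariant line (equivalently the vectors with coordinate sum $0$). $\mathcal{S}_{n-1}$ acts naturally on the exterior algebra $\wedge V$ (which is the direct sum of all Specht modules of $\mathcal{S}_{n-1}$ indexed by hooks, each occurring once). $\chi_n$ denotes the character of the induced $\mathcal{S}_n$-module $\wedge V\uparrow^{\mathcal{S}_n}$, and $\chi_n(\mu)$ its value at a permutation of cycle type $\mu$. In the product, $\mu_j=1$ for $r<j\le r+s$. *)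

theory Defs
  imports
    "Jordan_Normal_Form.VS_Connect"
    "HOL-Algebra.QuotRing"
    "HOL-Algebra.Sym_Groups"
    "HOL-Combinatorics.Orbits"
begin

hide_const (open) Multiset.mult Polynomial.smult Modules.module

section \<open>Exterior algebras\<close>

text \<open>
  The free associative unital complex algebra on a set \<open>X\<close>: finitely supported functions on words
  over \<open>X\<close>, with the product extending concatenation of words bilinearly.
\<close>

definition free_algebra :: "'v set \<Rightarrow> ('v list \<Rightarrow> complex) ring" where
  "free_algebra X =
     \<lparr>carrier = {f. finite {w. f w \<noteq> 0} \<and> {w. f w \<noteq> 0} \<subseteq> lists X},
      mult = (\<lambda>f g w. \<Sum>i\<le>length w. f (take i w) * g (drop i w)),
      one = (\<lambda>w. if w = [] then 1 else 0),
      zero = (\<lambda>w. 0),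
      add = (\<lambda>f g w. f w + g w)\<rparr>"

definition word :: "'v list \<Rightarrow> 'v list \<Rightarrow> complex" where
  "word u = (\<lambda>w. if w = u then 1 else 0)"

text \<open>
  The exterior algebra of a vector space \<open>V\<close> is the quotient of the tensor algebra of \<open>V\<close> by the
  two-sided ideal generated by the squares \<open>v \<otimes> v\<close>.  The tensor algebra is itself the free algebra
  on the set of vectors modulo the linear relations; both quotients are taken in one step.
\<close>

definition exterior_relations :: "(complex, 'v, 'm) module_scheme \<Rightarrow> ('v list \<Rightarrow> complex) set" where
  "exterior_relations V =
     {(\<lambda>u. word [v \<oplus>\<^bsub>V\<^esub> w] u - word [v] u - word [w] u) | v w. v \<in> carrier V \<and> w \<in> carrier V} \<union>
     {(\<lambda>u. word [c \<odot>\<^bsub>V\<^esub> v] u - c * word [v] u) | c v. v \<in> carrier V} \<union>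
     {word [v, v] | v. v \<in> carrier V}"

definition exterior_ideal :: "(complex, 'v, 'm) module_scheme \<Rightarrow> ('v list \<Rightarrow> complex) set" where
  "exterior_ideal V = Idl\<^bsub>free_algebra (carrier V)\<^esub> (exterior_relations V)"

text \<open>
  If \<open>F\<close> is additive and preserves the exterior ideal, the union below is the single coset
  of \<open>F f\<close>, for any representative \<open>f\<close> of \<open>A\<close>.
\<close>

definition exterior_lift ::
  "(complex, 'v, 'm) module_scheme \<Rightarrow> (('v list \<Rightarrow> complex) \<Rightarrow> 'v list \<Rightarrow> complex)
     \<Rightarrow> ('v list \<Rightarrow> complex) set \<Rightarrow> ('v list \<Rightarrow> complex) set" where
  "exterior_lift V F A = (\<Union>f\<in>A. exterior_ideal V +>\<^bsub>free_algebra (carrier V)\<^esub> F f)"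

definition exterior_algebra ::
  "(complex, 'v, 'm) module_scheme \<Rightarrow> (complex, ('v list \<Rightarrow> complex) set) module" where
  "exterior_algebra V =
     ring.extend (free_algebra (carrier V) Quot exterior_ideal V)
       \<lparr>smult = (\<lambda>c. exterior_lift V (\<lambda>f w. c * f w))\<rparr>"

text \<open>
  The algebra endomorphism of the exterior algebra induced by a linear endomorphism \<open>\<phi>\<close> of \<open>V\<close>:
  it sends \<open>v\<^sub>1 \<and> \<dots> \<and> v\<^sub>k\<close> to \<open>\<phi> v\<^sub>1 \<and> \<dots> \<and> \<phi> v\<^sub>k\<close>.
\<close>

definition map_words :: "('v \<Rightarrow> 'v) \<Rightarrow> ('v list \<Rightarrow> complex) \<Rightarrow> 'v list \<Rightarrow> complex" where
  "map_words \<phi> f = (\<lambda>w. \<Sum>u | f u \<noteq> 0 \<and> map \<phi> u = w. f u)"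

definition exterior_map ::
  "(complex, 'v, 'm) module_scheme \<Rightarrow> ('v \<Rightarrow> 'v)
     \<Rightarrow> ('v list \<Rightarrow> complex) set \<Rightarrow> ('v list \<Rightarrow> complex) set" where
  "exterior_map V \<phi> = exterior_lift V (map_words \<phi>)"


section \<open>Representations\<close>

text \<open>
  A representation of a group is given by a complex vector space together with a map \<open>\<rho>\<close>
  from group elements to endomorphisms of it.
\<close>

definition coordinates :: "(complex, 'v, 'm) module_scheme \<Rightarrow> 'v set \<Rightarrow> 'v \<Rightarrow> 'v \<Rightarrow> complex" where
  "coordinates M B v = (THE a. a \<in> extensional B \<and> module.lincomb M a B = v)"

definition trace :: "(complex, 'v, 'm) module_scheme \<Rightarrow> ('v \<Rightarrow> 'v) \<Rightarrow> complex" where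
  "trace M T =
     (let B = (SOME B. finite B \<and> vectorspace.basis class_ring M B)
      in \<Sum>b\<in>B. coordinates M B (T b) b)"

definition character ::
  "(complex, 'v, 'm) module_scheme \<Rightarrow> ('g \<Rightarrow> 'v \<Rightarrow> 'v) \<Rightarrow> 'g \<Rightarrow> complex" where
  "character M \<rho> g = trace M (\<rho> g)"

text \<open>
  The representation of a finite group \<open>G\<close> induced from a representation \<open>(M, \<rho>)\<close> of a subgroup \<open>H\<close>,
  in the model of \<open>H\<close>-equivariant functions from \<open>G\<close> to \<open>M\<close>.  The multiplicative part of the record
  plays no role.
\<close>

definition induced_module ::
  "('g, 'k) monoid_scheme \<Rightarrow> 'g set \<Rightarrow> (complex, 'v, 'm) module_scheme \<Rightarrow> ('g \<Rightarrow> 'v \<Rightarrow> 'v)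
     \<Rightarrow> (complex, 'g \<Rightarrow> 'v) module" where
  "induced_module G H M \<rho> =
     \<lparr>carrier = {f \<in> carrier G \<rightarrow>\<^sub>E carrier M.
                   \<forall>g\<in>carrier G. \<forall>h\<in>H. f (g \<otimes>\<^bsub>G\<^esub> h) = \<rho> (inv\<^bsub>G\<^esub> h) (f g)},
      mult = undefined,
      one = undefined,
      zero = (\<lambda>g\<in>carrier G. \<zero>\<^bsub>M\<^esub>),
      add = (\<lambda>f f'. \<lambda>g\<in>carrier G. f g \<oplus>\<^bsub>M\<^esub> f' g),
      smult = (\<lambda>c f. \<lambda>g\<in>carrier G. c \<odot>\<^bsub>M\<^esub> f g)\<rparr>"

definition induced_action :: "('g, 'k) monoid_scheme \<Rightarrow> 'g \<Rightarrow> ('g \<Rightarrow> 'v) \<Rightarrow> 'g \<Rightarrow> 'v" where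
  "induced_action G x f = (\<lambda>g\<in>carrier G. f (inv\<^bsub>G\<^esub> x \<otimes>\<^bsub>G\<^esub> g))"


section \<open>The symmetric group\<close>

text \<open>
  The standard representation of the symmetric group on \<open>{1..m}\<close>, as the vectors of coordinate sum
  zero in the permutation representation.  A vector is a function on the natural numbers
  vanishing outside \<open>{1..m}\<close>; \<open>g\<close> sends the unit vector at \<open>i\<close> to the one at \<open>g i\<close>.
\<close>

definition standard_module :: "nat \<Rightarrow> (complex, nat \<Rightarrow> complex) module" where
  "standard_module m =
     \<lparr>carrier = {v. (\<forall>i. i \<notin> {1..m} \<longrightarrow> v i = 0) \<and> (\<Sum>i\<in>{1..m}. v i) = 0},
      mult = undefined,
      one = undefined,
      zero = (\<lambda>i. 0),
      add = (\<lambda>v w i. v i + w i),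
      smult = (\<lambda>c v i. c * v i)\<rparr>"

definition standard_action :: "(nat \<Rightarrow> nat) \<Rightarrow> (nat \<Rightarrow> complex) \<Rightarrow> nat \<Rightarrow> complex" where
  "standard_action g v = (\<lambda>i. v (inv' g i))"

definition exterior_action ::
  "nat \<Rightarrow> (nat \<Rightarrow> nat) \<Rightarrow> ((nat \<Rightarrow> complex) list \<Rightarrow> complex) set
     \<Rightarrow> ((nat \<Rightarrow> complex) list \<Rightarrow> complex) set" where
  "exterior_action m g = exterior_map (standard_module m) (standard_action g)"

text \<open>
  The subgroup \<open>S\<^bsub>n-1\<^esub>\<close> of \<open>S\<^bsub>n\<^esub>\<close> is the group of permutations of \<open>{1..n}\<close> fixing \<open>n\<close>; its carrier is
  literally contained in that of \<open>sym_group n\<close>.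
\<close>

definition chi :: "nat \<Rightarrow> (nat \<Rightarrow> nat) \<Rightarrow> complex" where
  "chi n =
     character
       (induced_module (sym_group n) (carrier (sym_group (n - 1)))
          (exterior_algebra (standard_module (n - 1))) (exterior_action (n - 1)))
       (induced_action (sym_group n))"

text \<open>The multiset of cycle lengths, where fixed points count as cycles of length one.\<close>

definition cycle_type :: "nat \<Rightarrow> (nat \<Rightarrow> nat) \<Rightarrow> nat multiset" where
  "cycle_type n p = image_mset card (mset_set (orbit p ` {1..n}))"

end

(*
  The trace of an endomorphism can be computed from any finite family of vectors e k and functionals
  phi k with v = (SUM k. phi k v * e k) for all v, linearly independent or not.

  The exterior algebra of C^m is modelled by functions on subsets of {1..m} ("Fock space"), on which a
  vector v acts by exterior multiplication and the sum of the coordinates acts by contraction d.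
  Words in the vectors e_i - e_m (i < m), multiplied out in Fock space, give such a family for the
  exterior algebra of the standard representation V. Let u be the multiplication by e_m. Then
  d u + u d = 1, and d u projects onto the exterior algebra of V, so the trace of a permutation g there is
  tr (g d u). As g commutes with d, this equals tr (g u d), hence it is half the trace of g on Fock space.
  The latter is the sum of the signs of g on its invariant subsets, which are the unions of cycles:
  it is the product of 1 + (-1)^(l - 1) over the cycle lengths l.

  Finally, inducing sums this over the fixed points i of p, for p conjugated to fix n and restricted
  to {1..n-1}; dropping the cycle {i} removes a factor 2 from the product.
*)
theory Submission
  imports Defs
begin

section \<open>Traces\<close>

text \<open>The obstacle is that the exterior algebra is given by generators and relations: its
  ideal is merely the smallest one containing the relations, so nothing shows directly that a word
  is nonzero in the quotient. The bridge is a pair of maps. \<open>wedge_word\<close> multiplies a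
  word out in Fock space and respects the relations, so Fock coefficients are well defined on
  cosets; \<open>fock_lift\<close> goes back, using only the coefficients at sets S that avoid m.
  These suffice because e_i - e_m becomes e_i once e_m is set to 0. That lifting after multiplying
  out is the identity on the quotient is precisely a frame, which spares a separate proof that the
  2^(m-1) basis words are independent. The operator d u enters because its value on e_S, for S
  avoiding m, is the ordered product of the e_i - e_m over i in S, while for S containing m it is 0.
  The coefficients of g d u e_S at S, summed over the sets avoiding m, are therefore already a full
  trace on Fock space, where traces are cyclic and the halving argument applies.\<close>

lemma additive_finsum:
  fixes h :: "'v \<Rightarrow> complex"
  assumes M: "abelian_group M" and K: "finite K" "f \<in> K \<rightarrow> carrier M"
    and add: "\<And>x y. x \<in> carrier M \<Longrightarrow> y \<in> carrier M \<Longrightarrow> h (x \<oplus>\<^bsub>M\<^esub> y) = h x + h y"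
  shows "h (\<Oplus>\<^bsub>M\<^esub>k\<in>K. f k) = (\<Sum>k\<in>K. h (f k))"
proof -
  interpret abelian_group M by fact
  have h0: "h \<zero>\<^bsub>M\<^esub> = 0" using add[of "\<zero>\<^bsub>M\<^esub>" "\<zero>\<^bsub>M\<^esub>"] by simp
  show ?thesis using K
    by (induction rule: finite_induct) (auto simp: h0 add finsum_insert Pi_iff)
qed

lemma additive_finsum_endo:
  assumes M: "abelian_group M" and K: "finite K" "f \<in> K \<rightarrow> carrier M"
    and T: "T \<in> carrier M \<rightarrow> carrier M"
    and add: "\<And>x y. x \<in> carrier M \<Longrightarrow> y \<in> carrier M \<Longrightarrow> T (x \<oplus>\<^bsub>M\<^esub> y) = T x \<oplus>\<^bsub>M\<^esub> T y"
  shows "T (\<Oplus>\<^bsub>M\<^esub>k\<in>K. f k) = (\<Oplus>\<^bsub>M\<^esub>k\<in>K. T (f k))"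
proof -
  interpret abelian_group M by fact
  have c: "T x \<in> carrier M" if "x \<in> carrier M" for x using T that by auto
  have T0: "T \<zero>\<^bsub>M\<^esub> = \<zero>\<^bsub>M\<^esub>" using add[of "\<zero>\<^bsub>M\<^esub>" "\<zero>\<^bsub>M\<^esub>"] c[of "\<zero>\<^bsub>M\<^esub>"]
    by (metis add.l_cancel_one' r_zero zero_closed)
  show ?thesis using K
    by (induction rule: finite_induct) (auto simp: T0 add finsum_insert Pi_iff c)
qed

lemma coordinates_basis:
  fixes M :: "(complex, 'v, 'm) module_scheme"
  assumes V: "vectorspace class_ring M" and fB: "finite B" and B: "vectorspace.basis class_ring M B"
  shows "v \<in> carrier M \<Longrightarrow> (\<Oplus>\<^bsub>M\<^esub>b\<in>B. coordinates M B v b \<odot>\<^bsub>M\<^esub> b) = v"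
    and "v \<in> carrier M \<Longrightarrow> v = (\<Oplus>\<^bsub>M\<^esub>b\<in>B. a b \<odot>\<^bsub>M\<^esub> b) \<Longrightarrow> b \<in> B \<Longrightarrow> coordinates M B v b = a b"
    and "B \<subseteq> carrier M"
proof -
  interpret vectorspace "class_ring :: complex ring" M by fact
  show BM: "B \<subseteq> carrier M" using B unfolding basis_def by blast
  have ex: "\<exists>!a. a \<in> extensional B \<and> lincomb a B = v" if "v \<in> carrier M" for v
    using B basis_criterion[OF fB BM] that by (simp add: PiE_def)
  have c: "coordinates M B v \<in> extensional B \<and> lincomb (coordinates M B v) B = v"
    if "v \<in> carrier M" for v
    unfolding coordinates_def by (rule theI'[OF ex[OF that]])
  show "(\<Oplus>\<^bsub>M\<^esub>b\<in>B. coordinates M B v b \<odot>\<^bsub>M\<^esub> b) = v" if "v \<in> carrier M"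
    using c[OF that] unfolding lincomb_def by simp
  show "coordinates M B v b = a b"
    if v: "v \<in> carrier M" and e: "v = (\<Oplus>\<^bsub>M\<^esub>b\<in>B. a b \<odot>\<^bsub>M\<^esub> b)" and b: "b \<in> B"
  proof -
    \<comment> \<open>Coordinates are unique only among functions that are \<open>undefined\<close>
      outside B, hence the restriction.\<close>
    have "lincomb (restrict a B) B = lincomb a B"
      by (rule lincomb_cong) (use BM in auto)
    also have "\<dots> = v" unfolding lincomb_def using e by simp
    finally have "coordinates M B v = restrict a B"
      using ex[OF v] c[OF v] by (metis restrict_extensional)
    then show ?thesis using b by simp
  qed
qed

text \<open>The frame factors the identity through the functions on K, and a trace does not depend
  on the order of two factors: expanding each basis vector in the frame, and each
  \<open>T (e k)\<close> in the basis, turns both sides into the same double sum.\<close>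

lemma trace_frame:
  fixes M :: "(complex, 'v, 'm) module_scheme"
  assumes V: "vectorspace class_ring M"
    and K: "finite K" and e: "\<And>k. k \<in> K \<Longrightarrow> e k \<in> carrier M"
    and T: "T \<in> carrier M \<rightarrow> carrier M"
    and T_add: "\<And>x y. x \<in> carrier M \<Longrightarrow> y \<in> carrier M \<Longrightarrow> T (x \<oplus>\<^bsub>M\<^esub> y) = T x \<oplus>\<^bsub>M\<^esub> T y"
    and T_smult: "\<And>c x. x \<in> carrier M \<Longrightarrow> T (c \<odot>\<^bsub>M\<^esub> x) = c \<odot>\<^bsub>M\<^esub> T x"
    and phi_add: "\<And>k x y. k \<in> K \<Longrightarrow> x \<in> carrier M \<Longrightarrow> y \<in> carrier M \<Longrightarrow> \<phi> k (x \<oplus>\<^bsub>M\<^esub> y) = \<phi> k x + \<phi> k y"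
    and phi_smult: "\<And>k c x. k \<in> K \<Longrightarrow> x \<in> carrier M \<Longrightarrow> \<phi> k (c \<odot>\<^bsub>M\<^esub> x) = c * \<phi> k x"
    and frame: "\<And>v. v \<in> carrier M \<Longrightarrow> (\<Oplus>\<^bsub>M\<^esub>k\<in>K. \<phi> k v \<odot>\<^bsub>M\<^esub> e k) = v"
  shows "trace M T = (\<Sum>k\<in>K. \<phi> k (T (e k)))"
proof -
  interpret vectorspace "class_ring :: complex ring" M by fact
  have ag: "abelian_group M" ..
  have sm: "c \<odot>\<^bsub>M\<^esub> x \<in> carrier M" if "x \<in> carrier M" for c x using smult_closed that by simp
  have eK: "e ` K \<subseteq> carrier M" using e by auto
  \<comment> \<open>The sum runs over indices and \<open>e\<close> may repeat vectors, so membership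
    in the span of the image is built up one term at a time. The aim is finite dimensionality:
    \<open>trace\<close> picks a finite basis with SOME, which is meaningful only if one
    exists.\<close>
  have sp: "(\<Oplus>\<^bsub>M\<^esub>k\<in>L. a k \<odot>\<^bsub>M\<^esub> e k) \<in> span (e ` K)" if "L \<subseteq> K" for L a
  proof -
    have "finite L" using that K finite_subset by blast
    then show ?thesis using that
    proof (induction rule: finite_induct)
      case empty
      then show ?case using span_zero by simp
    next
      case (insert k L)
      have "submodule (class_ring :: complex ring) (span (e ` K)) M" using span_is_submodule[OF eK] .
      moreover have "e k \<in> span (e ` K)" using insert.prems eK by (intro span_mem) auto
      ultimately have "a k \<odot>\<^bsub>M\<^esub> e k \<oplus>\<^bsub>M\<^esub> (\<Oplus>\<^bsub>M\<^esub>k\<in>L. a k \<odot>\<^bsub>M\<^esub> e k) \<in> span (e ` K)"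
        using insert.IH insert.prems unfolding submodule_def by auto
      then show ?case using insert sm e by (subst finsum_insert) auto
    qed
  qed
  have "span (e ` K) = carrier M"
  proof
    show "span (e ` K) \<subseteq> carrier M" using span_closed[OF eK] by (rule subsetI)
    show "carrier M \<subseteq> span (e ` K)"
    proof
      fix v assume "v \<in> carrier M"
      then show "v \<in> span (e ` K)" using sp[OF order_refl, of "\<lambda>k. \<phi> k v"] frame by simp
    qed
  qed
  then have "fin_dim" unfolding fin_dim_def using K eK by (intro exI[of _ "e ` K"]) simp
  then have exB: "\<exists>B. finite B \<and> basis B" by (rule finite_basis_exists)
  define B where "B = (SOME B. finite B \<and> basis B)"
  have B: "finite B" "basis B" using someI_ex[OF exB] unfolding B_def by auto
  note cb = coordinates_basis[OF V B]
  let ?c = "coordinates M B"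
  have cadd: "?c (x \<oplus>\<^bsub>M\<^esub> y) b = ?c x b + ?c y b" if "x \<in> carrier M" "y \<in> carrier M" "b \<in> B" for x y b
  proof (rule cb(2))
    have "(\<Oplus>\<^bsub>M\<^esub>b\<in>B. (?c x b + ?c y b) \<odot>\<^bsub>M\<^esub> b)
      = (\<Oplus>\<^bsub>M\<^esub>b\<in>B. ?c x b \<odot>\<^bsub>M\<^esub> b \<oplus>\<^bsub>M\<^esub> ?c y b \<odot>\<^bsub>M\<^esub> b)"
      using cb(3) sm smult_l_distr by (intro finsum_cong') auto
    also have "\<dots> = (\<Oplus>\<^bsub>M\<^esub>b\<in>B. ?c x b \<odot>\<^bsub>M\<^esub> b) \<oplus>\<^bsub>M\<^esub> (\<Oplus>\<^bsub>M\<^esub>b\<in>B. ?c y b \<odot>\<^bsub>M\<^esub> b)"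
      using cb(3) sm by (intro finsum_addf) auto
    finally show "x \<oplus>\<^bsub>M\<^esub> y = (\<Oplus>\<^bsub>M\<^esub>b\<in>B. (?c x b + ?c y b) \<odot>\<^bsub>M\<^esub> b)"
      using cb(1) that by simp
  qed (use that in auto)
  have csm: "?c (s \<odot>\<^bsub>M\<^esub> x) b = s * ?c x b" if "x \<in> carrier M" "b \<in> B" for s x b
  proof (rule cb(2))
    have "(\<Oplus>\<^bsub>M\<^esub>b\<in>B. (s * ?c x b) \<odot>\<^bsub>M\<^esub> b) = (\<Oplus>\<^bsub>M\<^esub>b\<in>B. s \<odot>\<^bsub>M\<^esub> (?c x b \<odot>\<^bsub>M\<^esub> b))"
      using cb(3) sm smult_assoc1 by (intro finsum_cong') auto
    also have "\<dots> = s \<odot>\<^bsub>M\<^esub> (\<Oplus>\<^bsub>M\<^esub>b\<in>B. ?c x b \<odot>\<^bsub>M\<^esub> b)"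
      using cb(3) sm by (subst finsum_smult) auto
    finally show "s \<odot>\<^bsub>M\<^esub> x = (\<Oplus>\<^bsub>M\<^esub>b\<in>B. (s * ?c x b) \<odot>\<^bsub>M\<^esub> b)"
      using cb(1) that by simp
  qed (use that sm in auto)
  have Tc: "T x \<in> carrier M" if "x \<in> carrier M" for x using T that by auto
  have Tb: "?c (T b) b = (\<Sum>k\<in>K. \<phi> k b * ?c (T (e k)) b)" if b: "b \<in> B" for b
  proof -
    have bM: "b \<in> carrier M" using b cb(3) by auto
    have "T b = T (\<Oplus>\<^bsub>M\<^esub>k\<in>K. \<phi> k b \<odot>\<^bsub>M\<^esub> e k)" using frame[OF bM] by simp
    also have "\<dots> = (\<Oplus>\<^bsub>M\<^esub>k\<in>K. T (\<phi> k b \<odot>\<^bsub>M\<^esub> e k))"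
      using sm e by (intro additive_finsum_endo[OF ag K _ T T_add]) auto
    also have "\<dots> = (\<Oplus>\<^bsub>M\<^esub>k\<in>K. \<phi> k b \<odot>\<^bsub>M\<^esub> T (e k))"
      using sm e Tc T_smult by (intro finsum_cong') auto
    finally have "?c (T b) b = ?c (\<Oplus>\<^bsub>M\<^esub>k\<in>K. \<phi> k b \<odot>\<^bsub>M\<^esub> T (e k)) b" by simp
    also have "\<dots> = (\<Sum>k\<in>K. ?c (\<phi> k b \<odot>\<^bsub>M\<^esub> T (e k)) b)"
      using sm e Tc b cadd by (intro additive_finsum[OF ag K, where h="\<lambda>v. ?c v b"]) auto
    finally show ?thesis using csm e Tc b by simp
  qed
  have "trace M T = (\<Sum>b\<in>B. ?c (T b) b)" unfolding trace_def B_def[symmetric] by simp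
  also have "\<dots> = (\<Sum>b\<in>B. \<Sum>k\<in>K. \<phi> k b * ?c (T (e k)) b)" using Tb by simp
  also have "\<dots> = (\<Sum>k\<in>K. \<Sum>b\<in>B. \<phi> k b * ?c (T (e k)) b)" by (rule sum.swap)
  also have "\<dots> = (\<Sum>k\<in>K. \<phi> k (T (e k)))"
  proof (rule sum.cong[OF refl])
    fix k assume k: "k \<in> K"
    then have Te: "T (e k) \<in> carrier M" using e Tc by auto
    have "\<phi> k (T (e k)) = \<phi> k (\<Oplus>\<^bsub>M\<^esub>b\<in>B. ?c (T (e k)) b \<odot>\<^bsub>M\<^esub> b)" using cb(1)[OF Te] by simp
    also have "\<dots> = (\<Sum>b\<in>B. \<phi> k (?c (T (e k)) b \<odot>\<^bsub>M\<^esub> b))"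
      using sm cb(3) phi_add k by (intro additive_finsum[OF ag B(1)]) auto
    also have "\<dots> = (\<Sum>b\<in>B. \<phi> k b * ?c (T (e k)) b)"
      using phi_smult k cb(3) by (intro sum.cong) (auto simp: mult.commute)
    finally show "(\<Sum>b\<in>B. \<phi> k b * ?c (T (e k)) b) = \<phi> k (T (e k))" by simp
  qed
  finally show ?thesis .
qed

section \<open>The free algebra\<close>

definition linear_extension :: "('v list \<Rightarrow> complex) \<Rightarrow> ('v list \<Rightarrow> complex) \<Rightarrow> complex" where
  "linear_extension E f = (\<Sum>w | f w \<noteq> 0. f w * E w)"

definition convolution :: "('v list \<Rightarrow> complex) \<Rightarrow> ('v list \<Rightarrow> complex) \<Rightarrow> 'v list \<Rightarrow> complex" where
  "convolution f g w = (\<Sum>i\<le>length w. f (take i w) * g (drop i w))"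

lemma free_algebra_simps:
  "f \<in> carrier (free_algebra X) \<longleftrightarrow> finite {w. f w \<noteq> 0} \<and> {w. f w \<noteq> 0} \<subseteq> lists X"
  "mult (free_algebra X) = convolution"
  "one (free_algebra X) = word []"
  "zero (free_algebra X) = (\<lambda>w. 0)"
  "add (free_algebra X) = (\<lambda>f g w. f w + g w)"
  by (auto simp: free_algebra_def convolution_def word_def fun_eq_iff)

lemma linear_extension_superset:
  assumes "finite W" "{w. f w \<noteq> 0} \<subseteq> W"
  shows "linear_extension E f = (\<Sum>w\<in>W. f w * E w)"
  unfolding linear_extension_def by (rule sum.mono_neutral_left) (use assms in auto)

lemma linear_extension_add:
  assumes "finite {w. f w \<noteq> 0}" "finite {w. g w \<noteq> 0}"
  shows "linear_extension E (\<lambda>w. f w + g w) = linear_extension E f + linear_extension E g"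
proof -
  \<comment> \<open>Cancellation may shrink the support of the sum, so all three sums are taken over
    the union of the two supports.\<close>
  let ?W = "{w. f w \<noteq> 0} \<union> {w. g w \<noteq> 0}"
  have W: "finite ?W" using assms by simp
  have s: "{w. f w + g w \<noteq> 0} \<subseteq> ?W" "{w. f w \<noteq> 0} \<subseteq> ?W" "{w. g w \<noteq> 0} \<subseteq> ?W" by auto
  show ?thesis
    by (simp only: linear_extension_superset[OF W s(1)] linear_extension_superset[OF W s(2)]
      linear_extension_superset[OF W s(3)] distrib_right sum.distrib)
qed

lemma linear_extension_cmult: "linear_extension E (\<lambda>w. c * f w) = c * linear_extension E f"
  by (cases "c = 0") (auto simp: linear_extension_def sum_distrib_left mult.assoc)

lemma linear_extension_word [simp]: "linear_extension E (word u) = E u"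
proof -
  have "linear_extension E (word u) = (\<Sum>w\<in>{u}. word u w * E w)"
    by (rule linear_extension_superset) (auto simp: word_def)
  then show ?thesis by (simp add: word_def)
qed

lemma convolution_support:
  "{w. convolution f g w \<noteq> 0} \<subseteq> (\<lambda>(u, v). u @ v) ` ({w. f w \<noteq> 0} \<times> {w. g w \<noteq> 0})"
proof
  fix w assume "w \<in> {w. convolution f g w \<noteq> 0}"
  then have "(\<Sum>i\<le>length w. f (take i w) * g (drop i w)) \<noteq> 0" by (simp add: convolution_def)
  then obtain i where "f (take i w) * g (drop i w) \<noteq> 0" by (meson sum.not_neutral_contains_not_neutral)
  then have "(take i w, drop i w) \<in> {w. f w \<noteq> 0} \<times> {w. g w \<noteq> 0}" by simp
  then show "w \<in> (\<lambda>(u, v). u @ v) ` ({w. f w \<noteq> 0} \<times> {w. g w \<noteq> 0})"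
    by (metis (no_types, lifting) append_take_drop_id case_prod_conv image_eqI)
qed

text \<open>The pairs (u, v) are the words w = u v with a marked cut; in the sum over all words and
  all cuts, a cut where either factor vanishes contributes 0.\<close>

lemma linear_extension_convolution:
  assumes f: "finite {w. f w \<noteq> 0}" and g: "finite {w. g w \<noteq> 0}"
  shows "linear_extension E (convolution f g) =
    (\<Sum>u | f u \<noteq> 0. \<Sum>v | g v \<noteq> 0. f u * g v * E (u @ v))"
proof -
  let ?F = "{w. f w \<noteq> 0}" and ?G = "{w. g w \<noteq> 0}"
  let ?W = "(\<lambda>(u, v). u @ v) ` (?F \<times> ?G)"
  have fin: "finite ?W" using f g by simp
  have "linear_extension E (convolution f g) = (\<Sum>w\<in>?W. convolution f g w * E w)"
    by (rule linear_extension_superset[OF fin convolution_support])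
  also have "\<dots> = (\<Sum>w\<in>?W. \<Sum>i\<le>length w. f (take i w) * g (drop i w) * E w)"
    by (simp add: convolution_def sum_distrib_right)
  also have "\<dots> = (\<Sum>(w, i)\<in>(SIGMA w:?W. {..length w}). f (take i w) * g (drop i w) * E w)"
    using fin by (subst sum.Sigma) auto
  also have "\<dots> = (\<Sum>(u, v)\<in>?F \<times> ?G. f u * g v * E (u @ v))"
  proof -
    let ?p = "\<lambda>(u, v). (u @ v, length u)"
    have inj: "inj_on ?p (?F \<times> ?G)" by (auto simp: inj_on_def)
    have z: "f (take i w) * g (drop i w) = 0"
      if "(w, i) \<in> (SIGMA w:?W. {..length w}) - ?p ` (?F \<times> ?G)" for w i
    proof (rule ccontr)
      assume "f (take i w) * g (drop i w) \<noteq> 0"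
      then have "(take i w, drop i w) \<in> ?F \<times> ?G" by simp
      then have "?p (take i w, drop i w) \<in> ?p ` (?F \<times> ?G)" by (rule imageI)
      moreover have "?p (take i w, drop i w) = (w, i)" using that by simp
      ultimately show False using that by simp
    qed
    have sub: "?p ` (?F \<times> ?G) \<subseteq> (SIGMA w:?W. {..length w})" by auto
    have "(\<Sum>(w, i)\<in>(SIGMA w:?W. {..length w}). f (take i w) * g (drop i w) * E w)
      = (\<Sum>(w, i)\<in>?p ` (?F \<times> ?G). f (take i w) * g (drop i w) * E w)"
    proof (rule sum.mono_neutral_right[OF _ sub])
      show "finite (SIGMA w:?W. {..length w})" using fin by auto
      show "\<forall>x\<in>(SIGMA w:?W. {..length w}) - ?p ` (?F \<times> ?G).
          (case x of (w, i) \<Rightarrow> f (take i w) * g (drop i w) * E w) = 0"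
      proof
        fix x assume x: "x \<in> (SIGMA w:?W. {..length w}) - ?p ` (?F \<times> ?G)"
        obtain w i where wi: "x = (w, i)" by (cases x)
        show "(case x of (w, i) \<Rightarrow> f (take i w) * g (drop i w) * E w) = 0"
          using z[OF x[unfolded wi]] by (simp add: wi)
      qed
    qed
    also have "\<dots> = (\<Sum>(u, v)\<in>?F \<times> ?G. f u * g v * E (u @ v))"
      by (subst sum.reindex[OF inj]) (auto intro!: sum.cong)
    finally show ?thesis .
  qed
  also have "\<dots> = (\<Sum>u\<in>?F. \<Sum>v\<in>?G. f u * g v * E (u @ v))"
    by (simp add: sum.cartesian_product)
  finally show ?thesis .
qed

section \<open>Ring structure of the free algebra\<close>

lemma convolution_word [simp]: "convolution (word u) (word v) = word (u @ v)"
proof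
  fix w
  have "convolution (word u) (word v) w = (\<Sum>i\<le>length w. if i = length u then (if w = u @ v then 1 else 0) else 0)"
    unfolding convolution_def
  proof (rule sum.cong[OF refl])
    fix i assume "i \<in> {..length w}"
    then have "take i w = u \<and> drop i w = v \<longleftrightarrow> i = length u \<and> w = u @ v"
      by (metis append_eq_conv_conj append_take_drop_id atMost_iff length_take min.absorb2)
    moreover have "word u (take i w) * word v (drop i w) = (if take i w = u \<and> drop i w = v then 1 else 0)"
      by (simp add: word_def)
    moreover have "(if i = length u then if w = u @ v then 1 else 0 else 0) =
        (if i = length u \<and> w = u @ v then 1 else 0 :: complex)" by simp
    ultimately show "word u (take i w) * word v (drop i w) =
        (if i = length u then if w = u @ v then 1 else 0 else 0)" by (simp only:)
  qed
  also have "\<dots> = word (u @ v) w" by (auto simp: word_def)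
  finally show "convolution (word u) (word v) w = word (u @ v) w" .
qed

lemma convolution_assoc: "convolution (convolution f g) h = convolution f (convolution g h)"
proof
  fix w :: "'a list"
  let ?n = "length w"
  have "convolution (convolution f g) h w =
    (\<Sum>i\<le>?n. \<Sum>j\<le>i. f (take j w) * g (take (i - j) (drop j w)) * h (drop i w))"
    unfolding convolution_def
    by (intro sum.cong refl) (auto simp: sum_distrib_right min_def drop_take intro!: sum.cong)
  also have "\<dots> = (\<Sum>(i, j)\<in>(SIGMA i:{..?n}. {..i}). f (take j w) * g (take (i - j) (drop j w)) * h (drop i w))"
    by (subst sum.Sigma) auto
  \<comment> \<open>A factorisation of w into three pieces is recorded either by its two cuts j
    \<le> i or by the first cut j and the length k of the middle piece.\<close>
  also have "\<dots> = (\<Sum>(j, k)\<in>(SIGMA j:{..?n}. {..?n - j}). f (take j w) * g (take k (drop j w)) * h (drop (j + k) w))"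
    by (rule sum.reindex_bij_witness[where i = "\<lambda>(j, k). (j + k, j)" and j = "\<lambda>(i, j). (j, i - j)"]) auto
  also have "\<dots> = (\<Sum>j\<le>?n. \<Sum>k\<le>?n - j. f (take j w) * g (take k (drop j w)) * h (drop (j + k) w))"
    by (subst sum.Sigma) auto
  also have "\<dots> = convolution f (convolution g h) w"
    unfolding convolution_def
    by (intro sum.cong refl) (auto simp: sum_distrib_left mult.assoc add.commute intro!: sum.cong)
  finally show "convolution (convolution f g) h w = convolution f (convolution g h) w" .
qed

lemma convolution_one: "convolution (word []) f = f" "convolution f (word []) = f"
proof -
  have "convolution (word []) f w = (\<Sum>i\<le>length w. if i = 0 then f w else 0)" for w
    unfolding convolution_def by (intro sum.cong) (auto simp: word_def)
  then show "convolution (word []) f = f" by (simp add: fun_eq_iff)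
  have "convolution f (word []) w = (\<Sum>i\<le>length w. if i = length w then f w else 0)" for w
    unfolding convolution_def by (intro sum.cong) (auto simp: word_def)
  then show "convolution f (word []) = f" by (simp add: fun_eq_iff)
qed

lemma convolution_distrib:
  "convolution (\<lambda>w. f w + g w) h = (\<lambda>w. convolution f h w + convolution g h w)"
  "convolution h (\<lambda>w. f w + g w) = (\<lambda>w. convolution h f w + convolution h g w)"
  "convolution (\<lambda>w. f w - g w) h = (\<lambda>w. convolution f h w - convolution g h w)"
  "convolution h (\<lambda>w. f w - g w) = (\<lambda>w. convolution h f w - convolution h g w)"
  "convolution (\<lambda>w. c * f w) h = (\<lambda>w. c * convolution f h w)"
  "convolution h (\<lambda>w. c * f w) = (\<lambda>w. c * convolution h f w)"
  by (auto simp: convolution_def algebra_simps sum.distrib sum_subtractf sum_distrib_left)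

lemma convolution_sum:
  "convolution h (\<lambda>w. \<Sum>k\<in>K. f k w) = (\<lambda>w. \<Sum>k\<in>K. convolution h (f k) w)"
  "convolution (\<lambda>w. \<Sum>k\<in>K. f k w) h = (\<lambda>w. \<Sum>k\<in>K. convolution (f k) h w)"
  unfolding convolution_def sum_distrib_left sum_distrib_right
  by (rule ext, rule sum.swap)+

lemma free_algebra_word: "u \<in> lists X \<Longrightarrow> word u \<in> carrier (free_algebra X)"
  by (auto simp: free_algebra_simps word_def)

lemma free_algebra_add:
  "f \<in> carrier (free_algebra X) \<Longrightarrow> g \<in> carrier (free_algebra X) \<Longrightarrow> (\<lambda>w. f w + g w) \<in> carrier (free_algebra X)"
proof -
  assume "f \<in> carrier (free_algebra X)" "g \<in> carrier (free_algebra X)"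
  then have "finite ({w. f w \<noteq> 0} \<union> {w. g w \<noteq> 0})" "{w. f w \<noteq> 0} \<union> {w. g w \<noteq> 0} \<subseteq> lists X"
    by (simp_all add: free_algebra_simps)
  moreover have "{w. f w + g w \<noteq> 0} \<subseteq> {w. f w \<noteq> 0} \<union> {w. g w \<noteq> 0}" by auto
  ultimately show ?thesis by (simp only: free_algebra_simps(1)) (meson finite_subset subset_trans)
qed

lemma free_algebra_cmult:
  "f \<in> carrier (free_algebra X) \<Longrightarrow> (\<lambda>w. c * f w) \<in> carrier (free_algebra X)"
  by (auto simp: free_algebra_simps elim!: rev_finite_subset)

lemma free_algebra_zero: "(\<lambda>w. 0) \<in> carrier (free_algebra X)"
  by (auto simp: free_algebra_simps)

lemma free_algebra_sum:
  assumes "\<And>k. k \<in> K \<Longrightarrow> f k \<in> carrier (free_algebra X)"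
  shows "(\<lambda>w. \<Sum>k\<in>K. f k w) \<in> carrier (free_algebra X)"
  using assms
  by (induction K rule: infinite_finite_induct) (auto simp: free_algebra_zero free_algebra_add)

lemma free_algebra_convolution:
  assumes f: "f \<in> carrier (free_algebra X)" and g: "g \<in> carrier (free_algebra X)"
  shows "convolution f g \<in> carrier (free_algebra X)"
proof -
  have "finite ((\<lambda>(u, v). u @ v) ` ({w. f w \<noteq> 0} \<times> {w. g w \<noteq> 0}))"
    using f g by (simp add: free_algebra_simps)
  moreover have "(\<lambda>(u, v). u @ v) ` ({w. f w \<noteq> 0} \<times> {w. g w \<noteq> 0}) \<subseteq> lists X"
    using f g by (fastforce simp: free_algebra_simps(1))
  ultimately show ?thesis using convolution_support[of f g]
    by (simp add: free_algebra_simps) (meson finite_subset subset_trans)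
qed

lemma free_algebra_ring: "ring (free_algebra X)"
proof (rule ringI)
  show "abelian_group (free_algebra X)"
  proof (rule abelian_groupI)
    fix f assume f: "f \<in> carrier (free_algebra X)"
    show "\<exists>g\<in>carrier (free_algebra X). g \<oplus>\<^bsub>free_algebra X\<^esub> f = \<zero>\<^bsub>free_algebra X\<^esub>"
      using free_algebra_cmult[OF f, of "-1"] by (intro bexI[of _ "\<lambda>w. - 1 * f w"]) (auto simp: free_algebra_simps(4,5))
  qed (auto simp: free_algebra_simps(4,5) free_algebra_add free_algebra_zero add.assoc add.commute)
  show "monoid (free_algebra X)"
    by (rule monoidI)
      (auto simp: free_algebra_simps(2,3) free_algebra_convolution free_algebra_word convolution_assoc convolution_one)
qed (auto simp: free_algebra_simps(2,5) convolution_distrib)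

lemma linear_extension_diff:
  assumes "f \<in> carrier (free_algebra X)" "g \<in> carrier (free_algebra X)"
  shows "linear_extension E (\<lambda>w. f w - g w) = linear_extension E f - linear_extension E g"
  using linear_extension_add[of f "\<lambda>w. - 1 * g w" E] assms free_algebra_cmult[of g X "-1"]
    linear_extension_cmult[of E "-1" g]
  by (simp add: free_algebra_simps)

lemma linear_extension_free_add:
  assumes "f \<in> carrier (free_algebra X)" "g \<in> carrier (free_algebra X)"
  shows "linear_extension E (\<lambda>w. f w + g w) = linear_extension E f + linear_extension E g"
  using linear_extension_add[of f g E] assms by (simp add: free_algebra_simps)

lemma free_algebra_expand:
  assumes "f \<in> carrier (free_algebra X)"
  shows "f = (\<lambda>u. \<Sum>w | f w \<noteq> 0. f w * word w u)"
proof
  fix u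
  have "finite {w. f w \<noteq> 0}" using assms by (simp add: free_algebra_simps)
  then show "f u = (\<Sum>w | f w \<noteq> 0. f w * word w u)"
    by (simp add: word_def if_distrib cong: if_cong)
qed

section \<open>The exterior algebra\<close>

text \<open>Closure of the carrier is what places the defining relations in the free algebra on it,
  so that they generate an ideal there.\<close>

locale exterior =
  fixes V :: "(complex, 'v, 'm) module_scheme"
  assumes add_closed: "v \<in> carrier V \<Longrightarrow> w \<in> carrier V \<Longrightarrow> v \<oplus>\<^bsub>V\<^esub> w \<in> carrier V"
    and smult_closed: "v \<in> carrier V \<Longrightarrow> c \<odot>\<^bsub>V\<^esub> v \<in> carrier V"
begin

abbreviation FA where "FA \<equiv> free_algebra (carrier V)"

section \<open>The exterior ideal and congruence modulo it\<close>

definition cong :: "('v list \<Rightarrow> complex) \<Rightarrow> ('v list \<Rightarrow> complex) \<Rightarrow> bool" where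
  "cong f g \<longleftrightarrow> (\<lambda>w. f w - g w) \<in> exterior_ideal V"

definition coset :: "('v list \<Rightarrow> complex) \<Rightarrow> ('v list \<Rightarrow> complex) set" where
  "coset f = {g. cong g f}"

lemma relations_carrier: "exterior_relations V \<subseteq> carrier FA"
proof -
  have w: "word u \<in> carrier FA" if "set u \<subseteq> carrier V" for u
    using that by (intro free_algebra_word) auto
  have "(\<lambda>u. word [v \<oplus>\<^bsub>V\<^esub> w] u - word [v] u - word [w] u) \<in> carrier FA"
    if "v \<in> carrier V" "w \<in> carrier V" for v w
  proof -
    have "(\<lambda>u. (word [v \<oplus>\<^bsub>V\<^esub> w] u + - 1 * word [v] u) + - 1 * word [w] u) \<in> carrier FA"
      using that add_closed by (intro free_algebra_add free_algebra_cmult w) auto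
    then show ?thesis by (simp add: algebra_simps)
  qed
  moreover have "(\<lambda>u. word [c \<odot>\<^bsub>V\<^esub> v] u - c * word [v] u) \<in> carrier FA" if "v \<in> carrier V" for c v
  proof -
    have "(\<lambda>u. word [c \<odot>\<^bsub>V\<^esub> v] u + (- c) * word [v] u) \<in> carrier FA"
      using that smult_closed by (intro free_algebra_add free_algebra_cmult w) auto
    then show ?thesis by simp
  qed
  ultimately show ?thesis unfolding exterior_relations_def using w by auto
qed

lemma ideal: "ideal (exterior_ideal V) FA"
  unfolding exterior_ideal_def
  by (rule ring.genideal_ideal[OF free_algebra_ring relations_carrier])

lemma ideal_carrier: "f \<in> exterior_ideal V \<Longrightarrow> f \<in> carrier FA"
  using additive_subgroup.a_Hcarr[OF ideal.axioms(1)[OF ideal]] .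

lemma ideal_zero: "(\<lambda>w. 0) \<in> exterior_ideal V"
  using additive_subgroup.zero_closed[OF ideal.axioms(1)[OF ideal]] by (simp add: free_algebra_simps)

lemma ideal_add: "f \<in> exterior_ideal V \<Longrightarrow> g \<in> exterior_ideal V \<Longrightarrow> (\<lambda>w. f w + g w) \<in> exterior_ideal V"
  using additive_subgroup.a_closed[OF ideal.axioms(1)[OF ideal]] by (simp add: free_algebra_simps)

lemma ideal_convolution:
  assumes "f \<in> exterior_ideal V" "h \<in> carrier FA"
  shows "convolution h f \<in> exterior_ideal V" "convolution f h \<in> exterior_ideal V"
  using ideal.I_l_closed[OF ideal assms] ideal.I_r_closed[OF ideal assms]
  by (simp_all add: free_algebra_simps)

text \<open>An ideal of a ring is not closed under scalars by definition; here scaling by c is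
  multiplication by c times the empty word.\<close>

lemma ideal_cmult: "f \<in> exterior_ideal V \<Longrightarrow> (\<lambda>w. c * f w) \<in> exterior_ideal V"
  using ideal_convolution(1)[of f "\<lambda>w. c * word [] w"]
  by (simp add: free_algebra_cmult free_algebra_word convolution_distrib convolution_one)

lemma relation_in_ideal: "f \<in> exterior_relations V \<Longrightarrow> f \<in> exterior_ideal V"
  unfolding exterior_ideal_def
  using ring.genideal_self[OF free_algebra_ring relations_carrier] by blast

lemma cong_refl [simp]: "cong f f"
  by (simp add: cong_def ideal_zero)

lemma cong_trans: "cong f g \<Longrightarrow> cong g h \<Longrightarrow> cong f h"
  unfolding cong_def by (drule (1) ideal_add) simp

lemma cong_cmult: "cong f g \<Longrightarrow> cong (\<lambda>w. c * f w) (\<lambda>w. c * g w)"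
  unfolding cong_def by (drule ideal_cmult[of _ c]) (simp add: right_diff_distrib)

lemma cong_sym: "cong f g \<Longrightarrow> cong g f"
  unfolding cong_def by (drule ideal_cmult[of _ "-1"]) simp

lemma cong_add: "cong f g \<Longrightarrow> cong f' g' \<Longrightarrow> cong (\<lambda>w. f w + f' w) (\<lambda>w. g w + g' w)"
  unfolding cong_def by (drule (1) ideal_add) (simp add: add_diff_add)

lemma cong_sum:
  "(\<And>k. k \<in> K \<Longrightarrow> cong (f k) (g k)) \<Longrightarrow> cong (\<lambda>w. \<Sum>k\<in>K. f k w) (\<lambda>w. \<Sum>k\<in>K. g k w)"
  by (induction K rule: infinite_finite_induct) (auto intro!: cong_add)

lemma cong_convolution:
  assumes "cong f g" "h \<in> carrier FA"
  shows "cong (convolution h f) (convolution h g)" "cong (convolution f h) (convolution g h)"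
  using ideal_convolution[of _ h] assms by (auto simp: cong_def convolution_distrib[symmetric])

lemma cong_carrier: "cong f g \<Longrightarrow> g \<in> carrier FA \<Longrightarrow> f \<in> carrier FA"
  unfolding cong_def by (drule ideal_carrier, drule (1) free_algebra_add) simp

lemma cong_word_add:
  assumes "v \<in> carrier V" "w \<in> carrier V"
  shows "cong (word [v \<oplus>\<^bsub>V\<^esub> w]) (\<lambda>u. word [v] u + word [w] u)"
proof -
  have "(\<lambda>u. word [v \<oplus>\<^bsub>V\<^esub> w] u - word [v] u - word [w] u) \<in> exterior_relations V"
    unfolding exterior_relations_def using assms by blast
  then show ?thesis unfolding cong_def by (drule_tac relation_in_ideal) (simp add: algebra_simps)
qed

lemma cong_word_smult:
  assumes "v \<in> carrier V"
  shows "cong (word [c \<odot>\<^bsub>V\<^esub> v]) (\<lambda>u. c * word [v] u)"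
proof -
  have "(\<lambda>u. word [c \<odot>\<^bsub>V\<^esub> v] u - c * word [v] u) \<in> exterior_relations V"
    unfolding exterior_relations_def using assms by blast
  then show ?thesis unfolding cong_def by (rule relation_in_ideal)
qed

lemma cong_word_square:
  assumes "v \<in> carrier V"
  shows "cong (word [v, v]) (\<lambda>u. 0)"
proof -
  have "word [v, v] \<in> exterior_relations V"
    unfolding exterior_relations_def using assms by blast
  then show ?thesis unfolding cong_def by (drule_tac relation_in_ideal) simp
qed

text \<open>Polarisation: expand (v + w)(v + w), which is congruent to 0, as are v v and w
  w.\<close>

lemma cong_word_swap:
  assumes v: "v \<in> carrier V" and w: "w \<in> carrier V"
  shows "cong (word [v, w]) (\<lambda>u. - 1 * word [w, v] u)"
proof -
  have c: "word [v] \<in> carrier FA" "word [w] \<in> carrier FA" "word [v \<oplus>\<^bsub>V\<^esub> w] \<in> carrier FA"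
    using v w add_closed by (auto intro!: free_algebra_word)
  have c': "(\<lambda>u. word [v] u + word [w] u) \<in> carrier FA" using c free_algebra_add by blast
  have a: "cong (word [v \<oplus>\<^bsub>V\<^esub> w, v \<oplus>\<^bsub>V\<^esub> w]) (convolution (\<lambda>u. word [v] u + word [w] u) (\<lambda>u. word [v] u + word [w] u))"
    using cong_trans[OF cong_convolution(1)[OF cong_word_add[OF v w] c(3)]
      cong_convolution(2)[OF cong_word_add[OF v w] c']] by simp
  have e: "convolution (\<lambda>u. word [v] u + word [w] u) (\<lambda>u. word [v] u + word [w] u)
     = (\<lambda>u. word [v, v] u + (word [v, w] u + word [w, v] u) + word [w, w] u)"
    by (simp add: convolution_distrib algebra_simps)
  have "cong (\<lambda>u. word [v, v] u + (word [v, w] u + word [w, v] u) + word [w, w] u)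
      (\<lambda>u. 0 + (word [v, w] u + word [w, v] u) + 0)"
    by (intro cong_add cong_word_square v w cong_refl)
  from cong_trans[OF cong_sym[OF this] cong_trans[OF cong_sym[OF a[unfolded e]] cong_word_square]]
  have "cong (\<lambda>u. word [v, w] u + word [w, v] u) (\<lambda>u. 0)" using v w add_closed by simp
  then show ?thesis by (simp add: cong_def)
qed

text \<open>This is how a functional descends to the quotient. The kernel of a single functional
  need not be an ideal, so \<open>J\<close> asks for vanishing in every context: its elements are
  killed by all functionals taking a word w to E (a w b). Multiplying by a word only lengthens the
  context, so \<open>J\<close> is an ideal, and the first three hypotheses put the relations into
  it; minimality of the generated ideal does the rest.\<close>

lemma linear_extension_alternating:
  assumes add: "\<And>a b v w. a \<in> lists (carrier V) \<Longrightarrow> b \<in> lists (carrier V) \<Longrightarrow> v \<in> carrier V \<Longrightarrow> w \<in> carrier V \<Longrightarrow>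
      E (a @ (v \<oplus>\<^bsub>V\<^esub> w) # b) = E (a @ v # b) + E (a @ w # b)"
    and smult: "\<And>a b v c. a \<in> lists (carrier V) \<Longrightarrow> b \<in> lists (carrier V) \<Longrightarrow> v \<in> carrier V \<Longrightarrow>
      E (a @ (c \<odot>\<^bsub>V\<^esub> v) # b) = c * E (a @ v # b)"
    and sq: "\<And>a b v. a \<in> lists (carrier V) \<Longrightarrow> b \<in> lists (carrier V) \<Longrightarrow> v \<in> carrier V \<Longrightarrow>
      E (a @ v # v # b) = 0"
    and f: "f \<in> exterior_ideal V"
  shows "linear_extension E f = 0"
proof -
  define L where "L a b g = linear_extension (\<lambda>w. E (a @ w @ b)) g" for a b g
  define J where "J = {g \<in> carrier FA. \<forall>a\<in>lists (carrier V). \<forall>b\<in>lists (carrier V). L a b g = 0}"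
  have Ladd: "L a b (\<lambda>w. g w + h w) = L a b g + L a b h" if "g \<in> carrier FA" "h \<in> carrier FA" for a b g h
    unfolding L_def by (rule linear_extension_free_add[OF that])
  have Ldiff: "L a b (\<lambda>w. g w - h w) = L a b g - L a b h" if "g \<in> carrier FA" "h \<in> carrier FA" for a b g h
    unfolding L_def by (rule linear_extension_diff[OF that])
  have Lc: "L a b (\<lambda>w. c * g w) = c * L a b g" for a b c g
    unfolding L_def by (rule linear_extension_cmult)
  have Lw: "L a b (word u) = E (a @ u @ b)" for a b u unfolding L_def by simp
  have w: "word u \<in> carrier FA" if "set u \<subseteq> carrier V" for u
    using that by (intro free_algebra_word) auto
  interpret R: ring FA by (rule free_algebra_ring)
  have minus: "\<ominus>\<^bsub>FA\<^esub> g = (\<lambda>w. - 1 * g w)" if g: "g \<in> carrier FA" for g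
    using free_algebra_cmult[OF g, of "-1"] g
    by (intro R.minus_equality) (auto simp: free_algebra_simps(4,5))
  have "Ideal.ideal J FA"
  proof (rule idealI)
    show "ring FA" by (rule free_algebra_ring)
    show "subgroup J (add_monoid FA)"
    proof (rule R.add.subgroupI)
      show "J \<subseteq> carrier FA" by (auto simp: J_def)
      show "J \<noteq> {}"
        using free_algebra_zero Lc[of _ _ 0 "\<lambda>w. 0"] by (auto simp: J_def intro!: exI[of _ "\<lambda>w. 0"])
      show "\<ominus>\<^bsub>FA\<^esub> g \<in> J" if "g \<in> J" for g
        using that minus[of g] Lc[of _ _ "-1" g] free_algebra_cmult[of g _ "-1"] by (auto simp: J_def)
      show "g \<oplus>\<^bsub>FA\<^esub> h \<in> J" if "g \<in> J" "h \<in> J" for g h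
        using that Ladd free_algebra_add[of g _ h] by (auto simp: J_def free_algebra_simps(5))
    qed
    fix g h assume g: "g \<in> J" and h: "h \<in> carrier FA"
    have gF: "g \<in> carrier FA" using g by (simp add: J_def)
    have fin: "finite {w. g w \<noteq> 0}" "finite {w. h w \<noteq> 0}" and
      lst: "\<And>w. g w \<noteq> 0 \<Longrightarrow> w \<in> lists (carrier V)" "\<And>w. h w \<noteq> 0 \<Longrightarrow> w \<in> lists (carrier V)"
      using gF h by (auto simp: free_algebra_simps(1))
    have "L a b (convolution h g) = 0" if "a \<in> lists (carrier V)" "b \<in> lists (carrier V)" for a b
    proof -
      have "L a b (convolution h g) = (\<Sum>u | h u \<noteq> 0. \<Sum>v | g v \<noteq> 0. h u * g v * E (a @ (u @ v) @ b))"
        unfolding L_def by (rule linear_extension_convolution[OF fin(2,1)])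
      also have "\<dots> = (\<Sum>u | h u \<noteq> 0. h u * L (a @ u) b g)"
        by (simp add: L_def linear_extension_def sum_distrib_left mult.assoc)
      also have "\<dots> = 0" using g that lst(2) by (intro sum.neutral) (auto simp: J_def)
      finally show ?thesis .
    qed
    then show "h \<otimes>\<^bsub>FA\<^esub> g \<in> J" using gF h by (auto simp: J_def free_algebra_simps(2) free_algebra_convolution)
    have "L a b (convolution g h) = 0" if "a \<in> lists (carrier V)" "b \<in> lists (carrier V)" for a b
    proof -
      have "L a b (convolution g h) = (\<Sum>u | g u \<noteq> 0. \<Sum>v | h v \<noteq> 0. g u * h v * E (a @ u @ v @ b))"
        using fin by (simp add: L_def linear_extension_convolution)
      also have "\<dots> = (\<Sum>v | h v \<noteq> 0. \<Sum>u | g u \<noteq> 0. h v * (g u * E (a @ u @ v @ b)))"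
        by (subst sum.swap) (simp add: mult_ac)
      also have "\<dots> = (\<Sum>v | h v \<noteq> 0. h v * L a (v @ b) g)"
        by (simp add: L_def linear_extension_def sum_distrib_left)
      also have "\<dots> = 0" using g that lst(2) by (intro sum.neutral) (auto simp: J_def)
      finally show ?thesis .
    qed
    then show "g \<otimes>\<^bsub>FA\<^esub> h \<in> J" using gF h by (auto simp: J_def free_algebra_simps(2) free_algebra_convolution)
  qed
  moreover have "exterior_relations V \<subseteq> J"
  proof
    fix g assume g: "g \<in> exterior_relations V"
    then have "L a b g = 0" if ab: "a \<in> lists (carrier V)" "b \<in> lists (carrier V)" for a b
    proof -
      consider (add) v w where "v \<in> carrier V" "w \<in> carrier V" "g = (\<lambda>u. word [v \<oplus>\<^bsub>V\<^esub> w] u - word [v] u - word [w] u)"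
        | (smult) c v where "v \<in> carrier V" "g = (\<lambda>u. word [c \<odot>\<^bsub>V\<^esub> v] u - c * word [v] u)"
        | (sq) v where "v \<in> carrier V" "g = word [v, v]"
        using g unfolding exterior_relations_def by blast
      then show ?thesis
      proof cases
        case add
        have "L a b g = L a b (\<lambda>u. word [v \<oplus>\<^bsub>V\<^esub> w] u - (word [v] u + word [w] u))"
          using add(3) by (simp add: algebra_simps)
        also have "\<dots> = E (a @ (v \<oplus>\<^bsub>V\<^esub> w) # b) - (E (a @ v # b) + E (a @ w # b))"
          using add add_closed w by (simp add: Ldiff Ladd Lw free_algebra_add)
        finally show ?thesis using assms(1)[OF ab add(1,2)] by simp
      next
        case smult
        have "L a b g = E (a @ (c \<odot>\<^bsub>V\<^esub> v) # b) - c * E (a @ v # b)"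
          using smult smult_closed w by (simp add: Ldiff Lc Lw free_algebra_cmult)
        then show ?thesis using assms(2)[OF ab smult(1)] by simp
      next
        case sq
        then show ?thesis using assms(3)[OF ab sq(1)] by (simp add: Lw)
      qed
    qed
    then show "g \<in> J" using g relations_carrier by (auto simp: J_def)
  qed
  ultimately have "exterior_ideal V \<subseteq> J"
    unfolding exterior_ideal_def by (rule R.genideal_minimal)
  then have "L [] [] f = 0" using f by (auto simp: J_def)
  then show ?thesis by (simp add: L_def)
qed

section \<open>The quotient as a vector space of cosets\<close>

lemma coset_eq_iff: "coset f = coset g \<longleftrightarrow> cong f g"
proof
  show "coset f = coset g \<Longrightarrow> cong f g" unfolding coset_def using cong_refl by blast
  show "cong f g \<Longrightarrow> coset f = coset g" unfolding coset_def using cong_sym cong_trans by blast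
qed

lemma r_coset_eq: "exterior_ideal V +>\<^bsub>FA\<^esub> f = coset f"
proof -
  have "g \<in> exterior_ideal V +>\<^bsub>FA\<^esub> f \<longleftrightarrow> cong g f" for g
  proof
    assume "g \<in> exterior_ideal V +>\<^bsub>FA\<^esub> f"
    then obtain h where "h \<in> exterior_ideal V" "g = (\<lambda>w. h w + f w)"
      by (auto simp: a_r_coset_def' free_algebra_simps(5))
    then show "cong g f" by (simp add: cong_def)
  next
    assume "cong g f"
    then show "g \<in> exterior_ideal V +>\<^bsub>FA\<^esub> f" unfolding cong_def a_r_coset_def' free_algebra_simps(5)
      by (auto intro!: bexI[of _ "\<lambda>w. g w - f w"])
  qed
  then show ?thesis by (auto simp: coset_def)
qed

lemma exterior_lift_coset:
  assumes "\<And>g. cong g f \<Longrightarrow> cong (F g) (F f)"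
  shows "exterior_lift V F (coset f) = coset (F f)"
proof -
  have "coset (F g) = coset (F f)" if "g \<in> coset f" for g
    using assms that by (simp add: coset_eq_iff) (simp add: coset_def)
  moreover have "f \<in> coset f" by (simp add: coset_def)
  ultimately show ?thesis unfolding exterior_lift_def r_coset_eq by blast
qed

lemma exterior_algebra_simps:
  "carrier (exterior_algebra V) = coset ` carrier FA"
  "\<zero>\<^bsub>exterior_algebra V\<^esub> = coset (\<lambda>w. 0)"
  "coset f \<oplus>\<^bsub>exterior_algebra V\<^esub> coset g = coset (\<lambda>w. f w + g w)"
  "c \<odot>\<^bsub>exterior_algebra V\<^esub> coset f = coset (\<lambda>w. c * f w)"
proof -
  show "carrier (exterior_algebra V) = coset ` carrier FA"
    by (auto simp: exterior_algebra_def ring.defs FactRing_def A_RCOSETS_def' r_coset_eq)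
  show "\<zero>\<^bsub>exterior_algebra V\<^esub> = coset (\<lambda>w. 0)"
    by (auto simp: exterior_algebra_def ring.defs FactRing_def coset_def cong_def)
  show "c \<odot>\<^bsub>exterior_algebra V\<^esub> coset f = coset (\<lambda>w. c * f w)"
    unfolding exterior_algebra_def ring.defs
    by (simp add: exterior_lift_coset cong_cmult)
  have "coset f \<oplus>\<^bsub>exterior_algebra V\<^esub> coset g = {\<lambda>w. f' w + g' w | f' g'. cong f' f \<and> cong g' g}"
    by (auto simp: exterior_algebra_def ring.defs FactRing_def set_add_def' free_algebra_simps(5) coset_def)
  also have "\<dots> = coset (\<lambda>w. f w + g w)"
  proof (intro equalityI subsetI)
    fix h assume h: "h \<in> coset (\<lambda>w. f w + g w)"
    then have "cong (\<lambda>w. h w - f w) g" by (simp add: coset_def cong_def algebra_simps)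
    moreover have "h = (\<lambda>w. f w + (h w - f w))" by simp
    ultimately show "h \<in> {\<lambda>w. f' w + g' w | f' g'. cong f' f \<and> cong g' g}" 
      by (intro CollectI exI[of _ f] exI[of _ "\<lambda>w. h w - f w"] conjI cong_refl)
  qed (auto simp: coset_def intro: cong_add)
  finally show "coset f \<oplus>\<^bsub>exterior_algebra V\<^esub> coset g = coset (\<lambda>w. f w + g w)" .
qed

lemma exterior_algebra_vectorspace: "vectorspace class_ring (exterior_algebra V)"
proof -
  let ?M = "exterior_algebra V"
  have "abelian_group ?M"
  proof (rule abelian_groupI)
    fix x assume "x \<in> carrier ?M"
    then obtain f where f: "f \<in> carrier FA" "x = coset f" by (auto simp: exterior_algebra_simps)
    then have "coset (\<lambda>w. - 1 * f w) \<oplus>\<^bsub>?M\<^esub> x = \<zero>\<^bsub>?M\<^esub>" by (simp add: exterior_algebra_simps)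
    moreover have "coset (\<lambda>w. - 1 * f w) \<in> carrier ?M"
      using f free_algebra_cmult[of f _ "-1"] by (auto simp: exterior_algebra_simps)
    ultimately show "\<exists>y\<in>carrier ?M. y \<oplus>\<^bsub>?M\<^esub> x = \<zero>\<^bsub>?M\<^esub>" by blast
  qed (auto simp: exterior_algebra_simps free_algebra_add free_algebra_zero add.assoc add.commute add.left_commute)
  then have "Module.module class_ring ?M"
    by (intro moduleI class_cring.cring_axioms)
      (auto simp: exterior_algebra_simps free_algebra_cmult algebra_simps)
  then show ?thesis by (simp add: vectorspace_def class_field)
qed

lemma finsum_coset:
  assumes "finite K" "\<And>k. k \<in> K \<Longrightarrow> f k \<in> carrier FA"
  shows "(\<Oplus>\<^bsub>exterior_algebra V\<^esub>k\<in>K. coset (f k)) = coset (\<lambda>w. \<Sum>k\<in>K. f k w)"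
proof -
  interpret vectorspace "class_ring :: complex ring" "exterior_algebra V"
    by (rule exterior_algebra_vectorspace)
  show ?thesis using assms
  proof (induction rule: finite_induct)
    case empty
    then show ?case by (simp add: exterior_algebra_simps(2))
  next
    case (insert k K)
    have "(\<Oplus>\<^bsub>exterior_algebra V\<^esub>k\<in>insert k K. coset (f k)) =
        coset (f k) \<oplus>\<^bsub>exterior_algebra V\<^esub> (\<Oplus>\<^bsub>exterior_algebra V\<^esub>k\<in>K. coset (f k))"
      using insert by (intro finsum_insert) (auto simp: exterior_algebra_simps(1))
    then show ?case using insert by (simp add: exterior_algebra_simps(3))
  qed
qed

end

section \<open>Fock space\<close>

text \<open>The sign of moving the unit vector e_i from the front past e_j in an increasing product.
  The value 1 for j = i makes \<open>insertion_sign i S\<close> indifferent to whether a finite S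
  contains i.\<close>

definition pair_sign :: "nat \<Rightarrow> nat \<Rightarrow> complex" where
  "pair_sign j i = (if j < i then -1 else 1)"

text \<open>
  A function on sets of naturals is a combination of the products of the unit vectors indexed by a set
  in increasing order; \<open>insertion_sign i S\<close> is the sign of sorting \<open>i\<close> into \<open>S\<close>.
\<close>

definition insertion_sign :: "nat \<Rightarrow> nat set \<Rightarrow> complex" where
  "insertion_sign i S = (\<Prod>j\<in>S. pair_sign j i)"

text \<open>In coefficient form: for each i in S, the product over S arises from e_i times the
  product over S without i. On an infinite set the sum is 0 by convention.\<close>

definition wedge :: "(nat \<Rightarrow> complex) \<Rightarrow> (nat set \<Rightarrow> complex) \<Rightarrow> nat set \<Rightarrow> complex" where
  "wedge v f S = (\<Sum>i\<in>S. insertion_sign i S * v i * f (S - {i}))"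

text \<open>The interior product with the functional summing the coordinates in A: to delete i from
  the product over \<open>insert i S\<close>, first bring e_i to the front, which costs the same
  sign as inserting it.\<close>

definition contract :: "nat set \<Rightarrow> (nat set \<Rightarrow> complex) \<Rightarrow> nat set \<Rightarrow> complex" where
  "contract A f S = (\<Sum>i\<in>A - S. insertion_sign i S * f (insert i S))"

text \<open>Used at two types: on numbers it is a unit vector, on sets of numbers a basis product of
  Fock space.\<close>

definition indicator_fun :: "'a \<Rightarrow> 'a \<Rightarrow> complex" where
  "indicator_fun a = (\<lambda>x. if x = a then 1 else 0)"

lemma pair_sign_square [simp]: "pair_sign j i * pair_sign j i = 1"
  by (simp add: pair_sign_def)

lemma pair_sign_swap: "i \<noteq> j \<Longrightarrow> pair_sign i j = - pair_sign j i"
  by (simp add: pair_sign_def)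

lemma insertion_sign_square [simp]: "insertion_sign i S * insertion_sign i S = 1"
  by (simp add: insertion_sign_def flip: prod.distrib)

lemma insertion_sign_insert:
  "finite S \<Longrightarrow> j \<notin> S \<Longrightarrow> insertion_sign i (insert j S) = pair_sign j i * insertion_sign i S"
  by (simp add: insertion_sign_def)

lemma insertion_sign_remove:
  assumes "finite S" "j \<in> S"
  shows "insertion_sign i (S - {j}) = pair_sign j i * insertion_sign i S"
proof -
  have "insertion_sign i S = pair_sign j i * insertion_sign i (S - {j})"
    using insertion_sign_insert[of "S - {j}" j i] assms by (simp add: insert_absorb)
  then show ?thesis by (simp flip: mult.assoc)
qed

lemma insertion_sign_self:
  assumes "finite S"
  shows "insertion_sign i (insert i S) = insertion_sign i S" "insertion_sign i (S - {i}) = insertion_sign i S"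
  using assms insertion_sign_insert[of S i i] insertion_sign_remove[of S i i]
  by (cases "i \<in> S"; simp add: insert_absorb pair_sign_def)+

lemma wedge_cong: "(\<And>i. i \<in> S \<Longrightarrow> f (S - {i}) = g (S - {i})) \<Longrightarrow> wedge v f S = wedge v g S"
  by (simp add: wedge_def)

lemma wedge_linear:
  "wedge v (\<lambda>S. f S + g S) = (\<lambda>S. wedge v f S + wedge v g S)"
  "wedge v (\<lambda>S. c * f S) = (\<lambda>S. c * wedge v f S)"
  "wedge (\<lambda>i. v i + w i) f = (\<lambda>S. wedge v f S + wedge w f S)"
  "wedge (\<lambda>i. v i - w i) f = (\<lambda>S. wedge v f S - wedge w f S)"
  "wedge (\<lambda>i. c * v i) f = (\<lambda>S. c * wedge v f S)"
  "wedge v (\<lambda>S. 0) = (\<lambda>S. 0)"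
  by (auto simp: wedge_def algebra_simps sum.distrib sum_distrib_left sum_subtractf)

lemma contract_linear:
  "contract A (\<lambda>S. f S + g S) = (\<lambda>S. contract A f S + contract A g S)"
  "contract A (\<lambda>S. f S - g S) = (\<lambda>S. contract A f S - contract A g S)"
  "contract A (\<lambda>S. c * f S) = (\<lambda>S. c * contract A f S)"
  "contract A (\<lambda>S. 0) = (\<lambda>S. 0)"
  by (auto simp: contract_def algebra_simps sum.distrib sum_distrib_left sum_subtractf)

text \<open>Both sides sum over ordered pairs of distinct indices removed from S. Removing i and
  then j, or j and then i, gives opposite signs, since just one of the two indices is smaller than
  the other. For infinite S both sides are 0.\<close>

lemma wedge_anticommute: "wedge v (wedge w f) S = - wedge w (wedge v f) S"
proof (cases "finite S")
  case True
  have e: "wedge v (wedge w f) S =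
    (\<Sum>(i, j)\<in>(SIGMA i:S. S - {i}). insertion_sign i S * insertion_sign j (S - {i}) * v i * w j * f (S - {i} - {j}))"
    for v w
    using True unfolding wedge_def by (simp add: sum_distrib_left sum.Sigma mult_ac)
  have "wedge v (wedge w f) S =
    (\<Sum>(j, i)\<in>(SIGMA i:S. S - {i}). insertion_sign i S * insertion_sign j (S - {i}) * v i * w j * f (S - {i} - {j}))"
    unfolding e by (rule sum.reindex_bij_witness[where i = prod.swap and j = prod.swap]) auto
  also have "\<dots> = (\<Sum>(j, i)\<in>(SIGMA i:S. S - {i}). - (insertion_sign j S * insertion_sign i (S - {j}) * w j * v i * f (S - {j} - {i})))"
  proof (rule sum.cong[OF refl])
    fix x assume "x \<in> (SIGMA i:S. S - {i})"
    then obtain j i where x: "x = (j, i)" and ij: "j \<in> S" "i \<in> S" "i \<noteq> j" by auto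
    have "insertion_sign i S * insertion_sign j (S - {i}) = - (insertion_sign j S * insertion_sign i (S - {j}))"
      using ij True pair_sign_swap[OF ij(3)] by (simp add: insertion_sign_remove)
    moreover have "S - {i} - {j} = S - {j} - {i}" by auto
    ultimately show "(case x of (j, i) \<Rightarrow> insertion_sign i S * insertion_sign j (S - {i}) * v i * w j * f (S - {i} - {j}))
      = (case x of (j, i) \<Rightarrow> - (insertion_sign j S * insertion_sign i (S - {j}) * w j * v i * f (S - {j} - {i})))"
      by (simp add: x)
  qed
  also have "\<dots> = - wedge w (wedge v f) S" unfolding e by (simp add: sum_negf case_prod_unfold)
  finally show ?thesis .
qed (simp add: wedge_def)

lemma wedge_square: "wedge v (wedge v f) = (\<lambda>S. 0)"
  using wedge_anticommute[of v v f] by (simp add: fun_eq_iff)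

text \<open>The canonical anticommutation relation. Inserting and deleting the same index k gives v
  k times f S, from the first summand if k is outside S and from the second if it lies in S. For
  different indices, the two orders of inserting k and deleting i carry opposite signs and
  cancel.\<close>

lemma contract_wedge:
  assumes S: "finite S" and A: "finite A"
  shows "contract A (wedge v f) S + wedge v (contract A f) S = (\<Sum>k\<in>A. v k) * f S"
proof -
  let ?c = "\<lambda>k i. insertion_sign k S * insertion_sign i (insert k S) * v i * f (insert k S - {i})"
  have "contract A (wedge v f) S = (\<Sum>k\<in>A - S. \<Sum>i\<in>insert k S. ?c k i)"
    unfolding contract_def wedge_def by (simp add: sum_distrib_left mult.assoc)
  also have "\<dots> = (\<Sum>k\<in>A - S. v k * f S + (\<Sum>i\<in>S. ?c k i))"
    using S by (intro sum.cong) (auto simp: insertion_sign_self)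
  also have "\<dots> = (\<Sum>k\<in>A - S. v k * f S) + (\<Sum>k\<in>A - S. \<Sum>i\<in>S. ?c k i)"
    by (rule sum.distrib)
  finally have 1: "contract A (wedge v f) S = (\<Sum>k\<in>A - S. v k * f S) + (\<Sum>i\<in>S. \<Sum>k\<in>A - S. ?c k i)"
    by (simp add: sum.swap[of _ S])
  let ?d = "\<lambda>k i. insertion_sign i S * insertion_sign k (S - {i}) * v i * f (insert k (S - {i}))"
  have "wedge v (contract A f) S = (\<Sum>i\<in>S. \<Sum>k\<in>A - (S - {i}). ?d k i)"
    unfolding contract_def wedge_def by (simp add: sum_distrib_left mult_ac)
  also have "\<dots> = (\<Sum>i\<in>S. (if i \<in> A then v i * f S else 0) + (\<Sum>k\<in>A - S. ?d k i))"
  proof (rule sum.cong[OF refl])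
    fix i assume i: "i \<in> S"
    have di: "?d i i = v i * f S" using i S by (simp add: insertion_sign_self insert_absorb)
    show "(\<Sum>k\<in>A - (S - {i}). ?d k i) = (if i \<in> A then v i * f S else 0) + (\<Sum>k\<in>A - S. ?d k i)"
    proof (cases "i \<in> A")
      case True
      then have "A - (S - {i}) = insert i (A - S)" using i by auto
      then show ?thesis using True A i di by simp
    next
      case False
      then have "A - (S - {i}) = A - S" by auto
      then show ?thesis using False by simp
    qed
  qed
  also have "\<dots> = (\<Sum>i\<in>A \<inter> S. v i * f S) + (\<Sum>i\<in>S. \<Sum>k\<in>A - S. ?d k i)"
    using S by (simp add: sum.distrib sum.If_cases Int_commute)
  finally have 2: "wedge v (contract A f) S = (\<Sum>i\<in>A \<inter> S. v i * f S) + (\<Sum>i\<in>S. \<Sum>k\<in>A - S. ?d k i)" .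
  have "(\<Sum>i\<in>S. \<Sum>k\<in>A - S. ?c k i) = (\<Sum>i\<in>S. \<Sum>k\<in>A - S. - ?d k i)"
  proof (intro sum.cong refl)
    fix i k assume ik: "i \<in> S" "k \<in> A - S"
    then have ne: "i \<noteq> k" by auto
    have "insertion_sign k S * insertion_sign i (insert k S) = - (insertion_sign i S * insertion_sign k (S - {i}))"
      using ik S pair_sign_swap[OF ne] by (simp add: insertion_sign_remove insertion_sign_insert)
    moreover have "insert k S - {i} = insert k (S - {i})" using ne by auto
    ultimately show "?c k i = - ?d k i" by simp
  qed
  then have "contract A (wedge v f) S + wedge v (contract A f) S =
    (\<Sum>k\<in>A - S. v k * f S) + (\<Sum>k\<in>A \<inter> S. v k * f S)"
    unfolding 1 2 by (simp add: sum_negf)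
  also have "\<dots> = (\<Sum>k\<in>A. v k * f S)"
    using A by (subst sum.union_disjoint[symmetric]) (auto intro!: sum.cong)
  finally show ?thesis by (simp add: sum_distrib_right)
qed

section \<open>The action of permutations\<close>

text \<open>For injective g and finite S, which need not be invariant, this is -1 to the number of
  inversions of g within S. The first factor is -1 throughout, but with it the contribution of a
  pair is symmetric in i and j, so that S can be enumerated in any order.\<close>

definition inversion_sign :: "(nat \<Rightarrow> nat) \<Rightarrow> nat set \<Rightarrow> complex" where
  "inversion_sign g S = (\<Prod>(i, j) | i \<in> S \<and> j \<in> S \<and> i < j. pair_sign i j * pair_sign (g i) (g j))"

text \<open>A product over T goes to the product of the images, taken in the order of T; sorting
  them costs \<open>inversion_sign g T\<close>. The coefficient at S comes from its
  preimage.\<close>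

definition fock_action :: "(nat \<Rightarrow> nat) \<Rightarrow> (nat set \<Rightarrow> complex) \<Rightarrow> nat set \<Rightarrow> complex" where
  "fock_action g f S = inversion_sign g (g -` S) * f (g -` S)"

text \<open>The new pairs are those of i with the elements of S. By symmetry of the pair
  contribution, they multiply to the sign of inserting i into S times that of inserting g i into the
  image; the latter is its own inverse and appears on the left.\<close>

lemma inversion_sign_insert:
  assumes S: "finite S" and i: "i \<notin> S" and g: "inj g"
  shows "inversion_sign g (insert i S) * insertion_sign (g i) (g ` S) = inversion_sign g S * insertion_sign i S"
proof -
  let ?c = "\<lambda>i j. pair_sign i j * pair_sign (g i) (g j)"
  let ?P = "\<lambda>S. {(i, j). i \<in> S \<and> j \<in> S \<and> i < j}"
  have fin: "finite (?P S)" using S by (rule_tac finite_subset[of _ "S \<times> S"]) auto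
  let ?q = "\<lambda>j. if j < i then (j, i) else (i, j)"
  have sym: "?c a b = ?c b a" if "a \<noteq> b" for a b
    using pair_sign_swap[OF that] pair_sign_swap[of "g a" "g b"] that g by (simp add: inj_eq)
  have eq: "?P (insert i S) = ?P S \<union> ?q ` S"
  proof (intro equalityI subsetI)
    fix x assume "x \<in> ?P (insert i S)"
    then obtain a b where x: "x = (a, b)" "a \<in> insert i S" "b \<in> insert i S" "a < b" by auto
    have "x \<in> ?P S" if "a \<noteq> i" "b \<noteq> i" using x that by auto
    moreover have "x = ?q b" "b \<in> S" if "a = i" using x that by auto
    moreover have "x = ?q a" "a \<in> S" if "b = i" using x that by auto
    ultimately show "x \<in> ?P S \<union> ?q ` S" by blast
  next
    fix x assume "x \<in> ?P S \<union> ?q ` S"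
    then show "x \<in> ?P (insert i S)"
    proof
      assume "x \<in> ?q ` S"
      then obtain j where j: "j \<in> S" "x = ?q j" by blast
      then have "i \<noteq> j" using i by blast
      then show ?thesis using j by auto
    qed auto
  qed
  have inj: "inj_on ?q S" using i by (auto simp: inj_on_def split: if_splits)
  have "inversion_sign g (insert i S) = (\<Prod>(i, j)\<in>?P S. ?c i j) * (\<Prod>(i, j)\<in>?q ` S. ?c i j)"
    unfolding inversion_sign_def eq by (rule prod.union_disjoint) (use fin S i in \<open>auto split: if_splits\<close>)
  also have "(\<Prod>(i, j)\<in>?q ` S. ?c i j) = (\<Prod>j\<in>S. pair_sign j i * pair_sign (g j) (g i))"
    unfolding prod.reindex[OF inj] o_def
  proof (rule prod.cong[OF refl])
    fix j assume "j \<in> S"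
    then have "i \<noteq> j" using i by blast
    from sym[OF this] show "(case ?q j of (i, j) \<Rightarrow> ?c i j) = pair_sign j i * pair_sign (g j) (g i)"
      by (cases "j < i") (simp_all only: if_True if_False case_prod_conv)
  qed
  also have "\<dots> = insertion_sign i S * (\<Prod>j\<in>S. pair_sign (g j) (g i))"
    by (simp only: insertion_sign_def prod.distrib)
  also have "(\<Prod>j\<in>S. pair_sign (g j) (g i)) = insertion_sign (g i) (g ` S)"
    unfolding insertion_sign_def prod.reindex[OF inj_on_subset[OF g subset_UNIV]] by simp
  finally show ?thesis by (simp add: inversion_sign_def mult.assoc)
qed

text \<open>Functoriality of the exterior algebra. Term by term, sorting the images of T without i
  and then inserting g i agrees with inserting i first and sorting all images afterwards, by
  \<open>inversion_sign_insert\<close>.\<close>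

lemma fock_action_wedge:
  assumes g: "bij g"
  shows "wedge (\<lambda>i. v (inv' g i)) (fock_action g f) = fock_action g (wedge v f)"
proof
  fix S
  define T where "T = g -` S"
  have S: "S = g ` T" using g by (simp add: T_def bij_is_surj surj_image_vimage_eq)
  have injg: "inj g" using g by (rule bij_is_inj)
  have im: "g -` (g ` U) = U" for U using injg by (rule inj_vimage_image_eq)
  show "wedge (\<lambda>i. v (inv' g i)) (fock_action g f) S = fock_action g (wedge v f) S"
  proof (cases "finite T")
    case True
    have "wedge (\<lambda>i. v (inv' g i)) (fock_action g f) S =
      (\<Sum>i\<in>T. insertion_sign (g i) (g ` T) * v i * fock_action g f (g ` T - {g i}))"
      unfolding wedge_def S sum.reindex[OF inj_on_subset[OF injg subset_UNIV]]
      using injg by (simp add: im inv_f_f)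
    also have "\<dots> = (\<Sum>i\<in>T. inversion_sign g T * (insertion_sign i T * v i * f (T - {i})))"
    proof (rule sum.cong[OF refl])
      fix i assume i: "i \<in> T"
      have e: "g ` T - {g i} = g ` (T - {i})" using injg by (auto simp: inj_eq)
      have "inversion_sign g (insert i (T - {i})) * insertion_sign (g i) (g ` (T - {i})) =
          inversion_sign g (T - {i}) * insertion_sign i (T - {i})"
        using True injg by (intro inversion_sign_insert) auto
      moreover have "insert i (T - {i}) = T" using i by auto
      moreover have "insertion_sign (g i) (g ` (T - {i})) = insertion_sign (g i) (g ` T)"
        unfolding e[symmetric] using True by (intro insertion_sign_self) auto
      moreover have "insertion_sign i (T - {i}) = insertion_sign i T"
        using True by (intro insertion_sign_self)
      ultimately have t: "inversion_sign g (T - {i}) * insertion_sign i T = inversion_sign g T * insertion_sign (g i) (g ` T)"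
        by simp
      have "insertion_sign (g i) (g ` T) * inversion_sign g (T - {i}) =
          insertion_sign (g i) (g ` T) * (inversion_sign g (T - {i}) * insertion_sign i T) * insertion_sign i T"
        by (simp add: mult.assoc)
      also have "\<dots> = inversion_sign g T * insertion_sign i T *
          (insertion_sign (g i) (g ` T) * insertion_sign (g i) (g ` T))"
        unfolding t by (simp only: mult_ac)
      finally have *: "insertion_sign (g i) (g ` T) * inversion_sign g (T - {i}) = inversion_sign g T * insertion_sign i T"
        by simp
      have "insertion_sign (g i) (g ` T) * v i * fock_action g f (g ` T - {g i}) =
          (insertion_sign (g i) (g ` T) * inversion_sign g (T - {i})) * v i * f (T - {i})"
        unfolding e fock_action_def im by (simp only: mult_ac)
      then show "insertion_sign (g i) (g ` T) * v i * fock_action g f (g ` T - {g i}) =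
          inversion_sign g T * (insertion_sign i T * v i * f (T - {i}))"
        unfolding * by (simp only: mult_ac)
    qed
    finally show ?thesis unfolding fock_action_def wedge_def[of v] T_def[symmetric] by (simp add: sum_distrib_left)
  next
    case False
    then have "infinite S" unfolding S using injg finite_imageD inj_on_subset by blast
    then show ?thesis using False by (simp add: fock_action_def wedge_def T_def)
  qed
qed

text \<open>A permutation of A preserves the functional summing the coordinates in A, hence commutes
  with contraction by it; in indices, g maps the complement of T in A onto that of S.\<close>

lemma fock_action_contract:
  assumes g: "g permutes A" and S: "finite S"
  shows "contract A (fock_action g f) S = fock_action g (contract A f) S"
proof -
  define T where "T = g -` S"
  have injg: "inj g" using g by (rule permutes_inj)
  have S': "S = g ` T" using g by (simp add: T_def permutes_surj surj_image_vimage_eq)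
  have im: "g -` (g ` U) = U" for U using injg by (rule inj_vimage_image_eq)
  have T: "finite T" using S injg unfolding T_def by (intro finite_vimageI)
  have D: "A - S = g ` (A - T)"
    using image_set_diff[OF injg, of A T] permutes_image[OF g] by (simp add: S')
  have "contract A (fock_action g f) S =
    (\<Sum>i\<in>A - T. insertion_sign (g i) (g ` T) * fock_action g f (g ` insert i T))"
    unfolding contract_def D sum.reindex[OF inj_on_subset[OF injg subset_UNIV]] by (simp add: S')
  also have "\<dots> = (\<Sum>i\<in>A - T. inversion_sign g T * (insertion_sign i T * f (insert i T)))"
  proof (rule sum.cong[OF refl])
    fix i assume i: "i \<in> A - T"
    have *: "inversion_sign g (insert i T) * insertion_sign (g i) (g ` T) = inversion_sign g T * insertion_sign i T"
      using inversion_sign_insert[OF T _ injg] i by auto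
    have "insertion_sign (g i) (g ` T) * fock_action g f (g ` insert i T) =
        (inversion_sign g (insert i T) * insertion_sign (g i) (g ` T)) * f (insert i T)"
      unfolding fock_action_def im by (simp only: mult_ac)
    then show "insertion_sign (g i) (g ` T) * fock_action g f (g ` insert i T) =
        inversion_sign g T * (insertion_sign i T * f (insert i T))"
      unfolding * by (simp only: mult_ac)
  qed
  finally show ?thesis unfolding fock_action_def contract_def[of A f] T_def[symmetric] by (simp add: sum_distrib_left)
qed

section \<open>Traces on the exterior algebra of a coordinate space\<close>

text \<open>Operators act on functions of all sets of numbers. The condition says that on subsets of
  A the operator is given by a matrix, with entry \<open>X (indicator_fun T) S\<close> in row S and
  column T; \<open>fock_trace\<close> is the trace of this matrix, so Fock space need not be set up
  as a vector space.\<close>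

definition kernel_operator :: "nat set \<Rightarrow> ((nat set \<Rightarrow> complex) \<Rightarrow> nat set \<Rightarrow> complex) \<Rightarrow> bool" where
  "kernel_operator A X \<longleftrightarrow> (\<forall>f. \<forall>S\<in>Pow A. X f S = (\<Sum>T\<in>Pow A. f T * X (indicator_fun T) S))"

definition fock_trace :: "nat set \<Rightarrow> ((nat set \<Rightarrow> complex) \<Rightarrow> nat set \<Rightarrow> complex) \<Rightarrow> complex" where
  "fock_trace A X = (\<Sum>S\<in>Pow A. X (indicator_fun S) S)"

lemma kernel_operatorI:
  assumes A: "finite A"
    and X: "\<And>f S. S \<in> Pow A \<Longrightarrow> X f S = (\<Sum>k\<in>K S. c k S * f (\<tau> k S))"
    and \<tau>: "\<And>k S. S \<in> Pow A \<Longrightarrow> k \<in> K S \<Longrightarrow> \<tau> k S \<in> Pow A"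
  shows "kernel_operator A X"
  unfolding kernel_operator_def
proof (intro allI ballI)
  fix f S assume S: "S \<in> Pow A"
  have "X f S = (\<Sum>k\<in>K S. \<Sum>T\<in>Pow A. if T = \<tau> k S then c k S * f T else 0)"
    unfolding X[OF S] using \<tau>[OF S] A by (intro sum.cong) auto
  also have "\<dots> = (\<Sum>T\<in>Pow A. \<Sum>k\<in>K S. f T * (c k S * indicator_fun T (\<tau> k S)))"
    by (subst sum.swap) (auto simp: indicator_fun_def intro!: sum.cong)
  also have "\<dots> = (\<Sum>T\<in>Pow A. f T * X (indicator_fun T) S)"
    unfolding X[OF S] by (simp add: sum_distrib_left)
  finally show "X f S = (\<Sum>T\<in>Pow A. f T * X (indicator_fun T) S)" .
qed

lemma kernel_operator_wedge: "finite A \<Longrightarrow> kernel_operator A (wedge v)"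
  by (rule kernel_operatorI[where K = "\<lambda>S. S" and c = "\<lambda>i S. insertion_sign i S * v i" and \<tau> = "\<lambda>i S. S - {i}"])
    (auto simp: wedge_def)

lemma kernel_operator_contract: "finite A \<Longrightarrow> kernel_operator A (contract A)"
  by (rule kernel_operatorI[where K = "\<lambda>S. A - S" and c = insertion_sign and \<tau> = insert])
    (auto simp: contract_def)

lemma kernel_operator_action:
  assumes "finite A" "g permutes A"
  shows "kernel_operator A (fock_action g)"
proof (rule kernel_operatorI[where K = "\<lambda>S. {()}" and c = "\<lambda>_ S. inversion_sign g (g -` S)" and \<tau> = "\<lambda>_ S. g -` S"])
  show "g -` S \<in> Pow A" if "S \<in> Pow A" for S
    using assms that by (auto simp: permutes_in_image)
qed (use assms in \<open>auto simp: fock_action_def\<close>)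

lemma kernel_operator_comp:
  assumes X: "kernel_operator A X" and Y: "kernel_operator A Y"
  shows "kernel_operator A (\<lambda>f. X (Y f))"
  unfolding kernel_operator_def
proof (intro allI ballI)
  fix f S assume S: "S \<in> Pow A"
  have "X (Y f) S = (\<Sum>T\<in>Pow A. Y f T * X (indicator_fun T) S)"
    using X S unfolding kernel_operator_def by blast
  also have "\<dots> = (\<Sum>T\<in>Pow A. (\<Sum>U\<in>Pow A. f U * Y (indicator_fun U) T) * X (indicator_fun T) S)"
  proof (rule sum.cong[OF refl])
    fix T assume "T \<in> Pow A"
    then have "Y f T = (\<Sum>U\<in>Pow A. f U * Y (indicator_fun U) T)"
      using Y unfolding kernel_operator_def by blast
    then show "Y f T * X (indicator_fun T) S =
        (\<Sum>U\<in>Pow A. f U * Y (indicator_fun U) T) * X (indicator_fun T) S" by (rule arg_cong)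
  qed
  also have "\<dots> = (\<Sum>U\<in>Pow A. \<Sum>T\<in>Pow A. f U * (Y (indicator_fun U) T * X (indicator_fun T) S))"
    by (subst sum.swap) (simp add: sum_distrib_right mult.assoc)
  also have "\<dots> = (\<Sum>U\<in>Pow A. f U * X (Y (indicator_fun U)) S)"
  proof (rule sum.cong[OF refl])
    fix U
    have "X (Y (indicator_fun U)) S = (\<Sum>T\<in>Pow A. Y (indicator_fun U) T * X (indicator_fun T) S)"
      using X S unfolding kernel_operator_def by blast
    then show "(\<Sum>T\<in>Pow A. f U * (Y (indicator_fun U) T * X (indicator_fun T) S)) = f U * X (Y (indicator_fun U)) S"
      by (simp add: sum_distrib_left)
  qed
  finally show "X (Y f) S = (\<Sum>U\<in>Pow A. f U * X (Y (indicator_fun U)) S)" .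
qed

lemma fock_trace_commute:
  assumes X: "kernel_operator A X" and Y: "kernel_operator A Y"
  shows "fock_trace A (\<lambda>f. X (Y f)) = fock_trace A (\<lambda>f. Y (X f))"
proof -
  have e: "fock_trace A (\<lambda>f. X (Y f)) =
    (\<Sum>S\<in>Pow A. \<Sum>T\<in>Pow A. Y (indicator_fun S) T * X (indicator_fun T) S)"
    if "kernel_operator A X" for X Y
    unfolding fock_trace_def
  proof (rule sum.cong[OF refl])
    fix S assume "S \<in> Pow A"
    then show "X (Y (indicator_fun S)) S = (\<Sum>T\<in>Pow A. Y (indicator_fun S) T * X (indicator_fun T) S)"
      using that unfolding kernel_operator_def by blast
  qed
  show ?thesis unfolding e[OF X] e[OF Y] by (subst sum.swap) (simp add: mult.commute)
qed

lemma fock_trace_projection: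
  assumes A: "finite A" and m: "m \<in> A" and g: "g permutes A"
  shows "2 * fock_trace A (\<lambda>f. fock_action g (contract A (wedge (indicator_fun m) f))) = fock_trace A (fock_action g)"
proof -
  let ?u = "wedge (indicator_fun m)" and ?d = "contract A" and ?a = "fock_action g"
  note k = kernel_operator_wedge[OF A] kernel_operator_contract[OF A] kernel_operator_action[OF A g]
  have fS: "finite S" if "S \<in> Pow A" for S using A that finite_subset by auto
  have fV: "finite (g -` S)" if "S \<in> Pow A" for S using fS[OF that] g by (simp add: finite_vimageI permutes_inj)
  have "fock_trace A (\<lambda>f. ?a (?u (?d f))) = fock_trace A (\<lambda>f. ?d (?a (?u f)))"
    using fock_trace_commute[OF kernel_operator_comp[OF k(3) k(1)] k(2)] .
  also have "\<dots> = fock_trace A (\<lambda>f. ?a (?d (?u f)))"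
    unfolding fock_trace_def using fS by (intro sum.cong refl fock_action_contract[OF g])
  finally have "2 * fock_trace A (\<lambda>f. ?a (?d (?u f))) =
      fock_trace A (\<lambda>f. ?a (?d (?u f))) + fock_trace A (\<lambda>f. ?a (?u (?d f)))" by simp
  also have "\<dots> = fock_trace A ?a"
    unfolding fock_trace_def sum.distrib[symmetric]
  proof (rule sum.cong[OF refl])
    fix S assume S: "S \<in> Pow A"
    have one: "(\<Sum>k\<in>A. indicator_fun m k) = 1" using A m by (simp add: indicator_fun_def)
    show "?a (?d (?u (indicator_fun S))) S + ?a (?u (?d (indicator_fun S))) S = ?a (indicator_fun S) S"
      unfolding fock_action_def distrib_left[symmetric] contract_wedge[OF fV[OF S] A] one by simp
  qed
  finally show ?thesis .
qed

lemma fock_trace_action: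
  assumes A: "finite A" and g: "g permutes A"
  shows "fock_trace A (fock_action g) = (\<Sum>S | S \<subseteq> A \<and> g ` S = S. inversion_sign g S)"
proof -
  have v: "g -` S = S \<longleftrightarrow> g ` S = S" for S
    using g by (metis inj_vimage_image_eq permutes_inj permutes_surj surj_image_vimage_eq)
  have "fock_trace A (fock_action g) = (\<Sum>S\<in>Pow A. if g ` S = S then inversion_sign g S else 0)"
    unfolding fock_trace_def
  proof (rule sum.cong[OF refl])
    fix S
    show "fock_action g (indicator_fun S) S = (if g ` S = S then inversion_sign g S else 0)"
      using v[of S] by (cases "g ` S = S") (simp_all add: fock_action_def indicator_fun_def)
  qed
  also have "\<dots> = (\<Sum>S\<in>{S \<in> Pow A. g ` S = S}. inversion_sign g S)"
    by (subst sum.inter_filter) (use A in auto)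
  finally show ?thesis by (simp add: Pow_def)
qed

section \<open>Invariant subsets of a permutation\<close>

lemma inversion_sign_insert_eq:
  assumes "finite S" "i \<notin> S" "inj g"
  shows "inversion_sign g (insert i S) =
    inversion_sign g S * insertion_sign i S * insertion_sign (g i) (g ` S)"
proof -
  have "inversion_sign g (insert i S) * (insertion_sign (g i) (g ` S) * insertion_sign (g i) (g ` S))
    = inversion_sign g S * insertion_sign i S * insertion_sign (g i) (g ` S)"
    using inversion_sign_insert[OF assms] by (simp only: mult.assoc[symmetric])
  then show ?thesis by (simp only: insertion_sign_square mult_1_right)
qed

text \<open>Besides the pairs within S and within T there are the mixed ones. They contribute the
  product over i in S of the sign of inserting i into T, once before and once after applying g; as g
  permutes both S and T, the two products agree and cancel.\<close>

lemma inversion_sign_union: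
  assumes S: "finite S" and T: "finite T" and disj: "S \<inter> T = {}" and g: "inj g"
    and inv: "g ` S = S" "g ` T = T"
  shows "inversion_sign g (S \<union> T) = inversion_sign g S * inversion_sign g T"
proof -
  note ins = inversion_sign_insert_eq[OF _ _ g]
  have un: "insertion_sign i (U \<union> W) = insertion_sign i U * insertion_sign i W"
    if "finite U" "finite W" "U \<inter> W = {}" for i U W
    using that unfolding insertion_sign_def by (rule prod.union_disjoint)
  \<comment> \<open>The induction passes through sets U that g need not preserve, so the mixed signs
    are carried along until U = S.\<close>
  have gen: "inversion_sign g (U \<union> T) = inversion_sign g U * inversion_sign g T *
      (\<Prod>i\<in>U. insertion_sign i T * insertion_sign (g i) (g ` T))"
    if "finite U" "U \<inter> T = {}" for U using that
  proof (induction rule: finite_induct)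
    case empty
    then show ?case by (simp add: inversion_sign_def)
  next
    case (insert i U)
    have "inversion_sign g (insert i U \<union> T) =
        inversion_sign g (U \<union> T) * insertion_sign i (U \<union> T) * insertion_sign (g i) (g ` (U \<union> T))"
      using ins[of "U \<union> T" i] insert T by auto
    moreover have "insertion_sign i (U \<union> T) = insertion_sign i U * insertion_sign i T"
      using insert T by (intro un) auto
    moreover have "insertion_sign (g i) (g ` (U \<union> T)) = insertion_sign (g i) (g ` U) * insertion_sign (g i) (g ` T)"
      unfolding image_Un using insert T image_Int[OF g, of U T] by (intro un) auto
    ultimately show ?case using insert ins[of U i] by (simp add: mult_ac)
  qed
  have "(\<Prod>i\<in>S. insertion_sign i T * insertion_sign (g i) (g ` T)) =
      (\<Prod>i\<in>S. insertion_sign i T) * (\<Prod>i\<in>g ` S. insertion_sign i T)"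
    unfolding prod.distrib prod.reindex[OF inj_on_subset[OF g subset_UNIV]] inv(2) by simp
  also have "\<dots> = 1" unfolding inv(1) by (simp flip: prod.distrib)
  finally show ?thesis using gen[OF S disj] by simp
qed

lemma inversion_sign_Union:
  assumes "finite \<T>" and "\<And>C. C \<in> \<T> \<Longrightarrow> finite C \<and> g ` C = C" and "pairwise disjnt \<T>" and g: "inj g"
  shows "inversion_sign g (\<Union>\<T>) = (\<Prod>C\<in>\<T>. inversion_sign g C)"
  using assms(1-3)
proof (induction rule: finite_induct)
  case empty
  then show ?case by (simp add: inversion_sign_def)
next
  case (insert C \<T>)
  have "inversion_sign g (C \<union> \<Union>\<T>) = inversion_sign g C * inversion_sign g (\<Union>\<T>)"
  proof (rule inversion_sign_union[OF _ _ _ g])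
    show "C \<inter> \<Union>\<T> = {}" using insert.prems(2) insert.hyps by (auto simp: pairwise_insert disjnt_def)
    show "g ` \<Union>\<T> = \<Union>\<T>" using insert.prems(1) by (simp add: image_Union)
  qed (use insert in auto)
  then show ?case using insert by (simp add: pairwise_insert)
qed

text \<open>In the cyclic enumeration of the orbit, g shifts positions by 1. Comparing the pairs of
  positions before and after the shift, all cancel except those with the starting point, one sign -1
  for each of the other elements.\<close>

lemma inversion_sign_orbit:
  assumes g: "inj g" and x: "x \<in> orbit g x"
  shows "inversion_sign g (orbit g x) = (- 1) ^ (card (orbit g x) - 1)"
proof -
  define y where "y n = (g ^^ n) x" for n
  define l where "l = funpow_dist1 g x x"
  obtain n where l: "l = Suc n" unfolding l_def by blast
  have orb: "orbit g x = y ` {..<l}" and inj: "inj_on y {..<l}"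
    using orbit_conv_funpow_dist1[OF x] inj_on_funpow_dist1[OF x]
    unfolding y_def l_def atLeast0LessThan by auto
  have yl: "y l = y 0" using funpow_dist1_prop[OF x] by (simp add: y_def l_def)
  have gy: "g (y k) = y (Suc k)" for k by (simp add: y_def)
  define F where "F a b = pair_sign (y a) (y b)" for a b
  \<comment> \<open>The orbit is enumerated cyclically instead of increasingly;
    \<open>inversion_sign_insert_eq\<close> permits this, as the inserted element may lie anywhere
    relative to the set.\<close>
  have step: "inversion_sign g (y ` {..<k}) = (\<Prod>b<k. (\<Prod>a<b. F a b) * (\<Prod>a<b. F (Suc a) (Suc b)))"
    if "k \<le> l" for k using that
  proof (induction k)
    case 0
    then show ?case by (simp add: inversion_sign_def)
  next
    case (Suc k)
    have ik: "inj_on y {..k}" using inj by (rule inj_on_subset) (use Suc.prems in auto)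
    have nin: "y k \<notin> y ` {..<k}"
    proof
      assume "y k \<in> y ` {..<k}"
      then obtain a where "a < k" "y k = y a" by auto
      then show False using inj_onD[OF ik, of k a] by simp
    qed
    have ik': "inj_on y {..<k}" using ik by (rule inj_on_subset) auto
    have ins: "insertion_sign (y k) (y ` {..<k}) = (\<Prod>a<k. F a k)"
      unfolding insertion_sign_def prod.reindex[OF ik'] F_def by simp
    have ins': "insertion_sign (y (Suc k)) (g ` y ` {..<k}) = (\<Prod>a<k. F (Suc a) (Suc k))"
      unfolding insertion_sign_def prod.reindex[OF inj_on_subset[OF g subset_UNIV]] prod.reindex[OF ik'] F_def
      by (simp add: gy)
    have "inversion_sign g (insert (y k) (y ` {..<k})) =
        inversion_sign g (y ` {..<k}) * (\<Prod>a<k. F a k) * (\<Prod>a<k. F (Suc a) (Suc k))"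
      using inversion_sign_insert_eq[OF _ nin g] by (simp only: gy ins ins' finite_imageI finite_lessThan)
    then show ?case using Suc by (simp add: lessThan_Suc mult_ac)
  qed
  \<comment> \<open>The pairs of positions 0..n and the pairs of positions 1..l have the pairs within 1..n in common; their contribution \<open>?Q\<close> squares to 1.\<close>
  let ?Q = "\<Prod>b<n. \<Prod>a<b. F (Suc a) (Suc b)"
  have "(\<Prod>b<l. \<Prod>a<b. F a b) = (\<Prod>b<n. \<Prod>a<Suc b. F a (Suc b))"
    unfolding l prod.lessThan_Suc_shift[of _ n] by simp
  also have "\<dots> = (\<Prod>b<n. F 0 (Suc b)) * ?Q"
    by (simp only: prod.lessThan_Suc_shift prod.distrib)
  finally have 1: "(\<Prod>b<l. \<Prod>a<b. F a b) = (\<Prod>b<n. F 0 (Suc b)) * ?Q" .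
  have 2: "(\<Prod>b<l. \<Prod>a<b. F (Suc a) (Suc b)) = ?Q * (\<Prod>a<n. F (Suc a) l)"
    unfolding l by simp
  have Q: "?Q * ?Q = 1" by (simp add: F_def flip: prod.distrib)
  have R: "(\<Prod>b<n. F 0 (Suc b)) * (\<Prod>a<n. F (Suc a) l) = (- 1) ^ n"
  proof -
    \<comment> \<open>Position l is position 0 again, so the two signs compare the same two numbers
      in opposite orders.\<close>
    have "F 0 (Suc b) * F (Suc b) l = - 1" if "b < n" for b
    proof -
      have "y (Suc b) \<noteq> y 0" using inj that l by (auto dest!: inj_onD)
      then show ?thesis unfolding F_def yl by (simp add: pair_sign_swap[of "y (Suc b)" "y 0"])
    qed
    then have "(\<Prod>b<n. F 0 (Suc b) * F (Suc b) l) = (\<Prod>b<n. - 1)" by (intro prod.cong) auto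
    then show ?thesis by (simp add: prod.distrib)
  qed
  have "inversion_sign g (orbit g x) = ((\<Prod>b<n. F 0 (Suc b)) * (\<Prod>a<n. F (Suc a) l)) * (?Q * ?Q)"
    unfolding orb step[OF order_refl] prod.distrib 1 2 by (simp only: mult_ac)
  also have "\<dots> = (- 1) ^ (card (orbit g x) - 1)"
    unfolding Q R orb card_image[OF inj] by (simp add: l)
  finally show ?thesis .
qed

lemma sum_inversion_sign:
  assumes g: "g permutes A" and A: "finite A"
  shows "(\<Sum>S | S \<subseteq> A \<and> g ` S = S. inversion_sign g S) =
    (\<Prod>C\<in>orbit g ` A. 1 + (- 1) ^ (card C - 1))"
proof -
  let ?O = "orbit g ` A"
  have perm: "permutation g" using A g by (auto simp: permutation_permutes)
  have self: "x \<in> orbit g x" for x using perm by (rule permutation_self_in_orbit)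
  have eq: "orbit g x = orbit g y" if "x \<in> orbit g y" for x y
    using orbit_cyclic_eq3[OF cyclic_on_orbit'[OF perm] that] .
  have disj: "pairwise disjnt ?O"
  proof (rule pairwiseI)
    fix C D assume C: "C \<in> ?O" and D: "D \<in> ?O" and ne: "C \<noteq> D"
    obtain x y where xy: "C = orbit g x" "D = orbit g y" using C D by blast
    show "disjnt C D"
    proof (rule ccontr)
      assume "\<not> disjnt C D"
      then obtain z where "z \<in> orbit g x" "z \<in> orbit g y" unfolding xy disjnt_def by blast
      then show False using ne eq[of z x] eq[of z y] unfolding xy by simp
    qed
  qed
  have finO: "finite C" if "C \<in> ?O" for C
    using that finite_orbit[OF self] by blast
  have gO: "g ` C = C" if O: "C \<in> ?O" for C
  proof -
    obtain x where x: "C = orbit g x" using O by blast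
    have "g ` orbit g x \<subseteq> orbit g x" by (auto intro: orbit.step)
    then show ?thesis unfolding x by (intro endo_inj_surj finite_orbit self permutes_inj_on[OF g])
  qed
  \<comment> \<open>This turns the sum over invariant sets into one over sets of orbits: orbits are
    disjoint and nonempty, so a union determines which of them it contains.\<close>
  have bij: "bij_betw Union (Pow ?O) {S. S \<subseteq> A \<and> g ` S = S}"
    unfolding bij_betw_def
  proof
    show "inj_on Union (Pow ?O)"
    proof (rule inj_onI)
      have sub: "\<T> \<subseteq> \<U>" if TU: "\<T> \<in> Pow ?O" "\<U> \<in> Pow ?O" "\<Union>\<T> = \<Union>\<U>" for \<T> \<U>
      proof
        fix C assume O: "C \<in> \<T>"
        then obtain x where x: "C = orbit g x" using TU by blast
        then have "x \<in> \<Union>\<U>" using O self TU(3) by blast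
        then obtain C' where C': "C' \<in> \<U>" "x \<in> C'" by blast
        then obtain y where "C' = orbit g y" using TU by blast
        then have "C' = C" using C' x eq by blast
        then show "C \<in> \<U>" using C' by simp
      qed
      show "\<T> = \<U>" if "\<T> \<in> Pow ?O" "\<U> \<in> Pow ?O" "\<Union>\<T> = \<Union>\<U>" for \<T> \<U>
        using sub[OF that] sub[OF that(2,1) that(3)[symmetric]] by (rule equalityI)
    qed
    show "Union ` Pow ?O = {S. S \<subseteq> A \<and> g ` S = S}"
    proof (intro equalityI subsetI)
      fix S assume "S \<in> Union ` Pow ?O"
      then obtain \<T> where T: "\<T> \<subseteq> ?O" "S = \<Union>\<T>" by blast
      have "S \<subseteq> A" unfolding T using T(1) permutes_orbit_subset[OF g] by blast
      moreover have "g ` S = S" 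
      proof -
        have "image g ` \<T> = \<T>" using T(1) gO by (auto simp: image_iff subset_iff)
        then show ?thesis unfolding T by (simp add: image_Union)
      qed
      ultimately show "S \<in> {S. S \<subseteq> A \<and> g ` S = S}" by simp
    next
      fix S assume "S \<in> {S. S \<subseteq> A \<and> g ` S = S}"
      then have S: "S \<subseteq> A" "g ` S = S" by auto
      have "orbit g x \<subseteq> S" if "x \<in> S" for x
      proof
        fix y assume "y \<in> orbit g x"
        then show "y \<in> S" by induction (use S that in auto)
      qed
      then have "S = \<Union>(orbit g ` S)" using self by blast
      then show "S \<in> Union ` Pow ?O" using S by blast
    qed
  qed
  have "(\<Sum>S | S \<subseteq> A \<and> g ` S = S. inversion_sign g S) = (\<Sum>\<T>\<in>Pow ?O. inversion_sign g (\<Union>\<T>))"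
    by (rule sum.reindex_bij_betw[OF bij, symmetric])
  also have "\<dots> = (\<Sum>\<T>\<in>Pow ?O. \<Prod>C\<in>\<T>. (- 1) ^ (card C - 1))"
  proof (rule sum.cong[OF refl])
    fix \<T> assume T: "\<T> \<in> Pow ?O"
    have "inversion_sign g (\<Union>\<T>) = (\<Prod>C\<in>\<T>. inversion_sign g C)"
    proof (rule inversion_sign_Union)
      show "finite \<T>" using T A finite_subset by blast
      show "finite C \<and> g ` C = C" if "C \<in> \<T>" for C using that T finO gO by blast
      show "pairwise disjnt \<T>" using disj T by (auto intro: pairwise_subset)
    qed (rule permutes_inj[OF g])
    also have "\<dots> = (\<Prod>C\<in>\<T>. (- 1) ^ (card C - 1))"
    proof (rule prod.cong[OF refl])
      fix C assume "C \<in> \<T>"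
      then obtain x where "C = orbit g x" using T by blast
      then show "inversion_sign g C = (- 1) ^ (card C - 1)"
        using inversion_sign_orbit[OF permutes_inj[OF g] self] by simp
    qed
    finally show "inversion_sign g (\<Union>\<T>) = (\<Prod>C\<in>\<T>. (- 1) ^ (card C - 1))" .
  qed
  \<comment> \<open>Expanding the product picks for each orbit either its sign, when the orbit is in
    the set, or 1, when it is left out.\<close>
  also have "\<dots> = (\<Prod>C\<in>?O. 1 + (- 1) ^ (card C - 1))"
    using prod_add[of ?O "\<lambda>C. (- 1) ^ (card C - 1) :: complex" "\<lambda>_. 1"] A by (simp add: add.commute)
  finally show ?thesis .
qed

section \<open>The exterior algebra of the standard representation\<close>

definition wedge_word :: "(nat \<Rightarrow> complex) list \<Rightarrow> nat set \<Rightarrow> complex" where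
  "wedge_word w = foldr wedge w (indicator_fun {})"

definition simple_vector :: "nat \<Rightarrow> nat \<Rightarrow> nat \<Rightarrow> complex" where
  "simple_vector m i = (\<lambda>k. indicator_fun i k - indicator_fun m k)"

definition basis_word :: "nat \<Rightarrow> nat set \<Rightarrow> (nat \<Rightarrow> complex) list" where
  "basis_word m S = map (simple_vector m) (sorted_list_of_set S)"

lemma standard_module_simps:
  "v \<in> carrier (standard_module m) \<longleftrightarrow> (\<forall>i. i \<notin> {1..m} \<longrightarrow> v i = 0) \<and> (\<Sum>i\<in>{1..m}. v i) = 0"
  "v \<oplus>\<^bsub>standard_module m\<^esub> w = (\<lambda>i. v i + w i)"
  "c \<odot>\<^bsub>standard_module m\<^esub> v = (\<lambda>i. c * v i)"
  by (auto simp: standard_module_def)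

interpretation std: exterior "standard_module m" for m
  by unfold_locales (auto simp: standard_module_simps sum.distrib simp flip: sum_distrib_left)

lemma foldr_wedge_linear:
  "foldr wedge a (\<lambda>S. f S + g S) = (\<lambda>S. foldr wedge a f S + foldr wedge a g S)"
  "foldr wedge a (\<lambda>S. c * f S) = (\<lambda>S. c * foldr wedge a f S)"
  "foldr wedge a (\<lambda>S. 0) = (\<lambda>S. 0)"
  by (induction a) (simp_all add: wedge_linear)

text \<open>Products in Fock space satisfy the exterior relations because \<open>wedge\<close> is
  linear in the vector and squares to 0. The linear map \<phi> serves two ends: the identity makes
  Fock coefficients well defined modulo the ideal, and a permutation makes its action so.\<close>

lemma wedge_word_ideal:
  assumes add: "\<And>v w. \<phi> (\<lambda>i. v i + w i) = (\<lambda>i. \<phi> v i + \<phi> w i)"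
    and smult: "\<And>c v. \<phi> (\<lambda>i. c * v i) = (\<lambda>i. c * \<phi> v i)"
    and f: "f \<in> exterior_ideal (standard_module m)"
  shows "linear_extension (\<lambda>w. wedge_word (map \<phi> w) S) f = 0"
  by (rule std.linear_extension_alternating[OF _ _ _ f])
    (simp_all add: wedge_word_def standard_module_simps add smult wedge_linear wedge_square foldr_wedge_linear)

lemma simple_vector_carrier:
  "i \<in> {1..<m} \<Longrightarrow> simple_vector m i \<in> carrier (standard_module m)"
  by (auto simp: standard_module_simps simple_vector_def indicator_fun_def sum_subtractf)

lemma simple_vectors_carrier:
  "set l \<subseteq> {1..<m} \<Longrightarrow> map (simple_vector m) l \<in> lists (carrier (standard_module m))"
proof (induction l)
  case (Cons i l)
  then have "simple_vector m i \<in> carrier (standard_module m)" by (intro simple_vector_carrier) simp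
  then show ?case using Cons by simp
qed simp

lemma basis_word_carrier:
  "S \<subseteq> {1..<m} \<Longrightarrow> basis_word m S \<in> lists (carrier (standard_module m))"
  unfolding basis_word_def using finite_subset[of S "{1..<m}"] by (intro simple_vectors_carrier) simp

section \<open>Straightening words into combinations of basis words\<close>

lemma convolution_zero: "convolution (\<lambda>u. 0) f = (\<lambda>u. 0)" "convolution f (\<lambda>u. 0) = (\<lambda>u. 0)"
  by (simp_all add: convolution_def fun_eq_iff)

text \<open>The new letter moves to the right past every smaller index, each swap costing -1, until
  it is in place or meets its own copy, where the product vanishes. The resulting sign is the one
  used in Fock space.\<close>

lemma word_simple_vector_insort:
  assumes "i \<in> {1..<m}" "sorted_wrt (<) l" "set l \<subseteq> {1..<m}"
  shows "std.cong m (word (simple_vector m i # map (simple_vector m) l))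
    (\<lambda>u. if i \<in> set l then 0 else insertion_sign i (set l) * word (map (simple_vector m) (insort i l)) u)"
  using assms(2,3)
proof (induction l)
  case Nil
  then show ?case by (simp add: insertion_sign_def)
next
  case (Cons j l)
  let ?b = "simple_vector m"
  let ?w = "word (map ?b l)"
  have bi: "?b i \<in> carrier (standard_module m)" and bj: "?b j \<in> carrier (standard_module m)"
    using assms(1) Cons.prems simple_vector_carrier by auto
  have wF: "?w \<in> carrier (free_algebra (carrier (standard_module m)))"
    using Cons.prems by (intro free_algebra_word simple_vectors_carrier) auto
  have jF: "word [?b j] \<in> carrier (free_algebra (carrier (standard_module m)))"
    using bj by (intro free_algebra_word) auto
  consider "i < j" | "i = j" | "j < i" by linarith
  then show ?case
  proof cases
    case 1
    have "i \<notin> set (j # l)" using 1 Cons.prems by auto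
    moreover have "insertion_sign i (set (j # l)) = 1"
      unfolding insertion_sign_def using 1 Cons.prems by (intro prod.neutral) (auto simp: pair_sign_def)
    ultimately show ?thesis using 1 by simp
  next
    case 2
    have "std.cong m (convolution (word [?b i, ?b i]) ?w) (convolution (\<lambda>u. 0) ?w)"
      by (rule std.cong_convolution(2)[OF std.cong_word_square[OF bi] wF])
    then show ?thesis using 2 by (simp add: convolution_zero)
  next
    case 3
    have ins: "insertion_sign i (set (j # l)) = - insertion_sign i (set l)"
      using 3 Cons.prems insertion_sign_insert[of "set l" j i] by (auto simp: pair_sign_def)
    have "std.cong m (convolution (word [?b i, ?b j]) ?w) (convolution (\<lambda>u. - 1 * word [?b j, ?b i] u) ?w)"
      by (rule std.cong_convolution(2)[OF std.cong_word_swap[OF bi bj] wF])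
    then have a: "std.cong m (word (?b i # ?b j # map ?b l)) (\<lambda>u. - 1 * word (?b j # ?b i # map ?b l) u)"
      by (simp only: convolution_distrib convolution_word append.simps)
    have "std.cong m (convolution (word [?b j]) (word (?b i # map ?b l)))
       (convolution (word [?b j]) (\<lambda>u. if i \<in> set l then 0 else insertion_sign i (set l) * word (map ?b (insort i l)) u))"
      using Cons by (intro std.cong_convolution(1)[OF _ jF]) auto
    also have "convolution (word [?b j]) (\<lambda>u. if i \<in> set l then 0 else insertion_sign i (set l) * word (map ?b (insort i l)) u)
      = (\<lambda>u. if i \<in> set l then 0 else insertion_sign i (set l) * word (?b j # map ?b (insort i l)) u)"
    proof (cases "i \<in> set l")
      case True
      then show ?thesis by (simp add: convolution_zero)
    next
      case False
      then show ?thesis by (simp add: convolution_distrib)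
    qed
    finally have "std.cong m (\<lambda>u. - 1 * word (?b j # ?b i # map ?b l) u)
      (\<lambda>u. - 1 * (if i \<in> set l then 0 else insertion_sign i (set l) * word (?b j # map ?b (insort i l)) u))"
      by (intro std.cong_cmult) simp
    from std.cong_trans[OF a this]
    have "std.cong m (word (?b i # ?b j # map ?b l))
      (\<lambda>u. - 1 * (if i \<in> set l then 0 else insertion_sign i (set l) * word (?b j # map ?b (insort i l)) u))" .
    also have "(\<lambda>u. - 1 * (if i \<in> set l then 0 else insertion_sign i (set l) * word (?b j # map ?b (insort i l)) u)) =
      (\<lambda>u. if i \<in> set (j # l) then 0 else insertion_sign i (set (j # l)) * word (map ?b (insort i (j # l))) u)"
      unfolding ins using 3 by (auto simp: fun_eq_iff)
    finally show ?thesis by simp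
  qed
qed

text \<open>The argument \<open>x\<close> may be nonzero at sets containing m; these values are
  ignored, because setting e_m to 0 identifies the exterior algebra of V with that of the first m -
  1 coordinates.\<close>

definition fock_lift :: "nat \<Rightarrow> (nat set \<Rightarrow> complex) \<Rightarrow> (nat \<Rightarrow> complex) list \<Rightarrow> complex" where
  "fock_lift m x = (\<lambda>u. \<Sum>S\<in>Pow {1..<m}. x S * word (basis_word m S) u)"

lemma fock_lift_carrier: "fock_lift m x \<in> carrier (free_algebra (carrier (standard_module m)))"
  unfolding fock_lift_def
  by (intro free_algebra_sum free_algebra_cmult free_algebra_word basis_word_carrier) auto

lemma word_standard_vector:
  assumes v: "v \<in> carrier (standard_module m)"
  shows "std.cong m (word [v]) (\<lambda>u. \<Sum>i\<in>{1..<m}. v i * word [simple_vector m i] u)"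
proof -
  let ?b = "simple_vector m"
  \<comment> \<open>Modulo the ideal, words are additive for two vectors at a time, so the expansion
    of v is assembled term by term, keeping the partial sums in the carrier.\<close>
  have gen: "(\<lambda>k. \<Sum>i\<in>I. v i * ?b i k) \<in> carrier (standard_module m) \<and>
    std.cong m (word [\<lambda>k. \<Sum>i\<in>I. v i * ?b i k]) (\<lambda>u. \<Sum>i\<in>I. v i * word [?b i] u)"
    if "finite I" "I \<subseteq> {1..<m}" for I using that
  proof (induction rule: finite_induct)
    case empty
    have z: "(\<lambda>k. 0) \<in> carrier (standard_module m)" by (simp add: standard_module_simps)
    show ?case using z std.cong_word_smult[OF z, of 0] by (simp add: standard_module_simps)
  next
    case (insert i I)
    let ?s = "\<lambda>k. \<Sum>i\<in>I. v i * ?b i k"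
    have s: "?s \<in> carrier (standard_module m)" "std.cong m (word [?s]) (\<lambda>u. \<Sum>i\<in>I. v i * word [?b i] u)"
      using insert by auto
    have b: "?b i \<in> carrier (standard_module m)" using insert by (intro simple_vector_carrier) auto
    have vb: "(\<lambda>k. v i * ?b i k) \<in> carrier (standard_module m)"
      using std.smult_closed[OF b, of "v i"] by (simp add: standard_module_simps(3))
    have 1: "std.cong m (word [\<lambda>k. v i * ?b i k + ?s k]) (\<lambda>u. word [\<lambda>k. v i * ?b i k] u + word [?s] u)"
      using std.cong_word_add[OF vb s(1)] by (simp only: standard_module_simps(2))
    have 2: "std.cong m (word [\<lambda>k. v i * ?b i k]) (\<lambda>u. v i * word [?b i] u)"
      using std.cong_word_smult[OF b, of "v i"] by (simp only: standard_module_simps(3))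
    have "std.cong m (word [\<lambda>k. v i * ?b i k + ?s k]) (\<lambda>u. v i * word [?b i] u + (\<Sum>i\<in>I. v i * word [?b i] u))"
      by (rule std.cong_trans[OF 1 std.cong_add[OF 2 s(2)]])
    moreover have "(\<lambda>k. v i * ?b i k + ?s k) \<in> carrier (standard_module m)"
      using std.add_closed[OF vb s(1)] by (simp only: standard_module_simps(2))
    ultimately show ?case using insert by simp
  qed
  have eq: "(\<lambda>k. \<Sum>i\<in>{1..<m}. v i * ?b i k) = v"
  proof
    fix k
    have eq: "(\<Sum>i\<in>{1..<m}. v i * ?b i k) = (if k \<in> {1..<m} then v k else 0) - (\<Sum>i\<in>{1..<m}. v i) * indicator_fun m k"
    proof -
      have "(\<Sum>i\<in>{1..<m}. v i * indicator_fun i k) = (\<Sum>i\<in>{1..<m}. if i = k then v i else 0)"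
        by (intro sum.cong) (auto simp: indicator_fun_def)
      then show ?thesis
        by (simp add: simple_vector_def right_diff_distrib sum_subtractf sum_distrib_right)
    qed
    \<comment> \<open>The coordinate at m is minus the sum of the others; for m = 0 there is no such
      coordinate and v is 0.\<close>
    have sum0: "m \<ge> 1 \<Longrightarrow> (\<Sum>i\<in>{1..<m}. v i) = - v m"
    proof -
      assume "m \<ge> 1"
      then have "{1..m} = insert m {1..<m}" by auto
      then have "(\<Sum>i\<in>{1..m}. v i) = v m + (\<Sum>i\<in>{1..<m}. v i)" by simp
      then show ?thesis using v by (simp add: standard_module_simps eq_neg_iff_add_eq_0 add.commute)
    qed
    show "(\<Sum>i\<in>{1..<m}. v i * ?b i k) = v k"
    proof (cases "m \<ge> 1")
      case True
      then show ?thesis unfolding eq sum0[OF True] using v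
        by (auto simp: indicator_fun_def standard_module_simps)
    next
      case False
      then show ?thesis unfolding eq using v by (auto simp: standard_module_simps)
    qed
  qed
  show ?thesis using conjunct2[OF gen[OF finite_atLeastLessThan order_refl]] unfolding eq .
qed

text \<open>At a set avoiding m, \<open>wedge v\<close> reads only the v i with i < m, and these are
  the coefficients of v with respect to the e_i - e_m. So multiplying by v and straightening yields
  the same coefficients as in Fock space.\<close>

lemma fock_lift_wedge:
  assumes v: "v \<in> carrier (standard_module m)"
  shows "std.cong m (convolution (word [v]) (fock_lift m x)) (fock_lift m (wedge v x))"
proof -
  let ?b = "simple_vector m" and ?P = "Pow {1..<m}"
  have fS: "finite S" if "S \<in> ?P" for S using that finite_subset[of S "{1..<m}"] by auto
  have "std.cong m (convolution (word [v]) (fock_lift m x))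
      (convolution (\<lambda>u. \<Sum>i\<in>{1..<m}. v i * word [?b i] u) (fock_lift m x))"
    by (rule std.cong_convolution(2)[OF word_standard_vector[OF v] fock_lift_carrier])
  also have "convolution (\<lambda>u. \<Sum>i\<in>{1..<m}. v i * word [?b i] u) (fock_lift m x)
    = (\<lambda>u. \<Sum>i\<in>{1..<m}. v i * (\<Sum>S\<in>?P. x S * word (?b i # basis_word m S) u))"
    unfolding fock_lift_def
    by (simp add: convolution_sum convolution_distrib sum_distrib_left) (rule ext, rule sum.swap)
  finally have 1: "std.cong m (convolution (word [v]) (fock_lift m x))
    (\<lambda>u. \<Sum>i\<in>{1..<m}. v i * (\<Sum>S\<in>?P. x S * word (?b i # basis_word m S) u))" .
  have 2: "std.cong m (\<lambda>u. \<Sum>i\<in>{1..<m}. v i * (\<Sum>S\<in>?P. x S * word (?b i # basis_word m S) u))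
    (\<lambda>u. \<Sum>i\<in>{1..<m}. v i * (\<Sum>S\<in>?P. x S * (if i \<in> S then 0 else insertion_sign i S * word (basis_word m (insert i S)) u)))"
  proof (intro std.cong_sum std.cong_cmult)
    fix i S assume i: "i \<in> {1..<m}" and S: "S \<in> ?P"
    have "std.cong m (word (?b i # map ?b (sorted_list_of_set S)))
      (\<lambda>u. if i \<in> set (sorted_list_of_set S) then 0 else insertion_sign i (set (sorted_list_of_set S)) *
        word (map ?b (insort i (sorted_list_of_set S))) u)"
      using i S fS[OF S] by (intro word_simple_vector_insort) auto
    moreover have "set (sorted_list_of_set S) = S" using fS[OF S] by simp
    moreover have "i \<notin> S \<Longrightarrow> insort i (sorted_list_of_set S) = sorted_list_of_set (insert i S)"
      using fS[OF S] by simp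
    ultimately show "std.cong m (word (?b i # basis_word m S))
      (\<lambda>u. if i \<in> S then 0 else insertion_sign i S * word (basis_word m (insert i S)) u)"
      by (cases "i \<in> S") (simp_all only: basis_word_def if_True if_False not_False_eq_True)
  qed
  have 3: "(\<Sum>i\<in>{1..<m}. v i * (\<Sum>S\<in>?P. x S * (if i \<in> S then 0 else insertion_sign i S * word (basis_word m (insert i S)) u)))
    = fock_lift m (wedge v x) u" for u
  proof -
    have "(\<Sum>i\<in>{1..<m}. v i * (\<Sum>S\<in>?P. x S * (if i \<in> S then 0 else insertion_sign i S * word (basis_word m (insert i S)) u)))
      = (\<Sum>(i, S)\<in>{1..<m} \<times> ?P. if i \<in> S then 0 else insertion_sign i S * v i * x S * word (basis_word m (insert i S)) u)"
      unfolding sum.cartesian_product[symmetric] sum_distrib_left by (intro sum.cong refl) simp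
    also have "\<dots> = (\<Sum>(i, S)\<in>{(i, S) \<in> {1..<m} \<times> ?P. i \<notin> S}. insertion_sign i S * v i * x S * word (basis_word m (insert i S)) u)"
      by (rule sum.mono_neutral_cong_right) auto
    \<comment> \<open>Renaming (i, S) to (T, i) with T = \<open>insert i S\<close> collects the
      terms that belong to one basis word.\<close>
    also have "\<dots> = (\<Sum>(T, i)\<in>(SIGMA T:?P. T). insertion_sign i T * v i * x (T - {i}) * word (basis_word m T) u)"
    proof (rule sum.reindex_bij_witness[where i = "\<lambda>(T, i). (i, T - {i})" and j = "\<lambda>(i, S). (insert i S, i)"])
      fix a assume "a \<in> {(i, S) \<in> {1..<m} \<times> ?P. i \<notin> S}"
      then obtain i S where a: "a = (i, S)" "i \<in> {1..<m}" "S \<in> ?P" "i \<notin> S" by auto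
      have "insert i S - {i} = S" using a by auto
      then show "(case case a of (i, S) \<Rightarrow> (insert i S, i) of (T, i) \<Rightarrow>
          insertion_sign i T * v i * x (T - {i}) * word (basis_word m T) u) =
        (case a of (i, S) \<Rightarrow> insertion_sign i S * v i * x S * word (basis_word m (insert i S)) u)"
        using fS[OF a(3)] by (simp add: a insertion_sign_self)
    qed auto
    also have "\<dots> = (\<Sum>T\<in>?P. \<Sum>i\<in>T. insertion_sign i T * v i * x (T - {i}) * word (basis_word m T) u)"
      using fS by (subst sum.Sigma) auto
    also have "\<dots> = fock_lift m (wedge v x) u"
      unfolding fock_lift_def wedge_def sum_distrib_right ..
    finally show ?thesis .
  qed
  show ?thesis using std.cong_trans[OF 1 2] unfolding 3 .
qed

lemma word_fock_lift:
  "w \<in> lists (carrier (standard_module m)) \<Longrightarrow> std.cong m (word w) (fock_lift m (wedge_word w))"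
proof (induction w)
  case Nil
  have "fock_lift m (wedge_word []) u = word [] u" for u
  proof -
    have "fock_lift m (wedge_word []) u = (\<Sum>S\<in>Pow {1..<m}. if S = {} then word [] u else 0)"
      unfolding fock_lift_def by (intro sum.cong) (auto simp: wedge_word_def indicator_fun_def basis_word_def)
    then show ?thesis by simp
  qed
  then have "fock_lift m (wedge_word []) = word []" by (rule ext)
  then show ?case by simp
next
  case (Cons v w)
  then have v: "v \<in> carrier (standard_module m)" and w: "w \<in> lists (carrier (standard_module m))" by auto
  have "std.cong m (convolution (word [v]) (word w)) (convolution (word [v]) (fock_lift m (wedge_word w)))"
    using Cons.IH[OF w] v by (intro std.cong_convolution(1) free_algebra_word) auto
  from std.cong_trans[OF this fock_lift_wedge[OF v]] show ?case by (simp add: wedge_word_def)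
qed

definition fock_coordinate :: "nat set \<Rightarrow> ((nat \<Rightarrow> complex) list \<Rightarrow> complex) \<Rightarrow> complex" where
  "fock_coordinate S = linear_extension (\<lambda>w. wedge_word w S)"

text \<open>The frame identity at the level of representatives; by linearity it reduces to single
  words, where it is \<open>word_fock_lift\<close>.\<close>

lemma fock_lift_coordinate:
  assumes f: "f \<in> carrier (free_algebra (carrier (standard_module m)))"
  shows "std.cong m f (fock_lift m (\<lambda>S. fock_coordinate S f))"
proof -
  let ?W = "{w. f w \<noteq> 0}"
  have "std.cong m (\<lambda>u. \<Sum>w\<in>?W. f w * word w u) (\<lambda>u. \<Sum>w\<in>?W. f w * fock_lift m (wedge_word w) u)"
    using f by (intro std.cong_sum std.cong_cmult word_fock_lift) (auto simp: free_algebra_simps(1))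
  also have "(\<lambda>u. \<Sum>w\<in>?W. f w * word w u) = f" using free_algebra_expand[OF f] by simp
  also have "(\<lambda>u. \<Sum>w\<in>?W. f w * fock_lift m (wedge_word w) u) = fock_lift m (\<lambda>S. fock_coordinate S f)"
    unfolding fock_lift_def fock_coordinate_def linear_extension_def
    by (simp add: sum_distrib_left sum_distrib_right mult.assoc sum.swap[of _ ?W])
  finally show ?thesis .
qed

section \<open>The action on the exterior algebra\<close>

text \<open>Each coefficient of the image is a linear functional of f, so linearity and
  compatibility with composition can be inherited from \<open>linear_extension\<close>.\<close>

lemma map_words_eval:
  assumes "finite {u. f u \<noteq> 0}"
  shows "map_words \<phi> f w = linear_extension (\<lambda>u. if map \<phi> u = w then 1 else 0) f"
proof -
  have "linear_extension (\<lambda>u. if map \<phi> u = w then 1 else 0) f = (\<Sum>u | f u \<noteq> 0. if map \<phi> u = w then f u else 0)"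
    unfolding linear_extension_def by (intro sum.cong) auto
  also have "\<dots> = (\<Sum>u\<in>{u \<in> {u. f u \<noteq> 0}. map \<phi> u = w}. f u)"
    using assms by (rule sum.inter_filter[symmetric])
  finally show ?thesis by (simp add: map_words_def)
qed

lemma map_words_word: "map_words \<phi> (word u) = word (map \<phi> u)"
proof
  fix w
  have "finite {v. word u v \<noteq> 0}" by (simp add: word_def)
  then show "map_words \<phi> (word u) w = word (map \<phi> u) w"
    by (simp add: map_words_eval) (simp add: word_def)
qed

lemma map_words_support: "{w. map_words \<phi> f w \<noteq> 0} \<subseteq> map \<phi> ` {u. f u \<noteq> 0}"
proof
  fix w assume "w \<in> {w. map_words \<phi> f w \<noteq> 0}"
  then have "(\<Sum>u | f u \<noteq> 0 \<and> map \<phi> u = w. f u) \<noteq> 0" by (simp add: map_words_def)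
  then obtain u where "u \<in> {u. f u \<noteq> 0 \<and> map \<phi> u = w}" by (meson sum.not_neutral_contains_not_neutral)
  then show "w \<in> map \<phi> ` {u. f u \<noteq> 0}" by auto
qed

lemma linear_extension_map_words:
  assumes f: "finite {u. f u \<noteq> 0}"
  shows "linear_extension E (map_words \<phi> f) = linear_extension (\<lambda>u. E (map \<phi> u)) f"
proof -
  let ?S = "{u. f u \<noteq> 0}"
  have "linear_extension E (map_words \<phi> f) = (\<Sum>w\<in>map \<phi> ` ?S. map_words \<phi> f w * E w)"
    using f by (intro linear_extension_superset map_words_support) simp
  also have "\<dots> = (\<Sum>w\<in>map \<phi> ` ?S. \<Sum>u | u \<in> ?S \<and> map \<phi> u = w. f u * E (map \<phi> u))"
    unfolding map_words_def sum_distrib_right by (intro sum.cong) auto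
  also have "\<dots> = (\<Sum>u\<in>?S. f u * E (map \<phi> u))"
    by (rule sum.image_gen[OF f, symmetric])
  finally show ?thesis by (simp add: linear_extension_def)
qed

lemma map_words_carrier:
  assumes "\<phi> \<in> X \<rightarrow> Y" "f \<in> carrier (free_algebra X)"
  shows "map_words \<phi> f \<in> carrier (free_algebra Y)"
proof -
  have "finite (map \<phi> ` {u. f u \<noteq> 0})" using assms by (simp add: free_algebra_simps(1))
  moreover have "map \<phi> ` {u. f u \<noteq> 0} \<subseteq> lists Y"
    using assms by (fastforce simp: free_algebra_simps(1) Pi_iff)
  ultimately show ?thesis using map_words_support[of \<phi> f]
    by (simp only: free_algebra_simps(1)) (meson finite_subset subset_trans)
qed

lemma map_words_linear:
  assumes "f \<in> carrier (free_algebra X)" "g \<in> carrier (free_algebra X)"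
  shows "map_words \<phi> (\<lambda>w. f w + g w) = (\<lambda>w. map_words \<phi> f w + map_words \<phi> g w)"
    and "map_words \<phi> (\<lambda>w. f w - g w) = (\<lambda>w. map_words \<phi> f w - map_words \<phi> g w)"
    and "map_words \<phi> (\<lambda>w. c * f w) = (\<lambda>w. c * map_words \<phi> f w)"
proof -
  have fin: "finite {w. h w \<noteq> 0}" if "h \<in> carrier (free_algebra X)" for h
    using that by (simp add: free_algebra_simps(1))
  have s: "(\<lambda>w. f w + g w) \<in> carrier (free_algebra X)" "(\<lambda>w. c * f w) \<in> carrier (free_algebra X)"
    using assms by (auto intro: free_algebra_add free_algebra_cmult)
  have "(\<lambda>w. f w + - 1 * g w) \<in> carrier (free_algebra X)"
    using assms by (intro free_algebra_add free_algebra_cmult)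
  then have d: "(\<lambda>w. f w - g w) \<in> carrier (free_algebra X)" by simp
  show "map_words \<phi> (\<lambda>w. f w + g w) = (\<lambda>w. map_words \<phi> f w + map_words \<phi> g w)"
    by (simp only: map_words_eval[OF fin[OF s(1)]] map_words_eval[OF fin[OF assms(1)]]
      map_words_eval[OF fin[OF assms(2)]] linear_extension_free_add[OF assms] fun_eq_iff simp_thms)
  show "map_words \<phi> (\<lambda>w. f w - g w) = (\<lambda>w. map_words \<phi> f w - map_words \<phi> g w)"
    by (simp only: map_words_eval[OF fin[OF d]] map_words_eval[OF fin[OF assms(1)]]
      map_words_eval[OF fin[OF assms(2)]] linear_extension_diff[OF assms] fun_eq_iff simp_thms)
  show "map_words \<phi> (\<lambda>w. c * f w) = (\<lambda>w. c * map_words \<phi> f w)"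
    by (simp only: map_words_eval[OF fin[OF s(2)]] map_words_eval[OF fin[OF assms(1)]]
      linear_extension_cmult fun_eq_iff simp_thms)
qed

lemma map_words_comp:
  assumes f: "f \<in> carrier (free_algebra X)" and \<psi>: "\<psi> \<in> X \<rightarrow> Y"
  shows "map_words \<phi> (map_words \<psi> f) = map_words (\<phi> \<circ> \<psi>) f"
proof
  fix w
  have fin: "finite {u. f u \<noteq> 0}" using f by (simp add: free_algebra_simps(1))
  have "finite {u. map_words \<psi> f u \<noteq> 0}"
    using map_words_carrier[OF \<psi> f] by (simp add: free_algebra_simps(1))
  then show "map_words \<phi> (map_words \<psi> f) w = map_words (\<phi> \<circ> \<psi>) f w"
    using fin by (simp add: map_words_eval linear_extension_map_words)
qed

lemma standard_action_carrier:
  assumes g: "g permutes {1..m}"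
  shows "standard_action g \<in> carrier (standard_module m) \<rightarrow> carrier (standard_module m)"
proof
  fix v assume v: "v \<in> carrier (standard_module m)"
  have g': "inv' g permutes {1..m}" using g by (rule permutes_inv)
  have "(\<Sum>i\<in>{1..m}. v (inv' g i)) = (\<Sum>i\<in>{1..m}. v i)"
    using sum.permute[OF g', of v] by (simp add: comp_def)
  moreover have "v (inv' g i) = 0" if "i \<notin> {1..m}" for i
    using v that permutes_not_in[OF g' that] by (simp add: standard_module_simps)
  ultimately show "standard_action g v \<in> carrier (standard_module m)"
    using v unfolding standard_module_simps standard_action_def by auto
qed

lemma standard_action_linear:
  "standard_action g (\<lambda>i. v i + w i) = (\<lambda>i. standard_action g v i + standard_action g w i)"
  "standard_action g (\<lambda>i. c * v i) = (\<lambda>i. c * standard_action g v i)"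
  by (simp_all add: standard_action_def)

lemma standard_action_comp:
  assumes "bij g" "bij h"
  shows "standard_action (g \<circ> h) = standard_action g \<circ> standard_action h"
  using assms by (simp add: standard_action_def fun_eq_iff o_inv_distrib)

lemma fock_coordinate_ideal:
  assumes "f \<in> exterior_ideal (standard_module m)"
  shows "fock_coordinate S f = 0"
  unfolding fock_coordinate_def using wedge_word_ideal[of "\<lambda>v. v" f m S, OF _ _ assms] by simp

lemma fock_coordinate_cong:
  assumes "std.cong m f g" "g \<in> carrier (free_algebra (carrier (standard_module m)))"
  shows "fock_coordinate S f = fock_coordinate S g"
proof -
  have "fock_coordinate S (\<lambda>w. f w - g w) = 0"
    using assms(1) unfolding std.cong_def by (rule fock_coordinate_ideal)
  then show ?thesis
    using linear_extension_diff[OF std.cong_carrier[OF assms] assms(2)] by (simp add: fock_coordinate_def)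
qed

text \<open>Invariance of the ideal is obtained without going back to its generators: the Fock
  coefficients of the image vanish by \<open>wedge_word_ideal\<close>, and an element with vanishing
  coefficients lies in the ideal by \<open>fock_lift_coordinate\<close>.\<close>

lemma cong_map_words:
  assumes g: "g permutes {1..m}" and fh: "std.cong m f h"
    and h: "h \<in> carrier (free_algebra (carrier (standard_module m)))"
  shows "std.cong m (map_words (standard_action g) f) (map_words (standard_action g) h)"
proof -
  let ?d = "\<lambda>w. f w - h w"
  have f: "f \<in> carrier (free_algebra (carrier (standard_module m)))"
    using std.cong_carrier[OF fh h] .
  have d: "?d \<in> exterior_ideal (standard_module m)" using fh unfolding std.cong_def .
  have dF: "?d \<in> carrier (free_algebra (carrier (standard_module m)))" using d by (rule std.ideal_carrier)
  have "fock_coordinate S (map_words (standard_action g) ?d) = 0" for S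
    using dF wedge_word_ideal[where \<phi> = "standard_action g", OF standard_action_linear d]
    by (simp add: fock_coordinate_def linear_extension_map_words free_algebra_simps(1))
  then have "std.cong m (map_words (standard_action g) ?d) (fock_lift m (\<lambda>S. 0))"
    using fock_lift_coordinate[OF map_words_carrier[OF standard_action_carrier[OF g] dF]] by simp
  then have "map_words (standard_action g) ?d \<in> exterior_ideal (standard_module m)"
    unfolding std.cong_def by (simp add: fock_lift_def)
  then show ?thesis unfolding std.cong_def map_words_linear(2)[OF f h] .
qed

lemma exterior_action_coset:
  assumes "g permutes {1..m}" "f \<in> carrier (free_algebra (carrier (standard_module m)))"
  shows "exterior_action m g (std.coset m f) = std.coset m (map_words (standard_action g) f)"
  unfolding exterior_action_def exterior_map_def
  by (rule std.exterior_lift_coset) (rule cong_map_words[OF assms(1) _ assms(2)])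

context
  fixes m :: nat
begin

abbreviation (input) EA where "EA \<equiv> exterior_algebra (standard_module m)"

lemma exterior_action_closed:
  assumes "g permutes {1..m}"
  shows "exterior_action m g \<in> carrier EA \<rightarrow> carrier EA"
  using map_words_carrier[OF standard_action_carrier[OF assms]]
  by (auto simp: std.exterior_algebra_simps exterior_action_coset[OF assms])

lemma exterior_action_add:
  assumes g: "g permutes {1..m}" and "x \<in> carrier EA" "y \<in> carrier EA"
  shows "exterior_action m g (x \<oplus>\<^bsub>EA\<^esub> y) = exterior_action m g x \<oplus>\<^bsub>EA\<^esub> exterior_action m g y"
proof -
  obtain f h where f: "f \<in> carrier (free_algebra (carrier (standard_module m)))" "x = std.coset m f"
    and h: "h \<in> carrier (free_algebra (carrier (standard_module m)))" "y = std.coset m h"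
    using assms(2,3) by (auto simp: std.exterior_algebra_simps)
  show ?thesis
    using f(1) h(1) free_algebra_add[OF f(1) h(1)]
    by (simp add: f(2) h(2) std.exterior_algebra_simps exterior_action_coset[OF g] map_words_linear(1)[OF f(1) h(1)])
qed

lemma exterior_action_smult:
  assumes g: "g permutes {1..m}" and "x \<in> carrier EA"
  shows "exterior_action m g (c \<odot>\<^bsub>EA\<^esub> x) = c \<odot>\<^bsub>EA\<^esub> exterior_action m g x"
proof -
  obtain f where f: "f \<in> carrier (free_algebra (carrier (standard_module m)))" "x = std.coset m f"
    using assms(2) by (auto simp: std.exterior_algebra_simps)
  show ?thesis
    using f(1) free_algebra_cmult[OF f(1)]
    by (simp add: f(2) std.exterior_algebra_simps exterior_action_coset[OF g] map_words_linear(3)[OF f(1) f(1)])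
qed

lemma exterior_action_comp:
  assumes g: "g permutes {1..m}" and h: "h permutes {1..m}" and "x \<in> carrier EA"
  shows "exterior_action m (g \<circ> h) x = exterior_action m g (exterior_action m h x)"
proof -
  obtain f where f: "f \<in> carrier (free_algebra (carrier (standard_module m)))" "x = std.coset m f"
    using assms(3) by (auto simp: std.exterior_algebra_simps)
  have "bij g" "bij h" using g h permutes_bij by blast+
  then show ?thesis
    using f(1) map_words_carrier[OF standard_action_carrier[OF h] f(1)]
    by (simp only: f(2) exterior_action_coset[OF permutes_compose[OF h g] f(1)] exterior_action_coset[OF h f(1)]
      exterior_action_coset[OF g] standard_action_comp map_words_comp[OF f(1) standard_action_carrier[OF h]])
qed

end

text \<open>On the carrier of the exterior algebra the choice of representative is harmless, as
  congruent elements have the same Fock coefficients.\<close>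

definition coset_coordinate :: "nat set \<Rightarrow> ((nat \<Rightarrow> complex) list \<Rightarrow> complex) set \<Rightarrow> complex" where
  "coset_coordinate S C = fock_coordinate S (SOME f. f \<in> C)"

lemma coset_coordinate:
  assumes "f \<in> carrier (free_algebra (carrier (standard_module m)))"
  shows "coset_coordinate S (std.coset m f) = fock_coordinate S f"
proof -
  have "f \<in> std.coset m f" by (simp add: std.coset_def)
  then have "(SOME h. h \<in> std.coset m f) \<in> std.coset m f"
    by (rule someI[where P = "\<lambda>h. h \<in> std.coset m f"])
  then have "std.cong m (SOME h. h \<in> std.coset m f) f" by (simp add: std.coset_def)
  then show ?thesis unfolding coset_coordinate_def using assms by (rule fock_coordinate_cong)
qed

lemma coset_coordinate_linear:
  assumes "x \<in> carrier (exterior_algebra (standard_module m))" "y \<in> carrier (exterior_algebra (standard_module m))"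
  shows "coset_coordinate S (x \<oplus>\<^bsub>exterior_algebra (standard_module m)\<^esub> y) = coset_coordinate S x + coset_coordinate S y"
    and "coset_coordinate S (c \<odot>\<^bsub>exterior_algebra (standard_module m)\<^esub> x) = c * coset_coordinate S x"
proof -
  obtain f h where f: "f \<in> carrier (free_algebra (carrier (standard_module m)))" "x = std.coset m f"
    and h: "h \<in> carrier (free_algebra (carrier (standard_module m)))" "y = std.coset m h"
    using assms by (auto simp: std.exterior_algebra_simps)
  show "coset_coordinate S (x \<oplus>\<^bsub>exterior_algebra (standard_module m)\<^esub> y) = coset_coordinate S x + coset_coordinate S y"
    using f(1) h(1) free_algebra_add[OF f(1) h(1)] linear_extension_free_add[OF f(1) h(1)]
    by (simp add: f(2) h(2) std.exterior_algebra_simps coset_coordinate fock_coordinate_def)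
  show "coset_coordinate S (c \<odot>\<^bsub>exterior_algebra (standard_module m)\<^esub> x) = c * coset_coordinate S x"
    using f(1) free_algebra_cmult[OF f(1)]
    by (simp add: f(2) std.exterior_algebra_simps coset_coordinate fock_coordinate_def linear_extension_cmult)
qed

definition exterior_basis :: "nat \<Rightarrow> nat set \<Rightarrow> ((nat \<Rightarrow> complex) list \<Rightarrow> complex) set" where
  "exterior_basis m S = std.coset m (word (basis_word m S))"

lemma exterior_basis_carrier:
  "S \<subseteq> {1..<m} \<Longrightarrow> exterior_basis m S \<in> carrier (exterior_algebra (standard_module m))"
  unfolding exterior_basis_def std.exterior_algebra_simps
  by (intro imageI free_algebra_word basis_word_carrier)

lemma exterior_basis_frame:
  assumes x: "x \<in> carrier (exterior_algebra (standard_module m))"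
  shows "(\<Oplus>\<^bsub>exterior_algebra (standard_module m)\<^esub>S\<in>Pow {1..<m}.
    coset_coordinate S x \<odot>\<^bsub>exterior_algebra (standard_module m)\<^esub> exterior_basis m S) = x"
proof -
  obtain f where f: "f \<in> carrier (free_algebra (carrier (standard_module m)))" "x = std.coset m f"
    using x by (auto simp: std.exterior_algebra_simps)
  have "(\<Oplus>\<^bsub>exterior_algebra (standard_module m)\<^esub>S\<in>Pow {1..<m}.
      std.coset m (\<lambda>w. fock_coordinate S f * word (basis_word m S) w)) =
      std.coset m (\<lambda>w. \<Sum>S\<in>Pow {1..<m}. fock_coordinate S f * word (basis_word m S) w)"
    by (rule std.finsum_coset) (auto intro!: free_algebra_cmult free_algebra_word basis_word_carrier)
  also have "\<dots> = x"
    using std.cong_sym[OF fock_lift_coordinate[OF f(1)]] unfolding f(2) std.coset_eq_iff fock_lift_def .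
  finally show ?thesis
    by (simp add: f(2) coset_coordinate[OF f(1)] exterior_basis_def std.exterior_algebra_simps)
qed

section \<open>Equivariance of \<open>wedge_word\<close> and its values on basis words\<close>

lemma wedge_word_action:
  assumes g: "bij g"
  shows "wedge_word (map (standard_action g) w) = fock_action g (wedge_word w)"
proof (induction w)
  case Nil
  have "fock_action g (indicator_fun {}) S = indicator_fun {} S" for S
  proof (cases "S = {}")
    case True
    then show ?thesis by (simp add: fock_action_def inversion_sign_def)
  next
    case False
    then have "g -` S \<noteq> {}" using g by (metis bij_is_surj surj_image_vimage_eq image_empty)
    then show ?thesis using False by (simp add: fock_action_def indicator_fun_def)
  qed
  then show ?case by (simp add: wedge_word_def fun_eq_iff)
next
  case (Cons v w)
  then show ?case using fock_action_wedge[OF g, of v "wedge_word w"]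
    by (simp add: wedge_word_def standard_action_def)
qed

text \<open>The index i precedes all of T and is inserted at the front without a sign, as happens
  with the head of an increasing list.\<close>

lemma wedge_indicator_insert:
  assumes "finite T" "\<And>j. j \<in> T \<Longrightarrow> i < j"
  shows "wedge (indicator_fun i) (indicator_fun T) = indicator_fun (insert i T)"
proof
  fix S
  show "wedge (indicator_fun i) (indicator_fun T) S = indicator_fun (insert i T) S"
  proof (cases "finite S")
    case True
    have "wedge (indicator_fun i) (indicator_fun T) S =
        (\<Sum>j\<in>S. if j = i then insertion_sign i S * indicator_fun T (S - {i}) else 0)"
      unfolding wedge_def by (intro sum.cong) (auto simp: indicator_fun_def)
    also have "\<dots> = (if i \<in> S then insertion_sign i S * indicator_fun T (S - {i}) else 0)"
      using True by simp
    also have "\<dots> = indicator_fun (insert i T) S"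
    proof (cases "S = insert i T")
      case eq: True
      have "insertion_sign i (insert i T) = 1"
        unfolding insertion_sign_def using assms(2) by (intro prod.neutral) (force simp: pair_sign_def)
      moreover have "insert i T - {i} = T" using assms(2) by auto
      ultimately show ?thesis by (simp add: eq indicator_fun_def)
    next
      case False
      then have "i \<in> S \<Longrightarrow> S - {i} \<noteq> T" by blast
      then show ?thesis using False by (simp add: indicator_fun_def)
    qed
    finally show ?thesis .
  next
    case False
    then have "S \<noteq> insert i T" using assms(1) by blast
    then show ?thesis using False by (simp add: wedge_def indicator_fun_def)
  qed
qed

text \<open>The reason for d u: multiplication by b = e_i - e_m anticommutes with d, because b has
  coordinate sum 0, and also with u, so b d u = d u b. In the product of b with e_S the part coming
  from e_m is killed by u, leaving that of e_i. The induction starts from d u 1 = 1.\<close>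

lemma wedge_word_simple_vectors:
  assumes "m \<ge> 1" "sorted_wrt (<) l" "set l \<subseteq> {1..<m}" "finite S"
  shows "wedge_word (map (simple_vector m) l) S =
    contract {1..m} (wedge (indicator_fun m) (indicator_fun (set l))) S"
  using assms(2-4)
proof (induction l arbitrary: S)
  case Nil
  have "contract {1..m} (indicator_fun {}) = (\<lambda>S. 0)"
    by (auto simp: contract_def indicator_fun_def)
  moreover have "(\<Sum>k\<in>{1..m}. indicator_fun m k) = 1" using assms(1) by (simp add: indicator_fun_def)
  ultimately show ?case
    using contract_wedge[of S "{1..m}" "indicator_fun m" "indicator_fun {}"] Nil
    by (simp add: wedge_word_def wedge_linear)
next
  case (Cons i l)
  let ?u = "wedge (indicator_fun m)" and ?d = "contract {1..m}" and ?x = "indicator_fun (set l)"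
  let ?b = "wedge (simple_vector m i)"
  have sum0: "(\<Sum>k\<in>{1..m}. simple_vector m i k) = 0"
    using simple_vector_carrier[of i m] Cons.prems by (simp add: standard_module_simps)
  have "wedge_word (map (simple_vector m) (i # l)) S = ?b (wedge_word (map (simple_vector m) l)) S"
    by (simp add: wedge_word_def)
  also have "\<dots> = ?b (?d (?u ?x)) S"
    using Cons by (intro wedge_cong) auto
  also have "\<dots> = - ?d (?b (?u ?x)) S"
    using contract_wedge[of S "{1..m}" "simple_vector m i" "?u ?x"] Cons.prems sum0
    by (simp add: eq_neg_iff_add_eq_0 add.commute)
  also have "?b (?u ?x) = (\<lambda>S. - 1 * ?u (?b ?x) S)"
    using wedge_anticommute[of "simple_vector m i" "indicator_fun m" ?x] by (simp add: fun_eq_iff)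
  also have "?b ?x = (\<lambda>S. wedge (indicator_fun i) ?x S + - 1 * ?u ?x S)"
    unfolding simple_vector_def wedge_linear(4) by simp
  also have "?u \<dots> = (\<lambda>S. ?u (wedge (indicator_fun i) ?x) S + - 1 * ?u (?u ?x) S)"
    by (simp only: wedge_linear)
  also have "wedge (indicator_fun i) ?x = indicator_fun (insert i (set l))"
    using Cons.prems by (intro wedge_indicator_insert) auto
  finally show ?case by (simp add: wedge_square contract_linear(3)[of _ "-1", simplified])
qed

lemma exterior_trace:
  assumes m: "m \<ge> 1" and g: "g permutes {1..m}"
  shows "(\<Sum>S\<in>Pow {1..<m}. coset_coordinate S (exterior_action m g (exterior_basis m S))) =
    (\<Prod>C\<in>orbit g ` {1..m}. 1 + (- 1) ^ (card C - 1)) / 2"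
proof -
  let ?u = "wedge (indicator_fun m)" and ?d = "contract {1..m}"
  have gb: "bij g" using g by (rule permutes_bij)
  have "(\<Sum>S\<in>Pow {1..<m}. coset_coordinate S (exterior_action m g (exterior_basis m S))) =
    (\<Sum>S\<in>Pow {1..<m}. fock_action g (?d (?u (indicator_fun S))) S)"
  proof (rule sum.cong[OF refl])
    fix S assume S: "S \<in> Pow {1..<m}"
    then have fS: "finite S" using finite_subset[of S "{1..<m}"] by auto
    have w: "word (basis_word m S) \<in> carrier (free_algebra (carrier (standard_module m)))"
      using S by (intro free_algebra_word basis_word_carrier) auto
    have "exterior_action m g (exterior_basis m S) = std.coset m (word (map (standard_action g) (basis_word m S)))"
      unfolding exterior_basis_def by (simp add: exterior_action_coset[OF g w] map_words_word)
    moreover have "word (map (standard_action g) (basis_word m S)) \<in> carrier (free_algebra (carrier (standard_module m)))"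
      using map_words_carrier[OF standard_action_carrier[OF g] w] by (simp add: map_words_word)
    ultimately have "coset_coordinate S (exterior_action m g (exterior_basis m S)) =
        fock_action g (wedge_word (basis_word m S)) S"
      by (simp add: coset_coordinate fock_coordinate_def wedge_word_action[OF gb])
    also have "\<dots> = fock_action g (?d (?u (indicator_fun S))) S"
    proof -
      have "finite (g -` S)" using fS gb by (simp add: finite_vimageI bij_is_inj)
      then have "wedge_word (basis_word m S) (g -` S) = ?d (?u (indicator_fun S)) (g -` S)"
        unfolding basis_word_def using S fS m
        by (subst wedge_word_simple_vectors) auto
      then show ?thesis by (simp add: fock_action_def)
    qed
    finally show "coset_coordinate S (exterior_action m g (exterior_basis m S)) =
      fock_action g (?d (?u (indicator_fun S))) S" .
  qed
  \<comment> \<open>Sets containing m may be added to the sum: u kills their products, in which e_m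
    would occur twice.\<close>
  also have "\<dots> = fock_trace {1..m} (\<lambda>f. fock_action g (?d (?u f)))"
    unfolding fock_trace_def
  proof (rule sum.mono_neutral_left)
    show "\<forall>S\<in>Pow {1..m} - Pow {1..<m}. fock_action g (?d (?u (indicator_fun S))) S = 0"
    proof
      fix S assume S: "S \<in> Pow {1..m} - Pow {1..<m}"
      have mS: "m \<in> S"
      proof (rule ccontr)
        assume "m \<notin> S"
        then have "S \<subseteq> {1..<m}" using S by (auto simp: le_less)
        then show False using S by simp
      qed
      have "?u (indicator_fun S) = (\<lambda>T. 0)"
      proof
        fix T
        show "?u (indicator_fun S) T = 0"
          unfolding wedge_def using mS by (intro sum.neutral) (auto simp: indicator_fun_def)
      qed
      then show "fock_action g (?d (?u (indicator_fun S))) S = 0"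
        by (simp add: contract_linear fock_action_def)
    qed
  qed auto
  also have "\<dots> = fock_trace {1..m} (fock_action g) / 2"
    using fock_trace_projection[of "{1..m}" m g] m g by (simp add: eq_divide_eq mult.commute)
  also have "\<dots> = (\<Prod>C\<in>orbit g ` {1..m}. 1 + (- 1) ^ (card C - 1)) / 2"
    using fock_trace_action[of "{1..m}" g] sum_inversion_sign[of g "{1..m}"] g by simp
  finally show ?thesis .
qed

section \<open>Characters of induced representations\<close>

text \<open>The set I labels the left cosets of H: t i represents a coset, and c g is the label of
  the coset of g. A copy of the frame of M on each coset gives a frame of the induced module; the
  functional for (i, k) evaluates at t i and then applies \<open>\<phi> k\<close>. Diagonal terms
  arise only from cosets fixed by p, which is the condition on i.\<close>

lemma induced_trace:
  fixes G :: "('g, 'k) monoid_scheme" and M :: "(complex, 'v, 'm) module_scheme"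
  assumes G: "group G" and H: "subgroup H G" and V: "vectorspace class_ring M"
    and I: "finite I" and t: "\<And>i. i \<in> I \<Longrightarrow> t i \<in> carrier G"
    and c: "\<And>g. g \<in> carrier G \<Longrightarrow> c g \<in> I"
    and c_rep: "\<And>g. g \<in> carrier G \<Longrightarrow> inv\<^bsub>G\<^esub> (t (c g)) \<otimes>\<^bsub>G\<^esub> g \<in> H"
    and c_right: "\<And>g h. g \<in> carrier G \<Longrightarrow> h \<in> H \<Longrightarrow> c (g \<otimes>\<^bsub>G\<^esub> h) = c g"
    and c_t: "\<And>i. i \<in> I \<Longrightarrow> c (t i) = i"
    and rho: "\<And>h. h \<in> H \<Longrightarrow> \<rho> h \<in> carrier M \<rightarrow> carrier M"
    and rho_add: "\<And>h x y. h \<in> H \<Longrightarrow> x \<in> carrier M \<Longrightarrow> y \<in> carrier M \<Longrightarrow> \<rho> h (x \<oplus>\<^bsub>M\<^esub> y) = \<rho> h x \<oplus>\<^bsub>M\<^esub> \<rho> h y"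
    and rho_smult: "\<And>h a x. h \<in> H \<Longrightarrow> x \<in> carrier M \<Longrightarrow> \<rho> h (a \<odot>\<^bsub>M\<^esub> x) = a \<odot>\<^bsub>M\<^esub> \<rho> h x"
    and rho_mult: "\<And>h k x. h \<in> H \<Longrightarrow> k \<in> H \<Longrightarrow> x \<in> carrier M \<Longrightarrow> \<rho> (h \<otimes>\<^bsub>G\<^esub> k) x = \<rho> h (\<rho> k x)"
    and K: "finite K" and e: "\<And>k. k \<in> K \<Longrightarrow> e k \<in> carrier M"
    and phi_add: "\<And>k x y. k \<in> K \<Longrightarrow> x \<in> carrier M \<Longrightarrow> y \<in> carrier M \<Longrightarrow> \<phi> k (x \<oplus>\<^bsub>M\<^esub> y) = \<phi> k x + \<phi> k y"
    and phi_smult: "\<And>k a x. k \<in> K \<Longrightarrow> x \<in> carrier M \<Longrightarrow> \<phi> k (a \<odot>\<^bsub>M\<^esub> x) = a * \<phi> k x"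
    and frame: "\<And>v. v \<in> carrier M \<Longrightarrow> (\<Oplus>\<^bsub>M\<^esub>k\<in>K. \<phi> k v \<odot>\<^bsub>M\<^esub> e k) = v"
    and p: "p \<in> carrier G"
  shows "trace (induced_module G H M \<rho>) (induced_action G p) =
    (\<Sum>i | i \<in> I \<and> c (inv\<^bsub>G\<^esub> p \<otimes>\<^bsub>G\<^esub> t i) = i. \<Sum>k\<in>K. \<phi> k (\<rho> (inv\<^bsub>G\<^esub> (t i) \<otimes>\<^bsub>G\<^esub> p \<otimes>\<^bsub>G\<^esub> t i) (e k)))"
proof -
  interpret G: group G by fact
  interpret H: subgroup H G by fact
  interpret M: vectorspace "class_ring :: complex ring" M by fact
  let ?N = "induced_module G H M \<rho>"
  have ag: "abelian_group M" ..
  have sm: "a \<odot>\<^bsub>M\<^esub> x \<in> carrier M" if "x \<in> carrier M" for a x using M.smult_closed that by simp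
  have rc: "\<rho> h x \<in> carrier M" if "h \<in> H" "x \<in> carrier M" for h x using rho[OF that(1)] that(2) by auto
  have r0: "\<rho> h \<zero>\<^bsub>M\<^esub> = \<zero>\<^bsub>M\<^esub>" if h: "h \<in> H" for h
    using rho_smult[OF h M.zero_closed, of 0] M.lmult_0[OF rc[OF h M.zero_closed]] M.lmult_0[OF M.zero_closed] by simp
  have Nc: "f \<in> carrier ?N \<longleftrightarrow> f \<in> carrier G \<rightarrow>\<^sub>E carrier M \<and>
      (\<forall>g\<in>carrier G. \<forall>h\<in>H. f (g \<otimes>\<^bsub>G\<^esub> h) = \<rho> (inv\<^bsub>G\<^esub> h) (f g))" for f
    by (simp add: induced_module_def)
  have Na: "f \<oplus>\<^bsub>?N\<^esub> f' = (\<lambda>g\<in>carrier G. f g \<oplus>\<^bsub>M\<^esub> f' g)" for f f' by (simp add: induced_module_def)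
  have Nz: "\<zero>\<^bsub>?N\<^esub> = (\<lambda>g\<in>carrier G. \<zero>\<^bsub>M\<^esub>)" by (simp add: induced_module_def)
  have Ns: "a \<odot>\<^bsub>?N\<^esub> f = (\<lambda>g\<in>carrier G. a \<odot>\<^bsub>M\<^esub> f g)" for a f by (simp add: induced_module_def)
  have val: "f g \<in> carrier M" if "f \<in> carrier ?N" "g \<in> carrier G" for f g
    using that unfolding Nc by auto
  have ext: "f = f'" if "f \<in> carrier ?N" "f' \<in> carrier ?N" "\<And>g. g \<in> carrier G \<Longrightarrow> f g = f' g" for f f'
    using that unfolding Nc by (auto intro: PiE_ext)
  have eqv: "f (g \<otimes>\<^bsub>G\<^esub> h) = \<rho> (inv\<^bsub>G\<^esub> h) (f g)" if "f \<in> carrier ?N" "g \<in> carrier G" "h \<in> H" for f g h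
    using that unfolding Nc by blast
  have hG: "h \<in> carrier G" if "h \<in> H" for h using that by (rule H.mem_carrier)
  have hi: "inv\<^bsub>G\<^esub> h \<in> H" if "h \<in> H" for h using that by (rule H.m_inv_closed)
  have add_c: "f \<oplus>\<^bsub>?N\<^esub> f' \<in> carrier ?N" if f: "f \<in> carrier ?N" and f': "f' \<in> carrier ?N" for f f'
    unfolding Nc Na using f f' by (auto simp: val eqv hG hi rho_add)
  have smult_c: "a \<odot>\<^bsub>?N\<^esub> f \<in> carrier ?N" if f: "f \<in> carrier ?N" for a f
    unfolding Nc Ns using f by (auto simp: val eqv hG hi rho_smult sm)
  have zero_c: "\<zero>\<^bsub>?N\<^esub> \<in> carrier ?N"
    unfolding Nc Nz by (auto simp: hG hi r0)
  have agN: "abelian_group ?N"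
  proof (rule abelian_groupI)
    fix x y z assume x: "x \<in> carrier ?N" and y: "y \<in> carrier ?N" and z: "z \<in> carrier ?N"
    show "x \<oplus>\<^bsub>?N\<^esub> y \<oplus>\<^bsub>?N\<^esub> z = x \<oplus>\<^bsub>?N\<^esub> (y \<oplus>\<^bsub>?N\<^esub> z)"
      using x y z by (intro ext add_c) (auto simp: Na val M.a_assoc)
  next
    fix x y assume x: "x \<in> carrier ?N" and y: "y \<in> carrier ?N"
    show "x \<oplus>\<^bsub>?N\<^esub> y \<in> carrier ?N" using add_c x y .
    show "x \<oplus>\<^bsub>?N\<^esub> y = y \<oplus>\<^bsub>?N\<^esub> x"
      using x y by (intro ext add_c) (auto simp: Na val M.a_comm)
  next
    fix x assume x: "x \<in> carrier ?N"
    show "\<zero>\<^bsub>?N\<^esub> \<oplus>\<^bsub>?N\<^esub> x = x"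
      using x zero_c by (intro ext add_c) (auto simp: Na Nz val)
    have "- 1 \<odot>\<^bsub>M\<^esub> v \<oplus>\<^bsub>M\<^esub> v = \<zero>\<^bsub>M\<^esub>" if v: "v \<in> carrier M" for v
      using M.smult_l_distr[of "- 1" 1 v] M.smult_one[OF v] M.lmult_0[OF v] v by simp
    then have "(- 1 \<odot>\<^bsub>?N\<^esub> x) \<oplus>\<^bsub>?N\<^esub> x = \<zero>\<^bsub>?N\<^esub>"
      using x by (intro ext add_c smult_c zero_c) (auto simp: Na Nz Ns val)
    then show "\<exists>y\<in>carrier ?N. y \<oplus>\<^bsub>?N\<^esub> x = \<zero>\<^bsub>?N\<^esub>" using smult_c[OF x] by blast
  qed (rule zero_c)
  have "Module.module class_ring ?N"
  proof (rule moduleI)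
    show "cring (class_ring :: complex ring)" by (rule class_cring.cring_axioms)
    show "abelian_group ?N" by (rule agN)
  next
    fix a x assume x: "x \<in> carrier ?N"
    show "a \<odot>\<^bsub>?N\<^esub> x \<in> carrier ?N" using smult_c x .
  next
    fix a b x assume x: "x \<in> carrier ?N"
    show "(a \<oplus>\<^bsub>class_ring\<^esub> b) \<odot>\<^bsub>?N\<^esub> x = a \<odot>\<^bsub>?N\<^esub> x \<oplus>\<^bsub>?N\<^esub> b \<odot>\<^bsub>?N\<^esub> x"
      using x M.smult_l_distr by (intro ext add_c smult_c) (auto simp: Na Ns val)
    show "(a \<otimes>\<^bsub>class_ring\<^esub> b) \<odot>\<^bsub>?N\<^esub> x = a \<odot>\<^bsub>?N\<^esub> (b \<odot>\<^bsub>?N\<^esub> x)"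
      using x M.smult_assoc1 by (intro ext smult_c) (auto simp: Ns val)
  next
    fix a x y assume x: "x \<in> carrier ?N" and y: "y \<in> carrier ?N"
    show "a \<odot>\<^bsub>?N\<^esub> (x \<oplus>\<^bsub>?N\<^esub> y) = a \<odot>\<^bsub>?N\<^esub> x \<oplus>\<^bsub>?N\<^esub> a \<odot>\<^bsub>?N\<^esub> y"
      using x y M.smult_r_distr by (intro ext add_c smult_c) (auto simp: Na Ns val)
  next
    fix x assume x: "x \<in> carrier ?N"
    show "\<one>\<^bsub>class_ring\<^esub> \<odot>\<^bsub>?N\<^esub> x = x"
      using x M.smult_one by (intro ext smult_c) (auto simp: Ns val)
  qed
  then have VN: "vectorspace class_ring ?N" by (simp add: vectorspace_def class_field)
  interpret N: abelian_group ?N by (rule agN)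
  have finsum_val: "(\<Oplus>\<^bsub>?N\<^esub>x\<in>X. F x) g = (\<Oplus>\<^bsub>M\<^esub>x\<in>X. F x g)"
    if "finite X" "F \<in> X \<rightarrow> carrier ?N" "g \<in> carrier G" for X g and F :: "'i \<times> 'j \<Rightarrow> 'g \<Rightarrow> 'v"
    using that
  proof (induction rule: finite_induct)
    case empty
    then show ?case by (simp add: Nz)
  next
    case (insert x X)
    have "(\<Oplus>\<^bsub>?N\<^esub>x\<in>insert x X. F x) = F x \<oplus>\<^bsub>?N\<^esub> (\<Oplus>\<^bsub>?N\<^esub>x\<in>X. F x)"
      using insert by (intro N.finsum_insert) auto
    moreover have "(\<Oplus>\<^bsub>M\<^esub>x\<in>insert x X. F x g) = F x g \<oplus>\<^bsub>M\<^esub> (\<Oplus>\<^bsub>M\<^esub>x\<in>X. F x g)"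
      using insert val by (intro M.finsum_insert) auto
    ultimately show ?case using insert by (simp add: Na)
  qed
  \<comment> \<open>Supported on the coset of t i, with the value
    \<open>\<rho> (inv h) (e k)\<close> at t i h that equivariance prescribes.\<close>
  define E where "E = (\<lambda>(i, k). \<lambda>g\<in>carrier G. if c g = i then \<rho> (inv\<^bsub>G\<^esub> g \<otimes>\<^bsub>G\<^esub> t i) (e k) else \<zero>\<^bsub>M\<^esub>)"
  have gt: "inv\<^bsub>G\<^esub> g \<otimes>\<^bsub>G\<^esub> t (c g) \<in> H" if g: "g \<in> carrier G" for g
    using hi[OF c_rep[OF g]] g t[OF c[OF g]] by (simp add: G.inv_mult_group)
  have E_c: "E (i, k) \<in> carrier ?N" if i: "i \<in> I" and k: "k \<in> K" for i k
  proof -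
    have "(if c (g \<otimes>\<^bsub>G\<^esub> h) = i then \<rho> (inv\<^bsub>G\<^esub> (g \<otimes>\<^bsub>G\<^esub> h) \<otimes>\<^bsub>G\<^esub> t i) (e k) else \<zero>\<^bsub>M\<^esub>) =
        \<rho> (inv\<^bsub>G\<^esub> h) (if c g = i then \<rho> (inv\<^bsub>G\<^esub> g \<otimes>\<^bsub>G\<^esub> t i) (e k) else \<zero>\<^bsub>M\<^esub>)"
      if g: "g \<in> carrier G" and h: "h \<in> H" for g h
    proof (cases "c g = i")
      case True
      have "inv\<^bsub>G\<^esub> (g \<otimes>\<^bsub>G\<^esub> h) \<otimes>\<^bsub>G\<^esub> t i = inv\<^bsub>G\<^esub> h \<otimes>\<^bsub>G\<^esub> (inv\<^bsub>G\<^esub> g \<otimes>\<^bsub>G\<^esub> t i)"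
        using g hG[OF h] t[OF i] by (simp add: G.inv_mult_group G.m_assoc)
      then show ?thesis
        using True c_right[OF g h] rho_mult[OF hi[OF h] gt[OF g] e[OF k]] by simp
    next
      case False
      then show ?thesis using c_right[OF g h] r0[OF hi[OF h]] by simp
    qed
    moreover have "\<rho> (inv\<^bsub>G\<^esub> g \<otimes>\<^bsub>G\<^esub> t i) (e k) \<in> carrier M" if "g \<in> carrier G" "c g = i" for g
      using rc[OF gt[OF that(1)] e[OF k]] that(2) by simp
    ultimately show ?thesis unfolding Nc E_def by (auto simp: hG)
  qed
  have "trace ?N (induced_action G p) =
    (\<Sum>(i, k)\<in>I \<times> K. \<phi> k (induced_action G p (E (i, k)) (t i)))"
  proof (subst trace_frame[OF VN, where K = "I \<times> K" and e = E and \<phi> = "\<lambda>(i, k) f. \<phi> k (f (t i))"])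
    show "finite (I \<times> K)" using I K by simp
    show "E x \<in> carrier ?N" if "x \<in> I \<times> K" for x using that E_c by auto
    show "induced_action G p \<in> carrier ?N \<rightarrow> carrier ?N"
    proof
      fix f assume f: "f \<in> carrier ?N"
      show "induced_action G p f \<in> carrier ?N"
        unfolding Nc induced_action_def using f p
        by (auto simp: val hG eqv[OF f, symmetric] G.m_assoc)
    qed
    show "induced_action G p (x \<oplus>\<^bsub>?N\<^esub> y) = induced_action G p x \<oplus>\<^bsub>?N\<^esub> induced_action G p y" for x y
      using p by (auto simp: induced_action_def Na)
    show "induced_action G p (a \<odot>\<^bsub>?N\<^esub> x) = a \<odot>\<^bsub>?N\<^esub> induced_action G p x" for a x
      using p by (auto simp: induced_action_def Ns)
    show "(case x of (i, k) \<Rightarrow> \<lambda>f. \<phi> k (f (t i))) (f \<oplus>\<^bsub>?N\<^esub> f') =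
      (case x of (i, k) \<Rightarrow> \<lambda>f. \<phi> k (f (t i))) f + (case x of (i, k) \<Rightarrow> \<lambda>f. \<phi> k (f (t i))) f'"
      if "x \<in> I \<times> K" "f \<in> carrier ?N" "f' \<in> carrier ?N" for x f f'
      using that by (auto simp: Na t val phi_add)
    show "(case x of (i, k) \<Rightarrow> \<lambda>f. \<phi> k (f (t i))) (a \<odot>\<^bsub>?N\<^esub> f) = a * (case x of (i, k) \<Rightarrow> \<lambda>f. \<phi> k (f (t i))) f"
      if "x \<in> I \<times> K" "f \<in> carrier ?N" for x a f
      using that by (auto simp: Ns t val phi_smult)
    show "(\<Oplus>\<^bsub>?N\<^esub>x\<in>I \<times> K. (case x of (i, k) \<Rightarrow> \<lambda>f. \<phi> k (f (t i))) f \<odot>\<^bsub>?N\<^esub> E x) = f"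
      if f: "f \<in> carrier ?N" for f
    proof (rule ext[OF _ f])
      let ?F = "\<lambda>x. (case x of (i, k) \<Rightarrow> \<lambda>f. \<phi> k (f (t i))) f \<odot>\<^bsub>?N\<^esub> E x"
      have F: "?F \<in> I \<times> K \<rightarrow> carrier ?N" using E_c smult_c by auto
      show "(\<Oplus>\<^bsub>?N\<^esub>x\<in>I \<times> K. ?F x) \<in> carrier ?N" using F by (rule N.finsum_closed)
      fix g assume g: "g \<in> carrier G"
      have Fgc: "?F x g \<in> carrier M" if "x \<in> I \<times> K" for x
        using funcset_mem[OF F that] g by (rule val)
      let ?i = "c g" and ?r = "\<rho> (inv\<^bsub>G\<^esub> g \<otimes>\<^bsub>G\<^esub> t (c g))"
      note i = c[OF g]
      have Fg: "(\<phi> k (f (t i)) \<odot>\<^bsub>?N\<^esub> E (i, k)) g = (if i = ?i then \<phi> k (f (t i)) \<odot>\<^bsub>M\<^esub> ?r (e k) else \<zero>\<^bsub>M\<^esub>)"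
        if "i \<in> I" "k \<in> K" for i k
        using g M.rmult_0 by (simp add: Ns E_def)
      have "(\<Oplus>\<^bsub>?N\<^esub>x\<in>I \<times> K. ?F x) g = (\<Oplus>\<^bsub>M\<^esub>x\<in>I \<times> K. ?F x g)"
        using I K F g by (intro finsum_val) auto
      \<comment> \<open>At g only the indices with i = c g survive. There the frame of M rebuilds
        the value of f at t (c g), and equivariance carries it from there to g.\<close>
      also have "\<dots> = (\<Oplus>\<^bsub>M\<^esub>x\<in>Pair ?i ` K. ?F x g)"
      proof (rule M.add.finprod_mono_neutral_cong_right)
        show "finite (I \<times> K)" using I K by simp
        show "Pair ?i ` K \<subseteq> I \<times> K" using i by auto
        show "?F x g = \<zero>\<^bsub>M\<^esub>" if "x \<in> I \<times> K - Pair ?i ` K" for x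
          using that Fg by (cases x) auto
        show "(\<lambda>x. ?F x g) \<in> I \<times> K \<rightarrow> carrier M" using Fgc by (rule Pi_I)
      qed simp
      also have "\<dots> = (\<Oplus>\<^bsub>M\<^esub>k\<in>K. ?F (?i, k) g)"
      proof (rule M.finsum_reindex)
        show "(\<lambda>x. ?F x g) \<in> Pair ?i ` K \<rightarrow> carrier M"
          by (rule Pi_I, rule Fgc) (use i in auto)
      qed (simp add: inj_on_def)
      also have "\<dots> = (\<Oplus>\<^bsub>M\<^esub>k\<in>K. ?r (\<phi> k (f (t ?i)) \<odot>\<^bsub>M\<^esub> e k))"
        using gt[OF g] i by (intro M.finsum_cong') (auto simp: Fg rho_smult rc e sm)
      also have "\<dots> = ?r (\<Oplus>\<^bsub>M\<^esub>k\<in>K. \<phi> k (f (t ?i)) \<odot>\<^bsub>M\<^esub> e k)"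
        using gt[OF g] e sm rho_add rho
        by (intro additive_finsum_endo[OF ag K, symmetric]) auto
      also have "\<dots> = ?r (f (t ?i))" using frame[OF val[OF f t[OF i]]] by simp
      also have "\<dots> = f (t ?i \<otimes>\<^bsub>G\<^esub> (inv\<^bsub>G\<^esub> (t ?i) \<otimes>\<^bsub>G\<^esub> g))"
        using eqv[OF f t[OF i] c_rep[OF g]] g t[OF i] by (simp add: G.inv_mult_group)
      also have "t ?i \<otimes>\<^bsub>G\<^esub> (inv\<^bsub>G\<^esub> (t ?i) \<otimes>\<^bsub>G\<^esub> g) = g"
        using g t[OF i] by (simp add: G.m_assoc[symmetric])
      finally show "(\<Oplus>\<^bsub>?N\<^esub>x\<in>I \<times> K. ?F x) g = f g" .
    qed
  qed (simp add: case_prod_unfold)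
  also have "\<dots> = (\<Sum>i\<in>I. \<Sum>k\<in>K. \<phi> k (induced_action G p (E (i, k)) (t i)))"
    by (rule sum.cartesian_product[symmetric])
  also have "\<dots> = (\<Sum>i\<in>I. if c (inv\<^bsub>G\<^esub> p \<otimes>\<^bsub>G\<^esub> t i) = i
      then \<Sum>k\<in>K. \<phi> k (\<rho> (inv\<^bsub>G\<^esub> (t i) \<otimes>\<^bsub>G\<^esub> p \<otimes>\<^bsub>G\<^esub> t i) (e k)) else 0)"
  proof (rule sum.cong[OF refl])
    fix i assume i: "i \<in> I"
    have phi0: "\<phi> k \<zero>\<^bsub>M\<^esub> = 0" if k: "k \<in> K" for k
      using phi_add[OF k M.zero_closed M.zero_closed] by simp
    have "inv\<^bsub>G\<^esub> (inv\<^bsub>G\<^esub> p \<otimes>\<^bsub>G\<^esub> t i) \<otimes>\<^bsub>G\<^esub> t i = inv\<^bsub>G\<^esub> (t i) \<otimes>\<^bsub>G\<^esub> p \<otimes>\<^bsub>G\<^esub> t i"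
      using p t[OF i] by (simp add: G.inv_mult_group)
    then have "induced_action G p (E (i, k)) (t i) = (if c (inv\<^bsub>G\<^esub> p \<otimes>\<^bsub>G\<^esub> t i) = i
        then \<rho> (inv\<^bsub>G\<^esub> (t i) \<otimes>\<^bsub>G\<^esub> p \<otimes>\<^bsub>G\<^esub> t i) (e k) else \<zero>\<^bsub>M\<^esub>)" for k
      using p t[OF i] by (simp add: induced_action_def E_def)
    then show "(\<Sum>k\<in>K. \<phi> k (induced_action G p (E (i, k)) (t i))) = (if c (inv\<^bsub>G\<^esub> p \<otimes>\<^bsub>G\<^esub> t i) = i
      then \<Sum>k\<in>K. \<phi> k (\<rho> (inv\<^bsub>G\<^esub> (t i) \<otimes>\<^bsub>G\<^esub> p \<otimes>\<^bsub>G\<^esub> t i) (e k)) else 0)"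
      using phi0 by simp
  qed
  also have "\<dots> = (\<Sum>i | i \<in> I \<and> c (inv\<^bsub>G\<^esub> p \<otimes>\<^bsub>G\<^esub> t i) = i.
      \<Sum>k\<in>K. \<phi> k (\<rho> (inv\<^bsub>G\<^esub> (t i) \<otimes>\<^bsub>G\<^esub> p \<otimes>\<^bsub>G\<^esub> t i) (e k)))"
    by (rule sum.inter_filter[OF I, symmetric])
  finally show ?thesis .
qed

section \<open>The formula\<close>

text \<open>Conjugation by the transposition carries cycles to cycles of the same length and moves
  the fixed point i to n. The removed cycle {i} accounts for \<open>F 1\<close>.\<close>

lemma prod_orbits_conjugate:
  fixes F :: "nat \<Rightarrow> 'a :: comm_monoid_mult" and n :: nat
  assumes p: "p permutes {1..n}" and i: "i \<in> {1..n}" and pi: "p i = i"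
  shows "(\<Prod>C\<in>orbit p ` {1..n}. F (card C)) =
    F 1 * (\<Prod>C\<in>orbit (transpose i n \<circ> p \<circ> transpose i n) ` {1..n - 1}. F (card C))"
proof -
  let ?t = "transpose i n" and ?q = "transpose i n \<circ> p \<circ> transpose i n"
  have perm: "permutation p" by (rule permutes_imp_permutation[OF finite_atLeastAtMost p])
  have self: "x \<in> orbit p x" for x using perm by (rule permutation_self_in_orbit)
  have oi: "orbit p i = {i}" using pi by (simp add: orbit_eq_singleton_iff)
  have orb: "orbit ?q (?t x) = ?t ` orbit p x" for x
    by (rule orbit_inverse[symmetric, OF self]) simp
  have "{1..n - 1} = ?t ` ({1..n} - {i})"
  proof -
    have "?t ` ({1..n} - {i}) = ?t ` {1..n} - ?t ` {i}"
      by (rule image_set_diff) simp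
    also have "?t ` {1..n} = {1..n}" using i by (intro transpose_image_eq) auto
    finally show ?thesis by auto
  qed
  then have "orbit ?q ` {1..n - 1} = image ?t ` orbit p ` ({1..n} - {i})"
    by (simp add: image_image orb)
  then have "(\<Prod>C\<in>orbit ?q ` {1..n - 1}. F (card C)) =
      (\<Prod>C\<in>orbit p ` ({1..n} - {i}). F (card (?t ` C)))"
    unfolding \<open>orbit ?q ` {1..n - 1} = _\<close>
    by (subst prod.reindex) (auto intro!: inj_onI simp: inj_image_eq_iff)
  also have "\<dots> = (\<Prod>C\<in>orbit p ` ({1..n} - {i}). F (card C))"
    by (intro prod.cong refl arg_cong[of _ _ F] card_image) simp
  finally have 1: "(\<Prod>C\<in>orbit ?q ` {1..n - 1}. F (card C)) = (\<Prod>C\<in>orbit p ` ({1..n} - {i}). F (card C))" .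
  have "orbit p ` {1..n} = insert {i} (orbit p ` ({1..n} - {i}))" using i oi by auto
  moreover have "{i} \<notin> orbit p ` ({1..n} - {i})"
  proof
    assume "{i} \<in> orbit p ` ({1..n} - {i})"
    then obtain x where "x \<noteq> i" "orbit p x = {i}" by blast
    then show False using self[of x] by simp
  qed
  ultimately show ?thesis unfolding 1 by simp
qed

lemma card_fixed_points:
  fixes n :: nat
  assumes p: "p permutes {1..n}"
  shows "card {i. i \<in> {1..n} \<and> p i = i} = count (cycle_type n p) 1"
proof -
  have perm: "permutation p" by (rule permutes_imp_permutation[OF finite_atLeastAtMost p])
  have self: "x \<in> orbit p x" for x using perm by (rule permutation_self_in_orbit)
  let ?O = "orbit p ` {1..n}"
  have "count (cycle_type n p) 1 = (\<Sum>C\<in>card -` {1} \<inter> ?O. count (mset_set ?O) C)"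
    unfolding cycle_type_def count_image_mset by (simp only: finite_set_mset_mset_set finite_imageI finite_atLeastAtMost)
  also have "\<dots> = (\<Sum>C\<in>{C \<in> ?O. card C = 1}. 1)"
    by (rule sum.cong) auto
  also have "\<dots> = card {C \<in> ?O. card C = 1}" by (rule card_eq_sum[symmetric])
  also have "{C \<in> orbit p ` {1..n}. card C = 1} = (\<lambda>i. {i}) ` {i. i \<in> {1..n} \<and> p i = i}"
  proof (intro equalityI subsetI)
    fix C assume "C \<in> {C \<in> orbit p ` {1..n}. card C = 1}"
    then obtain x where x: "x \<in> {1..n}" "C = orbit p x" "card C = 1" by blast
    then obtain y where "C = {y}" using card_1_singletonE by blast
    then have "C = {x}" "p x = x"
      using self[of x] x orbit_eq_singleton_iff[of p x] by auto
    then show "C \<in> (\<lambda>i. {i}) ` {i. i \<in> {1..n} \<and> p i = i}"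
      using x(1) by (intro image_eqI[of _ _ x]) simp_all
  next
    fix C assume "C \<in> (\<lambda>i. {i}) ` {i. i \<in> {1..n} \<and> p i = i}"
    then obtain i where i: "i \<in> {1..n}" "p i = i" "C = {i}" by blast
    have "C = orbit p i" using i orbit_eq_singleton_iff[of p i] by simp
    moreover have "card C = 1" using i by simp
    ultimately show "C \<in> {C \<in> orbit p ` {1..n}. card C = 1}" using i(1) by blast
  qed
  also have "card \<dots> = card {i. i \<in> {1..n} \<and> p i = i}" by (intro card_image) simp
  finally show ?thesis by simp
qed

lemma sym_group_subgroup: "m \<le> n \<Longrightarrow> subgroup (carrier (sym_group m)) (sym_group n)"
proof (rule group.subgroupI[OF sym_group_is_group])
  assume mn: "m \<le> n"
  have sub: "p permutes {1..n}" if "p permutes {1..m}" for p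
    using that by (rule permutes_subset) (use mn in auto)
  show "carrier (sym_group m) \<subseteq> carrier (sym_group n)" using sub by (auto simp: sym_group_carrier)
  show "carrier (sym_group m) \<noteq> {}"
    using permutes_id[of "{1..m}"] unfolding sym_group_carrier[symmetric] by blast
  show "inv\<^bsub>sym_group n\<^esub> p \<in> carrier (sym_group m)" if "p \<in> carrier (sym_group m)" for p
    using that sub by (simp add: sym_group_carrier permutes_inv)
  show "p \<otimes>\<^bsub>sym_group n\<^esub> q \<in> carrier (sym_group m)"
    if "p \<in> carrier (sym_group m)" "q \<in> carrier (sym_group m)" for p q
    using that by (simp add: sym_group_carrier sym_group_mult permutes_compose)
qed

text \<open>Left cosets of the stabiliser of n are distinguished by the image of n, and the
  transposition of i and n represents the coset sending n to i. This coset is fixed by p exactly if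
  p i = i; conjugation by the transposition then puts p into the subgroup.\<close>

lemma chi_eq_sum_fixed_points:
  assumes n: "2 \<le> n" and p: "p permutes {1..n}"
  shows "chi n p = (\<Sum>i | i \<in> {1..n} \<and> p i = i.
    (\<Prod>C\<in>orbit (transpose i n \<circ> p \<circ> transpose i n) ` {1..n - 1}. 1 + (- 1) ^ (card C - 1)) / 2)"
proof -
  let ?G = "sym_group n" and ?H = "carrier (sym_group (n - 1))" and ?t = "\<lambda>i. transpose i n"
  let ?M = "exterior_algebra (standard_module (n - 1))"
  have t: "?t i permutes {1..n}" if "i \<in> {1..n}" for i
    using that n by (intro permutes_swap_id) auto
  have Hn: "h n = n" if "h \<in> ?H" for h
    using that n unfolding sym_group_carrier by (intro permutes_not_in) auto
  have memH: "g \<in> ?H" if "g permutes {1..n}" "g n = n" for g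
  proof -
    have "g permutes {1..n - 1}"
      using that(1)
    proof (rule permutes_superset)
      show "g x = x" if "x \<in> {1..n} - {1..n - 1}" for x
      proof -
        have "x = n" using that by auto
        then show ?thesis using \<open>g n = n\<close> by simp
      qed
    qed
    then show ?thesis by (simp only: sym_group_carrier)
  qed
  have invG: "inv\<^bsub>?G\<^esub> g = inv' g" if "g permutes {1..n}" for g
    using that by (intro sym_group_inv_equality) (simp only: sym_group_carrier)
  have invt: "inv\<^bsub>?G\<^esub> (?t i) = ?t i" if "i \<in> {1..n}" for i
    using invG[OF t[OF that]] by simp
  have cH: "h permutes {1..n - 1}" if "h \<in> ?H" for h using that by (simp only: sym_group_carrier)
  have fixed: "(inv\<^bsub>?G\<^esub> p \<otimes>\<^bsub>?G\<^esub> ?t i) n = i \<longleftrightarrow> p i = i" if "i \<in> {1..n}" for i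
    using permutes_inv_eq[OF p, of i i] by (simp add: invG[OF p] sym_group_mult)
  have "chi n p = (\<Sum>i | i \<in> {1..n} \<and> (inv\<^bsub>?G\<^esub> p \<otimes>\<^bsub>?G\<^esub> ?t i) n = i. \<Sum>S\<in>Pow {1..<n - 1}.
      coset_coordinate S (exterior_action (n - 1) (inv\<^bsub>?G\<^esub> (?t i) \<otimes>\<^bsub>?G\<^esub> p \<otimes>\<^bsub>?G\<^esub> ?t i) (exterior_basis (n - 1) S)))"
    unfolding chi_def character_def
  proof (rule induced_trace[where c = "\<lambda>g. g n"])
    show "group ?G" by (rule sym_group_is_group)
    show "subgroup ?H ?G" by (rule sym_group_subgroup) simp
    show "vectorspace class_ring ?M" by (rule std.exterior_algebra_vectorspace)
    show "?t i \<in> carrier ?G" if "i \<in> {1..n}" for i using t[OF that] by (simp only: sym_group_carrier)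
    show gn: "g n \<in> {1..n}" if "g \<in> carrier ?G" for g
      using that n permutes_in_image[of g "{1..n}" n] unfolding sym_group_carrier by auto
    show "inv\<^bsub>?G\<^esub> (?t (g n)) \<otimes>\<^bsub>?G\<^esub> g \<in> ?H" if g: "g \<in> carrier ?G" for g
    proof (rule memH)
      show "(inv\<^bsub>?G\<^esub> (?t (g n)) \<otimes>\<^bsub>?G\<^esub> g) permutes {1..n}"
        unfolding invt[OF gn[OF g]] sym_group_mult
        using g t[OF gn[OF g]] unfolding sym_group_carrier by (intro permutes_compose)
      show "(inv\<^bsub>?G\<^esub> (?t (g n)) \<otimes>\<^bsub>?G\<^esub> g) n = n"
        unfolding invt[OF gn[OF g]] sym_group_mult by simp
    qed
    show "(g \<otimes>\<^bsub>?G\<^esub> h) n = g n" if "h \<in> ?H" for g h using Hn[OF that] by (simp add: sym_group_mult)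
    show "?t i n = i" for i by simp
    show "exterior_action (n - 1) h \<in> carrier ?M \<rightarrow> carrier ?M" if "h \<in> ?H" for h
      by (rule exterior_action_closed[OF cH[OF that]])
    show "exterior_action (n - 1) h (x \<oplus>\<^bsub>?M\<^esub> y) = exterior_action (n - 1) h x \<oplus>\<^bsub>?M\<^esub> exterior_action (n - 1) h y"
      if "h \<in> ?H" "x \<in> carrier ?M" "y \<in> carrier ?M" for h x y
      by (rule exterior_action_add[OF cH[OF that(1)] that(2,3)])
    show "exterior_action (n - 1) h (a \<odot>\<^bsub>?M\<^esub> x) = a \<odot>\<^bsub>?M\<^esub> exterior_action (n - 1) h x"
      if "h \<in> ?H" "x \<in> carrier ?M" for h a x
      by (rule exterior_action_smult[OF cH[OF that(1)] that(2)])
    show "exterior_action (n - 1) (h \<otimes>\<^bsub>?G\<^esub> k) x = exterior_action (n - 1) h (exterior_action (n - 1) k x)"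
      if "h \<in> ?H" "k \<in> ?H" "x \<in> carrier ?M" for h k x
      unfolding sym_group_mult by (rule exterior_action_comp[OF cH[OF that(1)] cH[OF that(2)] that(3)])
    show "exterior_basis (n - 1) S \<in> carrier ?M" if "S \<in> Pow {1..<n - 1}" for S
      using that by (intro exterior_basis_carrier) (rule PowD)
    show "coset_coordinate S (x \<oplus>\<^bsub>?M\<^esub> y) = coset_coordinate S x + coset_coordinate S y"
      if "x \<in> carrier ?M" "y \<in> carrier ?M" for S x y
      by (rule coset_coordinate_linear(1)[OF that])
    show "coset_coordinate S (a \<odot>\<^bsub>?M\<^esub> x) = a * coset_coordinate S x" if "x \<in> carrier ?M" for S a x
      by (rule coset_coordinate_linear(2)[OF that that])
    show "(\<Oplus>\<^bsub>?M\<^esub>S\<in>Pow {1..<n - 1}. coset_coordinate S x \<odot>\<^bsub>?M\<^esub> exterior_basis (n - 1) S) = x"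
      if "x \<in> carrier ?M" for x
      by (rule exterior_basis_frame[OF that])
    show "p \<in> carrier ?G" using p by (simp only: sym_group_carrier)
  qed simp_all
  also have "\<dots> = (\<Sum>i | i \<in> {1..n} \<and> p i = i.
    (\<Prod>C\<in>orbit (?t i \<circ> p \<circ> ?t i) ` {1..n - 1}. 1 + (- 1) ^ (card C - 1)) / 2)"
  proof (rule sum.cong)
    show "{i. i \<in> {1..n} \<and> (inv\<^bsub>?G\<^esub> p \<otimes>\<^bsub>?G\<^esub> ?t i) n = i} = {i. i \<in> {1..n} \<and> p i = i}"
      using fixed by blast
    fix i assume "i \<in> {i. i \<in> {1..n} \<and> p i = i}"
    then have i: "i \<in> {1..n}" "p i = i" by simp_all
    have e: "inv\<^bsub>?G\<^esub> (?t i) \<otimes>\<^bsub>?G\<^esub> p \<otimes>\<^bsub>?G\<^esub> ?t i = ?t i \<circ> p \<circ> ?t i"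
      unfolding invt[OF i(1)] sym_group_mult ..
    have "?t i \<circ> p \<circ> ?t i \<in> ?H"
    proof (rule memH)
      show "?t i \<circ> p \<circ> ?t i permutes {1..n}" using t[OF i(1)] p by (intro permutes_compose)
    qed (simp add: i(2))
    \<comment> \<open>Here 2 \<le> n matters: \<open>exterior_trace\<close> needs m = n - 1 to be
      positive. For m = 0 the exterior algebra is one-dimensional and the identity has trace 1,
      whereas the formula would give 1/2.\<close>
    then show "(\<Sum>S\<in>Pow {1..<n - 1}. coset_coordinate S (exterior_action (n - 1)
        (inv\<^bsub>?G\<^esub> (?t i) \<otimes>\<^bsub>?G\<^esub> p \<otimes>\<^bsub>?G\<^esub> ?t i) (exterior_basis (n - 1) S))) =
      (\<Prod>C\<in>orbit (?t i \<circ> p \<circ> ?t i) ` {1..n - 1}. 1 + (- 1) ^ (card C - 1)) / 2"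
      unfolding e using n by (intro exterior_trace cH) auto
  qed
  finally show ?thesis .
qed

theorem theorem9p1:
  fixes n r s :: nat and \<mu> :: "nat list" and p :: "nat \<Rightarrow> nat"
  assumes "2 \<le> n"
    and "length \<mu> = r + s" and "sorted_wrt (\<ge>) \<mu>" and "sum_list \<mu> = n"
    and "\<forall>j<r. 1 < \<mu> ! j"
    and "\<forall>j. r \<le> j \<and> j < r + s \<longrightarrow> \<mu> ! j = 1"
    and "p \<in> carrier (sym_group n)" and "cycle_type n p = mset \<mu>"
  shows "chi n p = 1 / 4 * of_nat s * (\<Prod>j<r + s. 1 + (- 1) ^ (\<mu> ! j - 1))"
proof -
  let ?F = "\<lambda>l :: nat. 1 + (- 1) ^ (l - 1) :: complex"
  have p: "p permutes {1..n}" using assms(7) by (simp only: sym_group_carrier)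
  have "(\<Prod>C\<in>orbit p ` {1..n}. ?F (card C)) = prod_mset (image_mset ?F (cycle_type n p))"
    by (simp add: cycle_type_def prod_unfold_prod_mset image_mset.compositionality comp_def)
  also have "\<dots> = prod_list (map ?F \<mu>)"
    unfolding assms(8) by (metis mset_map prod_mset_prod_list)
  also have "\<dots> = (\<Prod>j<r + s. ?F (\<mu> ! j))"
    by (simp add: prod.list_conv_set_nth assms(2) atLeast0LessThan)
  finally have P: "(\<Prod>C\<in>orbit p ` {1..n}. ?F (card C)) = (\<Prod>j<r + s. ?F (\<mu> ! j))" .
  have "card {i. i \<in> {1..n} \<and> p i = i} = length (filter ((=) 1) \<mu>)"
    unfolding card_fixed_points[OF p] assms(8) count_mset count_list_eq_length_filter ..
  also have "\<dots> = card {j. j < r + s \<and> 1 = \<mu> ! j}"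
    by (simp add: length_filter_conv_card assms(2))
  also have "{j. j < r + s \<and> 1 = \<mu> ! j} = {r..<r + s}"
    using assms(5,6) by (auto simp: not_less[symmetric])
  finally have S: "card {i. i \<in> {1..n} \<and> p i = i} = s" by simp
  \<comment> \<open>The denominator 4 collects the 1/2 of \<open>exterior_trace\<close> and the
    factor 1 + (-1)^0 = 2 of the deleted cycle. The summand no longer depends on i, so the sum just
    counts fixed points.\<close>
  have "chi n p = (\<Sum>i | i \<in> {1..n} \<and> p i = i. (\<Prod>j<r + s. ?F (\<mu> ! j)) / 4)"
    unfolding chi_eq_sum_fixed_points[OF assms(1) p]
  proof (rule sum.cong[OF refl])
    fix i assume "i \<in> {i. i \<in> {1..n} \<and> p i = i}"
    then have "i \<in> {1..n}" "p i = i" by simp_all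
    from prod_orbits_conjugate[OF p this, of ?F]
    show "(\<Prod>C\<in>orbit (transpose i n \<circ> p \<circ> transpose i n) ` {1..n - 1}. 1 + (- 1) ^ (card C - 1)) / 2 =
        (\<Prod>j<r + s. ?F (\<mu> ! j)) / 4"
      unfolding P by simp
  qed
  also have "\<dots> = of_nat s * ((\<Prod>j<r + s. ?F (\<mu> ! j)) / 4)"
    unfolding sum_constant S ..
  finally show ?thesis by simp
qed

end
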